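(* There are absolute constants $C>0$, $c>0$ and $\epsilon_0>0$ such that the following holds. Let $\mathcal{H}$ be any class of functions $\mathcal{X}\to\{0,1\}$ and let $S\subseteq\mathcal{X}$ be any subset with $2\le \mathsf{VC}_S(\mathcal{H})<\infty$. If $|S|>5\,\mathsf{VC}_S(\mathcal{H})$ and $\mathsf{LVC}_S(\mathcal{H})\ge C\cdot \mathsf{VC}_S(\mathcal{H})^{3/4}\sqrt{\log \mathsf{VC}_S(\mathcal{H})}$, then for every $0<\epsilon<\epsilon_0$, $$m^{\mathrm{test}}_\epsilon(\mathcal{H})\;\ge\; c\cdot\frac{\mathsf{LVC}_S(\mathcal{H})^2}{\mathsf{VC}_S(\mathcal{H})\,\log \mathsf{VC}_S(\mathcal{H})}.$$ Moreover, this bound is tight: for every sufficiently small constant $\epsilon>0$ there are classes $\mathcal{H}$ and sets $S$ satisfying these hypotheses, with $\mathsf{VC}_S(\mathcal{H})$ arbitrarily large, for which $m^{\mathrm{test}}_\epsilon(\mathcal{H})=\Theta\left(\frac{\mathsf{LVC}_S(\mathcal{H})^2}{\mathsf{VC}_S(\mathcal{H})\log \mathsf{VC}_S(\mathcal{H})}\right)$ (with implied constants depending only on $\epsilon$).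
   Context: A finite set $T\subseteq\mathcal{X}$ is shattered by $\mathcal{H}$ if for every $\ell:T\to\{0,1\}$ there is $f\in\mathcal{H}$ agreeing with $\ell$ on all of $T$. For $S\subseteq\mathcal{X}$, $\mathsf{VC}_S(\mathcal{H})=\max\{k:\exists\, T\subseteq S,\ |T|=k,\ T\text{ is shattered by }\mathcal{H}\}$ and $\mathsf{LVC}_S(\mathcal{H})=\max\{k\le |S|:\forall\, T\subseteq S\text{ with }|T|=k,\ T\text{ is shattered by }\mathcal{H}\}$. For a probability distribution $\mathcal{D}$ on $\mathcal{X}$, $\mathrm{dist}_{\mathcal{D}}(f,g)=\Pr_{x\sim\mathcal{D}}[f(x)\ne g(x)]$ and $\mathrm{dist}_{\mathcal{D}}(f,\mathcal{H})=\inf_{h\in\mathcal{H}}\mathrm{dist}_{\mathcal{D}}(f,h)$. A distribution-free sample-based $\epsilon$-tester for $\mathcal{H}$ with sample complexity $m$ is a (computationally unbounded) randomized algorithm which, for every unknown probability distribution $\mathcal{D}$ on $\mathcal{X}$ (all finitely supported distributions are allowed) and every unknown $f:\mathcal{X}\to\{0,1\}$, receives $m$ labelled examples $(x,f(x))$ with $x$ drawn independently from $\mathcal{D}$, and accepts with probability at least $2/3$ if $f\in\mathcal{H}$ and rejects with probability at least $2/3$ if $\mathrm{dist}_{\mathcal{D}}(f,\mathcal{H})\ge\epsilon$. $m^{\mathrm{test}}_\epsilon(\mathcal{H})$ is the minimum $m$ for which such a tester exists ($\infty$ if none exists). *)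

theory Defs
  imports "HOL-Probability.Probability"
begin

text \<open>
  A class over the domain \<open>X\<close> is a set of extensional functions \<open>X \<rightarrow>\<^sub>E UNIV\<close> into \<^typ>\<open>bool\<close>
  (\<open>True\<close> is 1, \<open>False\<close> is 0).
\<close>

definition shatters :: "('a \<Rightarrow> bool) set \<Rightarrow> 'a set \<Rightarrow> bool" where
  "shatters H T \<longleftrightarrow> finite T \<and> (\<forall>l :: 'a \<Rightarrow> bool. \<exists>f\<in>H. \<forall>x\<in>T. f x = l x)"

text \<open>
  Suprema in \<^typ>\<open>enat\<close>, so that the values exist without further assumptions. For nonempty \<open>H\<close> both
  sets contain 0, and a finite supremum is a maximum. Moreover \<open>LVC S H \<le> VC S H\<close>.
\<close>

definition VC :: "'a set \<Rightarrow> ('a \<Rightarrow> bool) set \<Rightarrow> enat" where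
  "VC S H = Sup {enat k |k. \<exists>T\<subseteq>S. finite T \<and> card T = k \<and> shatters H T}"

definition LVC :: "'a set \<Rightarrow> ('a \<Rightarrow> bool) set \<Rightarrow> enat" where
  "LVC S H = Sup {enat k |k. (finite S \<longrightarrow> k \<le> card S) \<and>
     (\<forall>T\<subseteq>S. finite T \<and> card T = k \<longrightarrow> shatters H T)}"

definition dist_fun :: "'a pmf \<Rightarrow> ('a \<Rightarrow> bool) \<Rightarrow> ('a \<Rightarrow> bool) \<Rightarrow> real" where
  "dist_fun D f g = measure_pmf.prob D {x. f x \<noteq> g x}"

text \<open>Only meaningful for nonempty \<open>H\<close>; a class with \<open>VC S H \<ge> 2\<close> is nonempty.\<close>

definition dist_class :: "'a pmf \<Rightarrow> ('a \<Rightarrow> bool) \<Rightarrow> ('a \<Rightarrow> bool) set \<Rightarrow> real" where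
  "dist_class D f H = (INF h\<in>H. dist_fun D f h)"

text \<open>
  A randomized algorithm maps the list of \<open>m\<close> labelled examples to a distribution over
  \<open>True\<close> (accept) and \<open>False\<close> (reject). The internal randomness is independent of the sample.
\<close>

definition run_tester ::
  "(('a \<times> bool) list \<Rightarrow> bool pmf) \<Rightarrow> nat \<Rightarrow> 'a pmf \<Rightarrow> ('a \<Rightarrow> bool) \<Rightarrow> bool pmf" where
  "run_tester A m D f = bind_pmf (replicate_pmf m (map_pmf (\<lambda>x. (x, f x)) D)) A"

text \<open>
  The distributions on \<open>X\<close> are the discrete ones, in particular all finitely supported ones; no
  measurability condition on \<open>f\<close> and \<open>H\<close> arises. Admitting further distributions can only increase
  the sample complexity, so lower bounds for it carry over. On a countable domain (with all subsets
  measurable) these are all the probability distributions.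
\<close>

definition is_tester ::
  "'a set \<Rightarrow> ('a \<Rightarrow> bool) set \<Rightarrow> real \<Rightarrow> nat \<Rightarrow> (('a \<times> bool) list \<Rightarrow> bool pmf) \<Rightarrow> bool" where
  "is_tester X H \<epsilon> m A \<longleftrightarrow>
     (\<forall>D f. set_pmf D \<subseteq> X \<longrightarrow> f \<in> X \<rightarrow>\<^sub>E UNIV \<longrightarrow>
        (f \<in> H \<longrightarrow> pmf (run_tester A m D f) True \<ge> 2 / 3) \<and>
        (dist_class D f H \<ge> \<epsilon> \<longrightarrow> pmf (run_tester A m D f) False \<ge> 2 / 3))"

text \<open>The infimum of the empty set is \<open>\<infinity>\<close> in \<^typ>\<open>enat\<close>.\<close>

definition m_test :: "'a set \<Rightarrow> ('a \<Rightarrow> bool) set \<Rightarrow> real \<Rightarrow> enat" where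
  "m_test X H \<epsilon> = Inf {enat m |m. \<exists>A. is_tester X H \<epsilon> m A}"

text \<open>In the next two definitions \<^const>\<open>the_enat\<close> is applied to finite values only.\<close>

definition admissible :: "real \<Rightarrow> 'a set \<Rightarrow> ('a \<Rightarrow> bool) set \<Rightarrow> 'a set \<Rightarrow> bool" where
  "admissible C X H S \<longleftrightarrow>
     H \<subseteq> X \<rightarrow>\<^sub>E UNIV \<and> S \<subseteq> X \<and> 2 \<le> VC S H \<and> VC S H < \<infinity> \<and>
     (finite S \<longrightarrow> card S > 5 * the_enat (VC S H)) \<and>
     real (the_enat (LVC S H)) \<ge>
       C * real (the_enat (VC S H)) powr (3 / 4) * sqrt (ln (real (the_enat (VC S H))))"

definition rate :: "('a \<Rightarrow> bool) set \<Rightarrow> 'a set \<Rightarrow> real" where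
  "rate H S = (real (the_enat (LVC S H)))\<^sup>2 /
     (real (the_enat (VC S H)) * ln (real (the_enat (VC S H))))"

definition lower_bound :: "'a itself \<Rightarrow> real \<Rightarrow> real \<Rightarrow> real \<Rightarrow> bool" where
  "lower_bound (_ :: 'a itself) C c \<epsilon>\<^sub>0 \<longleftrightarrow>
     (\<forall>(X :: 'a set) H S. admissible C X H S \<longrightarrow>
        (\<forall>\<epsilon>. 0 < \<epsilon> \<and> \<epsilon> < \<epsilon>\<^sub>0 \<longrightarrow>
           ereal_of_enat (m_test X H \<epsilon>) \<ge> ereal (c * rate H S)))"

text \<open>
  The witnesses have domains \<open>X \<subseteq> \<nat>\<close>. The constants \<open>a\<close>, \<open>b\<close> of the \<open>\<Theta>\<close> depend on \<open>\<epsilon>\<close>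
  but not on \<open>N\<close>, that is, not on the class.
\<close>

definition lower_bound_tight :: "real \<Rightarrow> bool" where
  "lower_bound_tight C \<longleftrightarrow>
     (\<exists>\<epsilon>\<^sub>1>0. \<forall>\<epsilon>. 0 < \<epsilon> \<and> \<epsilon> < \<epsilon>\<^sub>1 \<longrightarrow>
        (\<exists>a>0. \<exists>b>0. \<forall>N :: nat. \<exists>(X :: nat set) H S.
           admissible C X H S \<and> enat N \<le> VC S H \<and>
           ereal (a * rate H S) \<le> ereal_of_enat (m_test X H \<epsilon>) \<and>
           ereal_of_enat (m_test X H \<epsilon>) \<le> ereal (b * rate H S)))"

end

theory Submission
  imports Defs "HOL-Combinatorics.Multiset_Permutations" "HOL-Real_Asymp.Real_Asymp"
begin

text \<open>
  Lower bound: let \<open>k = LVC\<close>, \<open>d = VC\<close>, and fix \<open>5 d\<close> points together with a labelling that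
  disagrees with every function of the class in at least \<open>d / 10\<close> of them. Give the points
  independent random weights. If at most \<open>k\<close> weights are nonzero, the labelling agrees with the
  class on the support; if all weights are at least \<open>1\<close> and their sum is \<open>O(d)\<close>, it is far from
  the class. Duality for Chebyshev polynomials, in the form of Lagrange interpolation at their
  extremal points, gives two weight distributions of these kinds with the same moments up to an
  order \<open>D\<close> of size \<open>log d\<close>, and largest weight \<open>O(D\<^sup>2 d / k)\<close>. After Poissonization the counts
  of the points are independent Poisson mixtures. They agree up to \<open>exp (- D)\<close> each as long as the
  sample size is below a small multiple of \<open>k / log d\<close>, which is at least \<open>k\<^sup>2 / (d log d)\<close>.

  Tightness: the functions with at most \<open>d\<close> ones on \<open>6 d\<close> points have \<open>VC = LVC = d\<close>. Being far
  forces more than \<open>(1 + \<epsilon> / 2) d\<close> ones of mass at least about \<open>\<epsilon> / d\<close>, so it suffices to estimate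
  the number of ones of nonnegligible mass. Points seen in a first sample are counted directly; an
  unseen point of mass \<open>x\<close> contributes an unbiased estimate of \<open>q(x)\<close>, where the shifted
  Chebyshev polynomial \<open>q\<close> vanishes at \<open>0\<close> and is nearly \<open>1\<close> on the relevant range. Degree
  \<open>O(log d)\<close> suffices, and keeps the variance of the estimate at \<open>o(d\<^sup>2)\<close>.
\<close>

subsection \<open>Chebyshev polynomials and moment matching\<close>

text \<open>A tester has a fixed sample size and sees a normalized distribution, whereas
  independence needs Poisson counts driven by unnormalized random weights. Both fit together if the
  mean number of examples is proportional to the random total weight: the counts of the points are
  then independent whatever the total is, so nothing has to be conditioned on it. The total matters
  on the far side only, where it is at least \<open>5 d\<close> because every weight is at least 1,
  and below \<open>500 d\<close> outside an event of small probability.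

  Closeness of two experiments is expressed through the acceptance probabilities of arbitrary
  kernels into \<open>bool pmf\<close> instead of total variation distance; this form composes
  directly with products and with the tester.

  For tightness, two demands on the degree \<open>L\<close> pull in opposite directions. Accuracy of
  the threshold polynomial requires \<open>L * m\<close> of order \<open>d\<close>, while the size
  of its coefficients makes the variance bound grow exponentially in \<open>L\<close>. This balance
  is what fixes the sample size at order \<open>d / log d\<close>.\<close>

fun cheb :: "nat \<Rightarrow> real poly" where
  "cheb 0 = 1"
| "cheb (Suc 0) = [:0, 1:]"
| "cheb (Suc (Suc n)) = [:0, 2:] * cheb (Suc n) - cheb n"

lemma degree_cheb: "degree (cheb n) \<le> n"
proof (induction n rule: cheb.induct)
  case (3 n)
  have "degree ([:0, 2:] * cheb (Suc n)) \<le> Suc (Suc n)"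
    using degree_mult_le[of "[:0, 2:]" "cheb (Suc n)"] 3 by simp
  then show ?case
    using 3 by (auto intro!: degree_diff_le)
qed auto

lemma poly_cheb_cos: "poly (cheb n) (cos t) = cos (real n * t)"
proof (induction n rule: cheb.induct)
  case (3 n)
  have a: "real (Suc (Suc n)) * t = real (Suc n) * t + t" "real n * t = real (Suc n) * t - t"
    by (simp_all add: algebra_simps)
  show ?case
    unfolding cheb.simps poly_diff poly_mult 3 a cos_add cos_diff by (simp add: algebra_simps)
qed simp_all

lemma poly_cheb_cosh: "poly (cheb n) (cosh t) = cosh (real n * t)"
proof (induction n rule: cheb.induct)
  case (3 n)
  have a: "real (Suc (Suc n)) * t = real (Suc n) * t + t" "real n * t = real (Suc n) * t - t"
    by (simp_all add: algebra_simps)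
  show ?case
    unfolding cheb.simps poly_diff poly_mult 3 a cosh_add cosh_diff by (simp add: algebra_simps)
qed simp_all

definition lagrange_weight :: "nat \<Rightarrow> (nat \<Rightarrow> real) \<Rightarrow> real \<Rightarrow> nat \<Rightarrow> real" where
  "lagrange_weight n x t j = (\<Prod>i\<in>{..n} - {j}. (t - x i) / (x j - x i))"

lemma lagrange_interpolation:
  assumes inj: "inj_on x {..n}" and deg: "degree p \<le> n"
  shows "poly p t = (\<Sum>j\<le>n. poly p (x j) * lagrange_weight n x t j)"
proof -
  define b where "b j = (\<Prod>i\<in>{..n} - {j}. smult (1 / (x j - x i)) [:- x i, 1:])" for j
  define q where "q = (\<Sum>j\<le>n. smult (poly p (x j)) (b j))"
  have poly_b: "poly (b j) u = lagrange_weight n x u j" for j u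
    by (simp add: b_def lagrange_weight_def poly_prod diff_divide_distrib)
  have poly_q: "poly q u = (\<Sum>j\<le>n. poly p (x j) * lagrange_weight n x u j)" for u
    by (simp add: q_def poly_sum poly_b)
  have node: "lagrange_weight n x (x i) j = (if i = j then 1 else 0)" if "i \<le> n" "j \<le> n" for i j
  proof (cases "i = j")
    case True
    have "x j \<noteq> x k" if "k \<in> {..n} - {j}" for k
      using inj that \<open>j \<le> n\<close> by (auto dest: inj_onD)
    then show ?thesis
      using True by (auto simp: lagrange_weight_def intro!: prod.neutral)
  next
    case False
    then show ?thesis
      using that by (auto simp: lagrange_weight_def intro!: bexI[of _ i])
  qed
  have root: "poly (p - q) (x i) = 0" if "i \<le> n" for i
  proof -
    have "poly q (x i) = (\<Sum>j\<le>n. poly p (x j) * (if i = j then 1 else 0))"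
      unfolding poly_q by (intro sum.cong) (use node that in auto)
    also have "\<dots> = poly p (x i)"
      using that by (simp add: if_distrib[of "\<lambda>u. _ * u"] sum.delta' cong: if_cong)
    finally show ?thesis by simp
  qed
  have deg_b: "degree (b j) \<le> n" if "j \<le> n" for j
  proof -
    have "degree (b j) \<le> (\<Sum>i\<in>{..n} - {j}. degree (smult (1 / (x j - x i)) [:- x i, 1:]))"
      unfolding b_def by (rule order_trans[OF degree_prod_sum_le]) (simp_all add: o_def)
    also have "\<dots> \<le> (\<Sum>i\<in>{..n} - {j}. 1)"
      by (intro sum_mono) (simp add: degree_smult_le)
    also have "\<dots> = n" using that by simp
    finally show ?thesis .
  qed
  have "degree (p - q) \<le> n"
    unfolding q_def using deg_b deg
    by (intro degree_diff_le degree_sum_le) (auto intro: order_trans[OF degree_smult_le])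
  moreover have "card (x ` {..n}) = Suc n"
    using inj by (simp add: card_image)
  moreover have "p - q \<noteq> 0 \<Longrightarrow> card (x ` {..n}) \<le> card {u. poly (p - q) u = 0}"
    by (intro card_mono poly_roots_finite) (use root in auto)
  ultimately have "p - q = 0"
    using card_poly_roots_bound[of "p - q"] by fastforce
  then show ?thesis
    using poly_q[of t] by simp
qed

lemma ex_pmf_of_weights:
  fixes f :: "'a \<Rightarrow> real"
  assumes "finite A" "\<And>x. x \<in> A \<Longrightarrow> f x \<ge> 0" "(\<Sum>x\<in>A. f x) = 1"
  shows "\<exists>p. set_pmf p \<subseteq> A \<and> (\<forall>x\<in>A. pmf p x = f x)"
proof -
  define g where "g x = (if x \<in> A then f x else 0)" for x
  have nonneg: "g x \<ge> 0" for x
    using assms by (simp add: g_def)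
  have "(\<integral>\<^sup>+x. ennreal (g x) \<partial>count_space UNIV) = (\<Sum>x\<in>A. ennreal (g x))"
    using assms(1) by (intro nn_integral_count_space') (auto simp: g_def)
  also have "\<dots> = ennreal (\<Sum>x\<in>A. g x)"
    using nonneg by (simp add: sum_ennreal)
  also have "(\<Sum>x\<in>A. g x) = 1"
    using assms by (simp add: g_def)
  finally have prob: "(\<integral>\<^sup>+x. ennreal (g x) \<partial>count_space UNIV) = 1" by simp
  have "set_pmf (embed_pmf g) \<subseteq> A"
    unfolding set_embed_pmf[OF nonneg prob] by (auto simp: g_def)
  moreover have "\<forall>x\<in>A. pmf (embed_pmf g) x = f x"
    unfolding pmf_embed_pmf[OF nonneg prob] by (simp add: g_def)
  ultimately show ?thesis by blast
qed

lemma cosh_ge_quadratic: "cosh t \<ge> 1 + t\<^sup>2 / 2" for t :: real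
proof -
  have s: "(\<lambda>n. if even n then t ^ n /\<^sub>R fact n else 0) sums cosh t"
    by (rule cosh_converges)
  have "(\<Sum>n<4. if even n then t ^ n /\<^sub>R fact n else 0) \<le> cosh t"
    unfolding sums_unique[OF s]
    by (intro sum_le_suminf sums_summable[OF s]) (auto intro!: mult_nonneg_nonneg zero_le_even_power)
  moreover have "{..<4} = {0, 1, 2, 3::nat}" by auto
  ultimately show ?thesis
    by (simp add: field_simps)
qed

text \<open>
  At the extremal points of the Chebyshev polynomial the interpolation weights for a point beyond
  the interval alternate in sign, so their absolute values add up to a value of that polynomial.
\<close>

lemma chebyshev_weights:
  fixes D :: nat
  assumes D: "D \<ge> 1" and s: "s > 1"
  obtains w y :: "nat \<Rightarrow> real" where
    "\<And>j. j \<le> D \<Longrightarrow> (-1) ^ j * w j \<ge> 0"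
    "\<And>j. j \<le> D \<Longrightarrow> s \<le> y j \<and> y j \<le> s * (1 + 4 * real D ^ 2)"
    "(\<Sum>j\<le>D. (-1) ^ j * w j) \<le> 2"
    "\<And>r. r \<le> D \<Longrightarrow> (\<Sum>j\<le>D. w j * y j ^ r) = 1"
proof -
  define x where "x j = cos (real j * (pi / real D))" for j
  \<comment> \<open>With this choice \<open>cosh (D * t)\<close> is the constant
    \<open>cosh 1\<close>, at most 2, while \<open>cosh t - 1\<close> is still at least
    \<open>1 / (2 * D^2)\<close>; the latter produces the factor \<open>1 + 4 * D^2\<close> in the
    range.\<close>
  define t where "t = 1 / real D"
  define w where "w = lagrange_weight D x (cosh t)"
  define e where "e = cosh t - 1"
  have e: "e \<ge> t\<^sup>2 / 2" unfolding e_def using cosh_ge_quadratic[of t] by simp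
  have t: "t > 0" using D by (simp add: t_def)
  have e0: "e > 0" using e t by (smt (verit) zero_less_power divide_pos_pos)
  \<comment> \<open>The affine map that sends the node 1 to \<open>s\<close> and the outer point
    \<open>cosh t\<close> to 1. It turns evaluation at \<open>cosh t\<close> into evaluation at
    1.\<close>
  define y where "y j = s + (s - 1) * (1 - x j) / e" for j
  have anti: "x i > x j" if "i < j" "j \<le> D" for i j
    unfolding x_def using that D
    by (intro cos_monotone_0_pi) (auto simp: divide_right_mono field_simps)
  have inj: "inj_on x {..D}"
    by (intro linorder_inj_onI') (use anti in force)
  have x1: "-1 \<le> x j" "x j \<le> 1" for j by (auto simp: x_def)
  have sgn: "(-1) ^ j * w j \<ge> 0" if "j \<le> D" for j
  proof -
    have "w j = (\<Prod>i<j. (cosh t - x i) / (x j - x i)) * (\<Prod>i\<in>{j<..D}. (cosh t - x i) / (x j - x i))"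
      unfolding w_def lagrange_weight_def using that
      by (subst prod.union_disjoint[symmetric]) (auto intro!: prod.cong)
    moreover have "(\<Prod>i<j. (cosh t - x i) / (x j - x i)) = (-1) ^ j * (\<Prod>i<j. (cosh t - x i) / (x i - x j))"
    proof -
      have "(c - a) / (b - a) = (-1) * ((c - a) / (a - b))" for a b c :: real
        by (metis minus_diff_eq minus_divide_right mult_minus1)
      then have "(\<Prod>i<j. (cosh t - x i) / (x j - x i)) = (\<Prod>i<j. (-1) * ((cosh t - x i) / (x i - x j)))"
        by (intro prod.cong refl)
      then show ?thesis by (simp only: prod.distrib) simp
    qed
    moreover have "(\<Prod>i<j. (cosh t - x i) / (x i - x j)) \<ge> 0"
      proof (intro prod_nonneg divide_nonneg_nonneg)
      fix i assume "i \<in> {..<j}"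
      then show "x i - x j \<ge> 0" "cosh t - x i \<ge> 0"
        using anti[of i j] that x1[of i] e0 by (auto simp: e_def)
    qed
    moreover have "(\<Prod>i\<in>{j<..D}. (cosh t - x i) / (x j - x i)) \<ge> 0"
      proof (intro prod_nonneg divide_nonneg_nonneg)
      fix i assume "i \<in> {j<..D}"
      then show "x j - x i \<ge> 0" "cosh t - x i \<ge> 0"
        using anti[of j i] x1[of i] e0 by (auto simp: e_def)
    qed
    moreover have "(-1) ^ j * ((-1) ^ j * u) = u" for u :: real
      by (simp add: mult.assoc[symmetric] power_add[symmetric] flip: mult_2)
    ultimately show ?thesis
      by (simp add: mult.assoc)
  qed
  have "poly (cheb D) (x j) = (-1) ^ j" for j
    unfolding x_def poly_cheb_cos using D by (simp add: cos_npi)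
  then have "(\<Sum>j\<le>D. (-1) ^ j * w j) = poly (cheb D) (cosh t)"
    unfolding w_def by (subst lagrange_interpolation[OF inj degree_cheb]) simp
  also have "\<dots> = cosh 1" unfolding poly_cheb_cosh using D by (simp add: t_def)
  also have "cosh 1 \<le> (2::real)"
  proof -
    have "exp 1 \<le> (3::real)" by (rule exp_le)
    moreover have "exp (-1) \<le> (1::real)" by simp
    ultimately have "exp 1 + exp (-1) \<le> (3 + 1 :: real)" by (rule add_mono)
    then show ?thesis by (simp add: cosh_field_def)
  qed
  finally have total: "(\<Sum>j\<le>D. (-1) ^ j * w j) \<le> 2" .
  have mom: "(\<Sum>j\<le>D. w j * y j ^ r) = 1" if "r \<le> D" for r
  proof -
    define q where "q = [:s + (s - 1) / e, - (s - 1) / e:] ^ r"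
    have "degree q \<le> r"
      unfolding q_def by (rule order_trans[OF degree_power_le]) simp
    then have "poly q (cosh t) = (\<Sum>j\<le>D. poly q (x j) * w j)"
      unfolding w_def by (intro lagrange_interpolation[OF inj]) (use that in simp)
    moreover have "poly q (x j) = y j ^ r" for j
      by (simp add: q_def y_def diff_divide_distrib add_divide_distrib algebra_simps)
    moreover have "poly q (cosh t) = 1"
    proof -
      have "s + (s - 1) / e + cosh t * (- (s - 1) / e) = s - (s - 1) * (cosh t - 1) / e"
        by (simp add: diff_divide_distrib add_divide_distrib algebra_simps)
      also have "\<dots> = 1" using e0 by (simp flip: e_def)
      finally show ?thesis by (simp add: q_def)
    qed
    ultimately show ?thesis by (simp add: mult.commute)
  qed
  have range: "s \<le> y j \<and> y j \<le> s * (1 + 4 * real D ^ 2)" for j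
  proof
    show "s \<le> y j" unfolding y_def using s e0 x1 by simp
    have "(s - 1) * (1 - x j) / e \<le> s * 2 / (t\<^sup>2 / 2)"
      using s e e0 x1[of j] t by (intro frac_le mult_mono) auto
    also have "\<dots> = s * (4 * real D ^ 2)" using D by (simp add: t_def field_simps)
    finally show "y j \<le> s * (1 + 4 * real D ^ 2)" unfolding y_def by (simp add: algebra_simps)
  qed
  show ?thesis using that[OF sgn range total mom] by blast
qed


text \<open>Moving the negative weights of \<open>chebyshev_weights\<close> to the other side leaves
  two positive measures with equal moments up to order \<open>D\<close>: one on the
  \<open>y j\<close>, the other with an additional unit mass at 1. Dividing each mass by its
  location raises the order of the matching by one and makes the masses at points beyond
  \<open>s\<close> small. The mass that the first measure then lacks is put at 0, where moments of
  positive order do not see it.\<close>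

lemma moment_matching_pmfs:
  fixes D :: nat and s :: real
  assumes D: "D \<ge> 1" and s: "s \<ge> 2"
  obtains U U' :: "real pmf" where
    "finite (set_pmf U)" "set_pmf U \<subseteq> insert 0 {s..s * (1 + 4 * real D ^ 2)}"
    "finite (set_pmf U')" "set_pmf U' \<subseteq> {1..s * (1 + 4 * real D ^ 2)}"
    "\<And>r. r \<le> Suc D \<Longrightarrow>
       measure_pmf.expectation U (\<lambda>x. x ^ r) = measure_pmf.expectation U' (\<lambda>x. x ^ r)"
    "measure_pmf.prob U {0<..} \<le> 2 / s"
    "measure_pmf.expectation U' (\<lambda>x. x) \<le> 2"
proof -
  obtain w y where sgn: "\<And>j. j \<le> D \<Longrightarrow> (-1) ^ j * w j \<ge> 0"
    and range: "\<And>j. j \<le> D \<Longrightarrow> s \<le> y j \<and> y j \<le> s * (1 + 4 * real D ^ 2)"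
    and total: "(\<Sum>j\<le>D. (-1) ^ j * w j) \<le> 2"
    and mom: "\<And>r. r \<le> D \<Longrightarrow> (\<Sum>j\<le>D. w j * y j ^ r) = 1"
    using chebyshev_weights[of D s] D s by auto
  define p where "p j = (if even j then w j else 0)" for j
  define q where "q j = (if odd j then - w j else 0)" for j
  have p0: "p j \<ge> 0" and q0: "q j \<ge> 0" if "j \<le> D" for j
    using sgn[OF that] by (auto simp: p_def q_def)
  have y0: "y j > 0" if "j \<le> D" for j using range[OF that] s by simp
  have w: "w j = p j - q j" "(-1) ^ j * w j = p j + q j" for j by (auto simp: p_def q_def)
  have sum_pq: "(\<Sum>j\<le>D. p j) + (\<Sum>j\<le>D. q j) \<le> 2"
    using total by (simp add: w(2) sum.distrib)
  have mom': "(\<Sum>j\<le>D. p j * y j ^ r) = 1 + (\<Sum>j\<le>D. q j * y j ^ r)" if "r \<le> D" for r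
    using mom[OF that] by (simp add: w(1) left_diff_distrib sum_subtractf)
  \<comment> \<open>The total mass of the second measure after the division by locations. Both
    measures are divided by the same \<open>Z\<close>, so their moments remain equal.\<close>
  define Z where "Z = 1 + (\<Sum>j\<le>D. q j / y j)"
  have Z: "Z \<ge> 1" unfolding Z_def using q0 y0 by (auto intro!: sum_nonneg divide_nonneg_pos)
  define \<alpha> where "\<alpha> = (\<Sum>j\<le>D. p j / (y j * Z))"
  have "\<alpha> \<le> (\<Sum>j\<le>D. p j / (s * 1))"
    unfolding \<alpha>_def using range s Z p0 by (intro sum_mono divide_left_mono mult_mono mult_pos_pos y0) fastforce+
  also have "\<dots> = (\<Sum>j\<le>D. p j) / s" by (simp add: sum_divide_distrib)
  also have "\<dots> \<le> 2 / s"
    using sum_pq sum_nonneg[of "{..D}" q] q0 s by (intro divide_right_mono) auto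
  finally have \<alpha>: "\<alpha> \<le> 2 / s" .
  then have \<alpha>1: "\<alpha> \<le> 1" using s by (smt (verit) divide_le_eq_1)
  \<comment> \<open>Index 0 stands for the atom that is not among the nodes: 0 for \<open>U\<close>
    and 1 for \<open>U'\<close>.\<close>
  define f where "f = case_nat (1 - \<alpha>) (\<lambda>j. p j / (y j * Z))"
  define f' where "f' = case_nat (1 / Z) (\<lambda>j. q j / (y j * Z))"
  have split: "(\<Sum>i\<le>Suc D. h i) = h 0 + (\<Sum>j\<le>D. h (Suc j))" for h :: "nat \<Rightarrow> real"
    by (rule sum.atMost_Suc_shift)
  have "(\<Sum>i\<le>Suc D. f i) = 1" unfolding split by (simp add: f_def \<alpha>_def)
  moreover have "f i \<ge> 0" if "i \<in> {..Suc D}" for i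
    using that p0 y0 Z \<alpha>1 by (cases i) (auto simp: f_def intro!: divide_nonneg_pos mult_pos_pos)
  ultimately obtain P where P: "set_pmf P \<subseteq> {..Suc D}" "\<And>i. i \<in> {..Suc D} \<Longrightarrow> pmf P i = f i"
    using ex_pmf_of_weights[of "{..Suc D}" f] by blast
  have "(\<Sum>i\<le>Suc D. f' i) = (1 + (\<Sum>j\<le>D. q j / y j)) / Z"
    unfolding split by (simp add: f'_def sum_divide_distrib add_divide_distrib)
  also have "\<dots> = 1" using Z by (simp add: Z_def)
  finally have "(\<Sum>i\<le>Suc D. f' i) = 1" .
  moreover have "f' i \<ge> 0" if "i \<in> {..Suc D}" for i
    using that q0 y0 Z by (cases i) (auto simp: f'_def intro!: divide_nonneg_pos mult_pos_pos)
  ultimately obtain P' where P': "set_pmf P' \<subseteq> {..Suc D}" "\<And>i. i \<in> {..Suc D} \<Longrightarrow> pmf P' i = f' i"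
    using ex_pmf_of_weights[of "{..Suc D}" f'] by blast
  define U where "U = map_pmf (case_nat 0 y) P"
  define U' where "U' = map_pmf (case_nat 1 y) P'"
  have EU: "measure_pmf.expectation U h = h 0 * (1 - \<alpha>) + (\<Sum>j\<le>D. h (y j) * (p j / (y j * Z)))"
    for h :: "real \<Rightarrow> real"
  proof -
    have "measure_pmf.expectation U h = (\<Sum>i\<le>Suc D. h (case_nat 0 y i) * f i)"
      unfolding U_def integral_map_pmf using P by (subst integral_measure_pmf_real[of "{..Suc D}"]) auto
    then show ?thesis unfolding split by (simp add: f_def)
  qed
  have EU': "measure_pmf.expectation U' h = h 1 * (1 / Z) + (\<Sum>j\<le>D. h (y j) * (q j / (y j * Z)))"
    for h :: "real \<Rightarrow> real"
  proof -
    have "measure_pmf.expectation U' h = (\<Sum>i\<le>Suc D. h (case_nat 1 y i) * f' i)"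
      unfolding U'_def integral_map_pmf using P' by (subst integral_measure_pmf_real[of "{..Suc D}"]) auto
    then show ?thesis unfolding split by (simp add: f'_def)
  qed
  have EU_Suc: "measure_pmf.expectation U (\<lambda>x. x ^ Suc r) = (\<Sum>j\<le>D. p j * y j ^ r) / Z" for r
    unfolding EU using y0 by (force simp: sum_divide_distrib intro!: sum.cong)
  have EU'_Suc: "measure_pmf.expectation U' (\<lambda>x. x ^ Suc r) = (1 + (\<Sum>j\<le>D. q j * y j ^ r)) / Z" for r
    unfolding EU' using y0
    by (force simp: sum_divide_distrib add_divide_distrib intro!: sum.cong)
  show ?thesis
  proof
    show "finite (set_pmf U)" "finite (set_pmf U')"
      using P(1) P'(1) by (auto simp: U_def U'_def intro: finite_subset)
    show "set_pmf U \<subseteq> insert 0 {s..s * (1 + 4 * real D ^ 2)}"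
      using P(1) range by (fastforce simp: U_def split: nat.splits)
    have "s * (1 + 4 * real D ^ 2) \<ge> s * 1" using s by (intro mult_left_mono) auto
    then show "set_pmf U' \<subseteq> {1..s * (1 + 4 * real D ^ 2)}"
      using P'(1) range s by (fastforce simp: U'_def split: nat.splits)
    show "measure_pmf.expectation U (\<lambda>x. x ^ r) = measure_pmf.expectation U' (\<lambda>x. x ^ r)"
      if "r \<le> Suc D" for r
    proof (cases r)
      case (Suc r')
      then show ?thesis using mom'[of r'] that by (simp only: EU_Suc EU'_Suc Suc_le_mono)
    qed simp
    have "measure_pmf.prob U {0<..} = measure_pmf.expectation U (indicator {0<..})" by simp
    also have "\<dots> = \<alpha>" unfolding EU \<alpha>_def using y0 by (auto intro!: sum.cong)
    finally show "measure_pmf.prob U {0<..} \<le> 2 / s" using \<alpha> by simp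
    have "measure_pmf.expectation U' (\<lambda>x. x) = (1 + (\<Sum>j\<le>D. q j)) / Z"
      using EU'_Suc[of 0] by simp
    also have "\<dots> \<le> (1 + (\<Sum>j\<le>D. q j)) / 1"
      using Z q0 by (intro divide_left_mono) (auto intro!: add_nonneg_nonneg sum_nonneg)
    also have "\<dots> \<le> 2" using mom'[of 0] sum_pq by simp
    finally show "measure_pmf.expectation U' (\<lambda>x. x) \<le> 2" .
  qed
qed

subsection \<open>Poisson mixtures\<close>

lemma abs_expectation_le:
  fixes f :: "'a \<Rightarrow> real"
  assumes "\<And>x. x \<in> set_pmf p \<Longrightarrow> \<bar>f x\<bar> \<le> c"
  shows "\<bar>measure_pmf.expectation p f\<bar> \<le> c"
proof -
  have "AE x in p. norm (f x) \<le> c" using assms by (simp add: AE_measure_pmf_iff)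
  then have int: "integrable p f" by (intro measure_pmf.integrable_const_bound[where B = c]) auto
  have "\<bar>measure_pmf.expectation p f\<bar> \<le> measure_pmf.expectation p (\<lambda>x. \<bar>f x\<bar>)"
    using integral_norm_bound[of p f] by simp
  also have "\<dots> \<le> measure_pmf.expectation p (\<lambda>_. c)"
    by (intro integral_mono_AE) (use int assms in \<open>auto simp: AE_measure_pmf_iff\<close>)
  finally show ?thesis by simp
qed

lemma integrable_pmf_bounded:
  fixes f :: "'a \<Rightarrow> real"
  assumes "\<And>x. x \<in> set_pmf p \<Longrightarrow> \<bar>f x\<bar> \<le> c"
  shows "integrable (measure_pmf p) f"
  using assms by (intro measure_pmf.integrable_const_bound[where B = c]) (auto simp: AE_measure_pmf_iff)

lemma integrable_pmf_pmf [simp]: "integrable (measure_pmf p) (\<lambda>x. pmf (f x) y)"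
  by (rule integrable_pmf_bounded[where c = 1]) (simp add: pmf_le_1)

text \<open>Rate 0 is given its limit, the point mass at 0, because the weights drawn from the first
  mixture may vanish.\<close>

definition pois :: "real \<Rightarrow> nat pmf" where
  "pois y = (if y > 0 then poisson_pmf y else return_pmf 0)"

lemma pmf_pois: "y \<ge> 0 \<Longrightarrow> pmf (pois y) k = y ^ k / fact k * exp (- y)"
  by (cases "y = 0"; cases "k = 0") (auto simp: pois_def pmf_return zero_power)

lemma expectation_nat_sums:
  fixes b :: "nat \<Rightarrow> real"
  assumes "\<And>n. \<bar>b n\<bar> \<le> c"
  shows "(\<lambda>n. pmf p n * b n) sums measure_pmf.expectation p b"
proof -
  have "integrable (measure_pmf p) b" by (rule integrable_pmf_bounded) (rule assms)
  then have "integrable (count_space UNIV) (\<lambda>n. pmf p n * b n)"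
    unfolding measure_pmf_eq_density by (subst (asm) integrable_density) auto
  then have "(\<lambda>n. pmf p n * b n) sums (\<integral>n. pmf p n * b n \<partial>count_space UNIV)"
    by (rule sums_integral_count_space_nat)
  also have "(\<integral>n. pmf p n * b n \<partial>count_space UNIV) = measure_pmf.expectation p b"
    unfolding measure_pmf_eq_density by (subst integral_density) auto
  finally show ?thesis .
qed

text \<open>Multiplying the series of \<open>b n * y^n / n!\<close> by that of
  \<open>exp (- y)\<close> shows that the expectation is an entire function of the rate; the sum of
  a row of binomial coefficients bounds its coefficients. Thus moments of the rate control Poisson
  mixtures against every bounded test function at once.\<close>

lemma pois_expectation_power_series:
  fixes b :: "nat \<Rightarrow> real"
  assumes b: "\<And>n. \<bar>b n\<bar> \<le> 1"
  obtains a where "\<And>r. \<bar>a r\<bar> \<le> 2 ^ r / fact r"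
    "\<And>y. y \<ge> 0 \<Longrightarrow> (\<lambda>r. a r * y ^ r) sums measure_pmf.expectation (pois y) b"
proof -
  define a where "a r = (\<Sum>i\<le>r. b i * (-1) ^ (r - i) / (fact i * fact (r - i)))" for r
  have "\<bar>a r\<bar> \<le> 2 ^ r / fact r" for r
  proof -
    have "\<bar>a r\<bar> \<le> (\<Sum>i\<le>r. \<bar>b i * (-1) ^ (r - i) / (fact i * fact (r - i))\<bar>)"
      unfolding a_def by (rule sum_abs)
    also have "\<dots> \<le> (\<Sum>i\<le>r. 1 / (fact i * fact (r - i)))"
      using b by (intro sum_mono) (auto simp: abs_mult power_abs intro!: divide_right_mono)
    also have "\<dots> = (\<Sum>i\<le>r. real (r choose i) / fact r)"
      by (intro sum.cong) (auto simp: binomial_fact field_simps)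
    also have "\<dots> = real (\<Sum>i\<le>r. r choose i) / fact r"
      by (simp add: sum_divide_distrib)
    finally show ?thesis by (simp add: choose_row_sum)
  qed
  moreover have "(\<lambda>r. a r * y ^ r) sums measure_pmf.expectation (pois y) b" if y: "y \<ge> 0" for y
  proof -
    define u where "u n = b n * y ^ n / fact n" for n
    define v where "v n = (- y) ^ n / fact n" for n
    have ex: "summable (\<lambda>n. norm (z ^ n / fact n))" for z :: real
      using summable_norm_exp[of z] by (simp add: field_simps)
    have sv: "summable (\<lambda>n. norm (v n))" unfolding v_def by (rule ex)
    have su: "summable (\<lambda>n. norm (u n))"
    proof (rule summable_comparison_test'[OF ex[of y], of 0])
      fix n :: nat
      have "\<bar>b n\<bar> * \<bar>y ^ n\<bar> \<le> 1 * \<bar>y ^ n\<bar>" by (rule mult_right_mono) (use b in auto)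
      then show "norm (norm (u n)) \<le> norm (y ^ n / fact n)"
        by (simp add: u_def abs_mult divide_right_mono)
    qed
    have "(\<lambda>k. \<Sum>i\<le>k. u i * v (k - i)) sums ((\<Sum>k. u k) * (\<Sum>k. v k))"
      by (rule Cauchy_product_sums[OF su sv])
    also have "(\<lambda>k. \<Sum>i\<le>k. u i * v (k - i)) = (\<lambda>r. a r * y ^ r)"
    proof
      fix r
      have "u i * v (r - i) = b i * (-1) ^ (r - i) / (fact i * fact (r - i)) * y ^ r" if "i \<le> r" for i
      proof -
        have "y ^ r = y ^ i * y ^ (r - i)" using that by (simp flip: power_add)
        moreover have "(- y) ^ (r - i) = (-1) ^ (r - i) * y ^ (r - i)" by (rule power_minus)
        ultimately show ?thesis by (simp add: u_def v_def)
      qed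
      then show "(\<Sum>i\<le>r. u i * v (r - i)) = a r * y ^ r"
        unfolding a_def sum_distrib_right by (intro sum.cong) auto
    qed
    also have "(\<Sum>k. v k) = exp (- y)"
      by (simp add: v_def exp_def field_simps)
    also have "(\<Sum>k. u k) * exp (- y) = measure_pmf.expectation (pois y) b"
    proof -
      have "(\<lambda>n. u n * exp (- y)) sums ((\<Sum>k. u k) * exp (- y))"
        by (rule sums_mult2) (rule summable_sums[OF summable_norm_cancel[OF su]])
      moreover have "(\<lambda>n. u n * exp (- y)) = (\<lambda>n. pmf (pois y) n * b n)"
        using y by (auto simp: u_def pmf_pois)
      ultimately have "(\<lambda>n. pmf (pois y) n * b n) sums ((\<Sum>k. u k) * exp (- y))"
        by (simp only:)
      then show ?thesis
        by (rule sums_unique2) (rule expectation_nat_sums[OF b])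
    qed
    finally show ?thesis .
  qed
  ultimately show ?thesis using that by blast
qed

text \<open>The usual exponential Markov argument: each term is inflated by \<open>z^r\<close>,
  which is at least 1, and the tail is completed to the full series of
  \<open>exp (z * x)\<close>.\<close>

lemma exp_series_tail:
  fixes x z :: real
  assumes "x \<ge> 0" "z \<ge> 1"
  shows "(\<Sum>r. x ^ (r + R) / fact (r + R)) \<le> exp (z * x) / z ^ R"
    "summable (\<lambda>r. x ^ (r + R) / fact (r + R))"
proof -
  have e: "(\<lambda>r. (z * x) ^ r / fact r / z ^ R) sums (exp (z * x) / z ^ R)"
    by (intro sums_divide) (use exp_converges[of "z * x"] in \<open>simp add: field_simps\<close>)
  have s: "summable (\<lambda>r. x ^ r / fact r)"
    using summable_exp[of x] by (simp add: field_simps)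
  then show *: "summable (\<lambda>r. x ^ (r + R) / fact (r + R))"
    by (subst summable_iff_shift)
  have "(\<Sum>r. x ^ (r + R) / fact (r + R)) \<le> (\<Sum>r. (z * x) ^ (r + R) / fact (r + R) / z ^ R)"
  proof (rule suminf_le[OF _ *])
    show "summable (\<lambda>r. (z * x) ^ (r + R) / fact (r + R) / z ^ R)"
      using sums_summable[OF e] by (subst summable_iff_shift)
    fix r
    have "x ^ (r + R) \<le> (z * x) ^ (r + R) / z ^ R"
    proof -
      have "x ^ (r + R) * 1 \<le> x ^ (r + R) * z ^ r"
        using assms by (intro mult_left_mono) auto
      also have "\<dots> = (z * x) ^ (r + R) / z ^ R"
        using assms by (simp add: power_mult_distrib power_add)
      finally show ?thesis by simp
    qed
    then show "x ^ (r + R) / fact (r + R) \<le> (z * x) ^ (r + R) / fact (r + R) / z ^ R"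
      using assms by (simp add: field_simps)
  qed
  also have "\<dots> = exp (z * x) / z ^ R - (\<Sum>r<R. (z * x) ^ r / fact r / z ^ R)"
    using suminf_minus_initial_segment[OF sums_summable[OF e], of R] sums_unique[OF e] by simp
  also have "\<dots> \<le> exp (z * x) / z ^ R"
    using assms by (simp add: sum_nonneg)
  finally show "(\<Sum>r. x ^ (r + R) / fact (r + R)) \<le> exp (z * x) / z ^ R" .
qed

text \<open>Given a kernel \<open>k\<close>, the acceptance probability is the mean of an entire
  function of the weight. Its Taylor polynomial of degree \<open>D + 1\<close> has equal means under
  both mixtures, so only the remainder counts. The constant 18 comes from \<open>exp 2 <= 9\<close>:
  for rates up to \<open>D / 18\<close> the remainder is at most
  \<open>exp D / exp (2 * (D + 2))\<close>.\<close>

lemma poisson_mixture_closeness: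
  fixes U U' :: "real pmf" and D :: nat and k :: "nat \<Rightarrow> bool pmf"
  assumes fin: "finite (set_pmf U)" "finite (set_pmf U')"
    and range: "\<And>x. x \<in> set_pmf U \<union> set_pmf U' \<Longrightarrow> 0 \<le> x \<and> l * x \<le> real D / 18"
    and mom: "\<And>r. r \<le> Suc D \<Longrightarrow>
       measure_pmf.expectation U (\<lambda>x. x ^ r) = measure_pmf.expectation U' (\<lambda>x. x ^ r)"
    and l: "l \<ge> 0"
  shows "\<bar>pmf (bind_pmf (bind_pmf U (\<lambda>x. pois (l * x))) k) True
          - pmf (bind_pmf (bind_pmf U' (\<lambda>x. pois (l * x))) k) True\<bar> \<le> 2 * exp (- real D)"
proof -
  define b where "b n = pmf (k n) True" for n
  have "\<bar>b n\<bar> \<le> 1" for n by (simp add: b_def pmf_le_1)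
  then obtain a where a: "\<And>r. \<bar>a r\<bar> \<le> 2 ^ r / fact r"
    and ser: "\<And>y. y \<ge> 0 \<Longrightarrow> (\<lambda>r. a r * y ^ r) sums measure_pmf.expectation (pois y) b"
    using pois_expectation_power_series[of b] by blast
  define q where "q x = (\<Sum>r<D+2. a r * (l * x) ^ r)" for x
  define h where "h x = measure_pmf.expectation (pois (l * x)) b" for x
  have approx: "\<bar>h x - q x\<bar> \<le> exp (- real D)" if "x \<in> set_pmf U \<union> set_pmf U'" for x
  proof -
    define y where "y = l * x"
    have y: "0 \<le> y" "y \<le> real D / 18" using range[OF that] l by (auto simp: y_def)
    have diff: "h x - q x = (\<Sum>r. a (r + (D + 2)) * y ^ (r + (D + 2)))"
      using suminf_minus_initial_segment[OF sums_summable[OF ser[OF y(1)]], of "D + 2"]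
        sums_unique[OF ser[OF y(1)]] by (simp add: h_def q_def y_def)
    have le: "\<bar>a (r + (D + 2)) * y ^ (r + (D + 2))\<bar>
        \<le> (2 * y) ^ (r + (D + 2)) / fact (r + (D + 2))" for r
      using mult_right_mono[OF a[of "r + (D + 2)"], of "y ^ (r + (D + 2))"] y
      unfolding power_mult_distrib[of 2] by (simp add: abs_mult)
    note tail = exp_series_tail[of "2 * y" "exp 2" "D + 2"]
    have "\<bar>\<Sum>r. a (r + (D + 2)) * y ^ (r + (D + 2))\<bar>
        \<le> (\<Sum>r. \<bar>a (r + (D + 2)) * y ^ (r + (D + 2))\<bar>)"
      by (intro summable_rabs summable_comparison_test'[OF tail(2), of 0]) (use le y in auto)
    also have "\<dots> \<le> (\<Sum>r. (2 * y) ^ (r + (D + 2)) / fact (r + (D + 2)))"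
      by (intro suminf_le le tail(2) summable_comparison_test'[OF tail(2), of 0]) (use le y in auto)
    also have "\<dots> \<le> exp (exp 2 * (2 * y)) / exp 2 ^ (D + 2)"
      using y by (intro tail(1)) auto
    also have "\<dots> \<le> exp (real D) / exp 2 ^ (D + 2)"
    proof -
      have "exp (2::real) = exp 1 * exp 1" by (simp flip: exp_add)
      also have "\<dots> \<le> 3 * 3" by (intro mult_mono exp_le) auto
      finally have "exp 2 * (2 * y) \<le> 9 * (2 * (real D / 18))"
        using y by (intro mult_mono) auto
      then show ?thesis by (intro divide_right_mono) auto
    qed
    also have "\<dots> = exp (- real D - 4)"
      by (simp add: exp_diff exp_minus field_simps flip: exp_of_nat_mult exp_add)
    also have "\<dots> \<le> exp (- real D)" by simp
    finally have "\<bar>\<Sum>r. a (r + (D + 2)) * y ^ (r + (D + 2))\<bar> \<le> exp (- real D)" .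
    then show ?thesis using diff by simp
  qed
  have val: "pmf (bind_pmf (bind_pmf P (\<lambda>x. pois (l * x))) k) True = measure_pmf.expectation P h" for P
    by (simp add: bind_assoc_pmf pmf_bind h_def[abs_def] b_def[abs_def])
  have intU: "integrable (measure_pmf U) f" "integrable (measure_pmf U') f" for f :: "real \<Rightarrow> real"
    using fin by (auto intro: integrable_measure_pmf_finite)
  have "measure_pmf.expectation U q = measure_pmf.expectation U' q"
    using mom by (simp add: q_def[abs_def] power_mult_distrib Bochner_Integration.integral_sum[OF intU(1)]
      Bochner_Integration.integral_sum[OF intU(2)] del: sum.lessThan_Suc)
  then have "measure_pmf.expectation U h - measure_pmf.expectation U' h
    = measure_pmf.expectation U (\<lambda>x. h x - q x) - measure_pmf.expectation U' (\<lambda>x. h x - q x)"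
    using intU by simp
  also have "\<bar>\<dots>\<bar> \<le> exp (- real D) + exp (- real D)"
    by (intro order_trans[OF abs_triangle_ineq4] add_mono abs_expectation_le approx) auto
  finally show ?thesis unfolding val by simp
qed

text \<open>A hybrid argument: one coordinate is exchanged at a time, the remaining ones being
  absorbed into the kernel. Hence the hypothesis ranges over all kernels.\<close>

lemma Pi_pmf_closeness:
  fixes P P' :: "'b pmf" and k :: "('a \<Rightarrow> 'b) \<Rightarrow> bool pmf"
  assumes close: "\<And>k. \<bar>pmf (bind_pmf P k) True - pmf (bind_pmf P' k) True\<bar> \<le> \<delta>"
    and "finite T"
  shows "\<bar>pmf (bind_pmf (Pi_pmf T d (\<lambda>_. P)) k) True - pmf (bind_pmf (Pi_pmf T d (\<lambda>_. P')) k) True\<bar>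
    \<le> real (card T) * \<delta>"
  using \<open>finite T\<close>
proof (induction T arbitrary: k)
  case (insert x T)
  define K where "K Q y = bind_pmf (Pi_pmf T d (\<lambda>_. Q)) (\<lambda>f. k (f(x := y)))" for Q y
  have eq: "bind_pmf (Pi_pmf (insert x T) d (\<lambda>_. Q)) k = bind_pmf Q (K Q)" for Q
    using insert.hyps by (simp add: Pi_pmf_insert' K_def[abs_def] bind_assoc_pmf bind_return_pmf)
  have "pmf (bind_pmf P (K P)) True - pmf (bind_pmf P (K P')) True
    = measure_pmf.expectation P (\<lambda>y. pmf (K P y) True - pmf (K P' y) True)"
    by (simp add: pmf_bind)
  then have "\<bar>pmf (bind_pmf P (K P)) True - pmf (bind_pmf P (K P')) True\<bar> \<le> real (card T) * \<delta>"
    by (simp only:) (intro abs_expectation_le, use insert.IH in \<open>simp add: K_def\<close>)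
  moreover have "\<bar>pmf (bind_pmf P (K P')) True - pmf (bind_pmf P' (K P')) True\<bar> \<le> \<delta>"
    by (rule close)
  ultimately show ?case
    unfolding eq using insert.hyps by (simp add: algebra_simps)
qed simp

section \<open>Poissonization of a sample\<close>

lemma pmf_replicate_pmf:
  assumes "finite T" "set xs \<subseteq> T"
  shows "pmf (replicate_pmf n p) xs =
    (if length xs = n then \<Prod>x\<in>T. pmf p x ^ count (mset xs) x else 0)"
  using assms(2)
proof (induction n arbitrary: xs)
  case 0
  then show ?case by (auto simp: pmf_return)
next
  case (Suc n)
  show ?case
  proof (cases xs)
    case Nil
    then show ?thesis by (simp add: set_pmf_iff[symmetric] set_replicate_pmf pmf_eq_0_set_pmf)
  next
    case (Cons y ys)
    have "replicate_pmf (Suc n) p = map_pmf (\<lambda>(x, xs). x # xs) (pair_pmf p (replicate_pmf n p))"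
      by (simp add: pair_pmf_def map_bind_pmf map_pmf_def bind_assoc_pmf bind_return_pmf)
    then have "pmf (replicate_pmf (Suc n) p) (case (y, ys) of (x, xs) \<Rightarrow> x # xs)
        = pmf (pair_pmf p (replicate_pmf n p)) (y, ys)"
      by (simp only:) (intro pmf_map_inj', auto simp: inj_def)
    then have "pmf (replicate_pmf (Suc n) p) xs = pmf p y * pmf (replicate_pmf n p) ys"
      using Cons by (simp add: pmf_pair)
    also have "\<dots> = (if length xs = Suc n then \<Prod>x\<in>T. pmf p x ^ count (mset xs) x else 0)"
    proof -
      have "y \<in> T" using Suc.prems Cons by simp
      have "(\<Prod>x\<in>T. pmf p x ^ count (mset xs) x)
          = (\<Prod>x\<in>T. (if x = y then pmf p x else 1) * pmf p x ^ count (mset ys) x)"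
        using Cons by (intro prod.cong) auto
      also have "\<dots> = pmf p y * (\<Prod>x\<in>T. pmf p x ^ count (mset ys) x)"
        using assms(1) \<open>y \<in> T\<close> by (simp add: prod.distrib)
      finally show ?thesis using Suc.IH[of ys] Suc.prems Cons by simp
    qed
    finally show ?thesis .
  qed
qed

text \<open>
  The Poisson weights on the left contribute the factorials of the counts, the uniform order
  contributes the multinomial coefficient, and the two cancel to the \<open>1 / (length xs)!\<close> on the right.
\<close>

lemma poissonization:
  fixes w :: "'a \<Rightarrow> real" and p :: "'a pmf"
  assumes T: "finite T" and w: "\<And>x. x \<in> T \<Longrightarrow> w x \<ge> 0" and l: "l \<ge> 0"
    and W: "W = (\<Sum>x\<in>T. w x)" and p: "set_pmf p \<subseteq> T" "\<And>x. x \<in> T \<Longrightarrow> pmf p x * W = w x"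
  shows "bind_pmf (Pi_pmf T 0 (\<lambda>x. pois (l * w x)))
           (\<lambda>N. pmf_of_set (permutations_of_multiset (\<Sum>x\<in>T. replicate_mset (N x) x)))
         = bind_pmf (pois (l * W)) (\<lambda>m. replicate_pmf m p)" (is "bind_pmf ?Pi ?perm = ?R")
proof (rule pmf_eqI)
  fix xs :: "'a list"
  define M where "M N = (\<Sum>x\<in>T. replicate_mset (N x) x)" for N :: "'a \<Rightarrow> nat"
  have count_M: "count (M N) x = (if x \<in> T then N x else 0)" for N x
    using T by (simp add: M_def count_sum)
  have W0: "W \<ge> 0" unfolding W by (intro sum_nonneg w)
  show "pmf (bind_pmf ?Pi ?perm) xs = pmf ?R xs"
  proof (cases "set xs \<subseteq> T")
    case False
    have "xs \<notin> set_pmf ?R"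
      using False p(1) by (auto simp: set_replicate_pmf)
    moreover have "xs \<notin> set_pmf (bind_pmf ?Pi ?perm)"
    proof
      assume "xs \<in> set_pmf (bind_pmf ?Pi ?perm)"
      then obtain N where "mset xs = M N"
        by (auto simp: M_def dest: permutations_of_multisetD)
      moreover have "set_mset (M N) \<subseteq> T"
        using count_M[of N] by (auto simp flip: count_greater_zero_iff split: if_splits)
      ultimately show False using False by (metis set_mset_mset)
    qed
    ultimately show ?thesis by (simp only: set_pmf_iff not_not)
  next
    case True
    define c where "c = count (mset xs)"
    have c0: "c x = 0" if "x \<notin> T" for x
    proof -
      have "x \<notin># mset xs" using that True by auto
      then show ?thesis by (simp add: c_def not_in_iff)
    qed
    have Mc: "M c = mset xs"
      by (rule multiset_eqI) (use c0 in \<open>auto simp: count_M c_def\<close>)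
    have len: "length xs = (\<Sum>x\<in>T. c x)"
    proof -
      have "length xs = size (M c)" by (simp add: Mc)
      also have "\<dots> = (\<Sum>x\<in>T. c x)"
        unfolding M_def using T by (induction T rule: finite_induct) auto
      finally show ?thesis .
    qed
    \<comment> \<open>Off \<open>T\<close> the default value 0 of \<open>Pi_pmf\<close> pins the
      counts down, so exactly one count function can produce \<open>xs\<close>, and the expectation
      over counts reduces to one term.\<close>
    have uniq: "N = c" if "N \<in> set_pmf ?Pi" "mset xs = M N" for N
    proof
      fix x
      have c: "c x = count (M N) x" unfolding c_def using that(2) by simp
      show "N x = c x"
      proof (cases "x \<in> T")
        case False
        then show ?thesis
          using that(1) set_Pi_pmf_subset[OF T, of 0 "\<lambda>x. pois (l * w x)"] c0[of x] by auto
      qed (use c in \<open>simp add: count_M\<close>)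
    qed
    have card: "real (card (permutations_of_multiset (mset xs))) * (\<Prod>x\<in>T. fact (c x)) = fact (length xs)"
    proof -
      have c1: "c x = 0" if "x \<notin> set xs" for x unfolding c_def using that by simp
      have "(\<Prod>x\<in>T. fact (c x)) = (\<Prod>x\<in>set_mset (mset xs). fact (c x) :: nat)"
        by (rule prod.mono_neutral_right) (use T True c1 in auto)
      then have "card (permutations_of_multiset (mset xs)) * (\<Prod>x\<in>T. fact (c x)) = fact (length xs)"
        using card_permutations_of_multiset_aux[of "mset xs"] unfolding c_def size_mset by (simp only:)
      then have "real (card (permutations_of_multiset (mset xs)) * (\<Prod>x\<in>T. fact (c x))) = real (fact (length xs))"
        by (simp only:)
      then show ?thesis by simp
    qed
    have fact_pos: "(\<Prod>x\<in>T. fact (c x) :: real) > 0" by (rule prod_pos) simp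
    have "pmf (bind_pmf ?Pi ?perm) xs = measure_pmf.expectation ?Pi (\<lambda>N. pmf (?perm N) xs)"
      by (rule pmf_bind)
    also have "\<dots> = pmf (?perm c) xs * pmf ?Pi c"
      using integral_measure_pmf_real[of "{c}" ?Pi "\<lambda>N. pmf (?perm N) xs"] uniq
      unfolding M_def[symmetric] by (fastforce simp: indicator_def dest: permutations_of_multisetD split: if_splits)
    also have "pmf (?perm c) xs = 1 / real (card (permutations_of_multiset (mset xs)))"
      using Mc by (simp add: M_def permutations_of_multisetI)
    also have "\<dots> = (\<Prod>x\<in>T. fact (c x)) / fact (length xs)"
      using fact_pos unfolding card[symmetric] by simp
    also have "pmf ?Pi c = (\<Prod>x\<in>T. (l * w x) ^ c x / fact (c x) * exp (- (l * w x)))"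
      using c0 w l by (subst pmf_Pi'[OF T]) (auto simp: pmf_pois intro!: prod.cong)
    also have "\<dots> = (\<Prod>x\<in>T. (l * w x) ^ c x) / (\<Prod>x\<in>T. fact (c x)) * exp (- (l * W))"
      by (simp add: prod.distrib prod_dividef exp_sum[OF T, symmetric] W sum_distrib_left sum_negf)
    also have "(\<Prod>x\<in>T. (l * w x) ^ c x) = (l * W) ^ length xs * (\<Prod>x\<in>T. pmf p x ^ c x)"
    proof -
      have "(\<Prod>x\<in>T. (l * w x) ^ c x) = (\<Prod>x\<in>T. (l * W) ^ c x * pmf p x ^ c x)"
      proof (rule prod.cong[OF refl])
        fix x assume "x \<in> T"
        then have "l * w x = l * W * pmf p x" using p(2) by (simp add: mult_ac)
        then show "(l * w x) ^ c x = (l * W) ^ c x * pmf p x ^ c x"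
          by (simp only: power_mult_distrib)
      qed
      then show ?thesis unfolding prod.distrib len power_sum .
    qed
    finally have L: "pmf (bind_pmf ?Pi ?perm) xs
        = (l * W) ^ length xs / fact (length xs) * exp (- (l * W)) * (\<Prod>x\<in>T. pmf p x ^ c x)"
      using fact_pos by simp
    have "pmf ?R xs = measure_pmf.expectation (pois (l * W)) (\<lambda>m. pmf (replicate_pmf m p) xs)"
      by (rule pmf_bind)
    also have "\<dots> = pmf (replicate_pmf (length xs) p) xs * pmf (pois (l * W)) (length xs)"
      by (subst integral_measure_pmf_real[of "{length xs}"])
        (auto simp: pmf_replicate_pmf[OF T True] split: if_splits)
    finally show ?thesis
      unfolding L using pmf_replicate_pmf[OF T True] W0 l by (simp add: pmf_pois c_def)
  qed
qed

subsection \<open>Sauer--Shelah and far labellings\<close>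

text \<open>Pajor's form of the Sauer-Shelah lemma. Splitting \<open>F\<close> by membership of
  \<open>x\<close> gives two families on \<open>T\<close>. A set shattered by both is counted twice
  by the induction hypothesis, and it pays for this by being shattered by \<open>F\<close> both as
  it is and with \<open>x\<close> added.\<close>

lemma card_le_card_shattered:
  assumes "finite T" "F \<subseteq> Pow T"
  shows "card F \<le> card {A. A \<subseteq> T \<and> (\<forall>B\<subseteq>A. \<exists>G\<in>F. G \<inter> A = B)}"
  using assms
proof (induction T arbitrary: F rule: finite_induct)
  case empty
  have "F \<subseteq> {A. A \<subseteq> {} \<and> (\<forall>B\<subseteq>A. \<exists>G\<in>F. G \<inter> A = B)}"
    using empty by auto
  then show ?case by (rule card_mono[rotated]) simp
next
  case (insert x T)
  define S where "S F' = {A. A \<subseteq> T \<and> (\<forall>B\<subseteq>A. \<exists>G\<in>F'. G \<inter> A = B)}" for F'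
  define S' where "S' = {A. A \<subseteq> insert x T \<and> (\<forall>B\<subseteq>A. \<exists>G\<in>F. G \<inter> A = B)}"
  define F0 where "F0 = {G \<in> F. x \<notin> G}"
  define F1 where "F1 = (\<lambda>G. G - {x}) ` {G \<in> F. x \<in> G}"
  have finS: "finite (S F')" for F' using insert.hyps by (auto simp: S_def)
  have finS': "finite S'" using insert.hyps by (auto simp: S'_def)
  have finF: "finite F" using insert by (meson finite.insertI finite_Pow_iff finite_subset)
  have "card F = card F0 + card {G \<in> F. x \<in> G}"
    unfolding F0_def using finF by (subst card_Un_disjoint[symmetric]) (auto intro!: arg_cong[where f = card])
  also have "card {G \<in> F. x \<in> G} = card F1"
    unfolding F1_def by (subst card_image) (auto simp: inj_on_def)
  finally have "card F = card F0 + card F1" .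
  moreover have "card F0 \<le> card (S F0)" "card F1 \<le> card (S F1)"
    unfolding S_def by (intro insert.IH; use insert.prems in \<open>auto simp: F0_def F1_def\<close>)+
  moreover have "card (S F0) + card (S F1) = card (S F0 \<union> S F1) + card (S F0 \<inter> S F1)"
    by (rule card_Un_Int) (rule finS)+
  moreover have "card (S F0 \<union> S F1) + card (insert x ` (S F0 \<inter> S F1)) \<le> card S'"
  proof -
    have x: "x \<notin> A" if "A \<in> S F'" for A F' using that insert.hyps by (auto simp: S_def)
    have SD: "\<exists>G\<in>F'. G \<inter> A = B" if "A \<in> S F'" "B \<subseteq> A" for A B F'
      using that by (simp add: S_def)
    have "A \<in> S'" if "A \<in> S F0 \<union> S F1" for A
    proof -
      have "\<exists>G\<in>F. G \<inter> A = B" if B: "B \<subseteq> A" for B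
      proof (cases "A \<in> S F0")
        case True
        then obtain G where "G \<in> F0" "G \<inter> A = B" using SD[OF True B] by (elim bexE)
        then show ?thesis unfolding F0_def by (intro bexI[of _ G]) simp_all
      next
        case False
        then have A: "A \<in> S F1" using \<open>A \<in> S F0 \<union> S F1\<close> by simp
        then obtain G' where "G' \<in> F1" "G' \<inter> A = B" using SD[OF A B] by (elim bexE)
        then obtain G where "G \<in> F" "(G - {x}) \<inter> A = B" unfolding F1_def by auto
        then show ?thesis using x[OF A] by (intro bexI[of _ G]) auto
      qed
      then show ?thesis using that by (auto simp: S'_def S_def)
    qed
    moreover have "insert x A \<in> S'" if A: "A \<in> S F0" "A \<in> S F1" for A
    proof -
      have "\<exists>G\<in>F. G \<inter> insert x A = B" if B: "B \<subseteq> insert x A" for B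
      proof (cases "x \<in> B")
        case True
        have BA: "B - {x} \<subseteq> A" using B by auto
        obtain G' where "G' \<in> F1" "G' \<inter> A = B - {x}"
          using SD[OF A(2) BA] by (elim bexE)
        then obtain G where "G \<in> F" "x \<in> G" "(G - {x}) \<inter> A = B - {x}" unfolding F1_def by auto
        then show ?thesis using True x[OF A(1)] by (intro bexI[of _ G]) auto
      next
        case False
        then have BA: "B \<subseteq> A" using B by blast
        obtain G where "G \<in> F0" "G \<inter> A = B" using SD[OF A(1) BA] by (elim bexE)
        then have "G \<in> F" "x \<notin> G" "G \<inter> A = B" unfolding F0_def by simp_all
        then show ?thesis using False by (intro bexI[of _ G]) auto
      qed
      then show ?thesis using A by (auto simp: S'_def S_def)
    qed
    ultimately have "(S F0 \<union> S F1) \<union> insert x ` (S F0 \<inter> S F1) \<subseteq> S'" by auto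
    then have "card ((S F0 \<union> S F1) \<union> insert x ` (S F0 \<inter> S F1)) \<le> card S'"
      by (rule card_mono[OF finS'])
    moreover have "card ((S F0 \<union> S F1) \<union> insert x ` (S F0 \<inter> S F1))
        = card (S F0 \<union> S F1) + card (insert x ` (S F0 \<inter> S F1))"
      by (rule card_Un_disjoint) (use finS x in auto)
    ultimately show ?thesis by simp
  qed
  moreover have "card (insert x ` (S F0 \<inter> S F1)) = card (S F0 \<inter> S F1)"
  proof (rule card_image)
    have "x \<notin> A" if "A \<in> S F0" for A using that insert.hyps by (auto simp: S_def)
    then show "inj_on (insert x) (S F0 \<inter> S F1)" by (auto intro!: inj_onI dest: insert_ident)
  qed
  ultimately show ?case unfolding S'_def by simp
qed

text \<open>For \<open>i <= r\<close> the weight \<open>y^i\<close> is at least \<open>y^r\<close>,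
  and the binomial theorem sums the weights. The parameter \<open>y\<close> is left open because the
  two applications need different ones: 1/4 for the number of traces and 1/10 for the size of a
  ball.\<close>

lemma sum_binomial_le:
  fixes y :: real
  assumes "0 < y" "y \<le> 1"
  shows "real (\<Sum>i\<le>r. n choose i) * y ^ r \<le> (1 + y) ^ n"
proof -
  have "real (\<Sum>i\<le>r. n choose i) * y ^ r \<le> (\<Sum>i\<le>r. real (n choose i) * y ^ i)"
    unfolding of_nat_sum sum_distrib_right using assms
    by (intro sum_mono mult_left_mono power_decreasing) auto
  also have "\<dots> \<le> (\<Sum>i\<le>max r n. real (n choose i) * y ^ i)"
    using assms by (intro sum_mono2) auto
  also have "\<dots> = (\<Sum>i\<le>n. real (n choose i) * y ^ i)"
    by (intro sum.mono_neutral_right) auto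
  also have "\<dots> = (1 + y) ^ n"
    unfolding add.commute[of 1] binomial_ring by simp
  finally show ?thesis .
qed

lemma card_subsets_le:
  assumes "finite T"
  shows "card {A. A \<subseteq> T \<and> card A \<le> r} = (\<Sum>i\<le>r. card T choose i)"
proof -
  have "{A. A \<subseteq> T \<and> card A \<le> r} = (\<Union>i\<in>{..r}. {A. A \<subseteq> T \<and> card A = i})" by auto
  also have "card \<dots> = (\<Sum>i\<le>r. card {A. A \<subseteq> T \<and> card A = i})"
    using assms by (intro card_UN_disjoint) auto
  finally show ?thesis using n_subsets[OF assms] by simp
qed

text \<open>
  By Sauer--Shelah the Hamming balls of radius \<open>d / 10\<close> around the traces of \<open>H\<close> do not cover
  the cube of all labellings of \<open>T\<close>.
\<close>

lemma ex_far_labelling: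
  assumes T: "finite T" "card T = 5 * d" and d: "d \<ge> 1"
    and sh: "\<And>A. A \<subseteq> T \<Longrightarrow> shatters H A \<Longrightarrow> card A \<le> d"
  shows "\<exists>l. \<forall>h\<in>H. d < 10 * card {x \<in> T. h x \<noteq> l x}"
proof (rule ccontr)
  assume neg: "\<nexists>l. \<forall>h\<in>H. d < 10 * card {x \<in> T. h x \<noteq> l x}"
  define r where "r = d div 10"
  define tr where "tr h = {x \<in> T. h x}" for h :: "'a \<Rightarrow> bool"
  define ball where "ball G = {B. B \<subseteq> T \<and> card (sym_diff G B) \<le> r}" for G
  have "Pow T \<subseteq> (\<Union>G\<in>tr ` H. ball G)"
  proof
    fix B assume B: "B \<in> Pow T"
    obtain h where h: "h \<in> H" "\<not> d < 10 * card {x \<in> T. h x \<noteq> (x \<in> B)}"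
      using neg[unfolded not_ex, rule_format, of "\<lambda>x. x \<in> B"] by blast
    have "{x \<in> T. h x \<noteq> (x \<in> B)} = sym_diff (tr h) B" using B by (auto simp: tr_def)
    then have "B \<in> ball (tr h)" using h(2) B by (auto simp: ball_def r_def)
    then show "B \<in> (\<Union>G\<in>tr ` H. ball G)" using h(1) by blast
  qed
  moreover have fin: "finite (tr ` H)" "tr ` H \<subseteq> Pow T"
    using T by (auto simp: tr_def intro: finite_subset[of _ "Pow T"])
  moreover have finb: "finite (ball G)" for G using T by (auto simp: ball_def)
  ultimately have "card (Pow T) \<le> card (\<Union>G\<in>tr ` H. ball G)" by (intro card_mono finite_UN_I) auto
  also have "\<dots> \<le> (\<Sum>G\<in>tr ` H. card (ball G))" by (rule card_UN_le[OF fin(1)])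
  also have "\<dots> = (\<Sum>G\<in>tr ` H. (\<Sum>i\<le>r. 5 * d choose i))"
  proof (rule sum.cong[OF refl])
    fix G assume "G \<in> tr ` H"
    then have G: "G \<subseteq> T" using fin by auto
    have "bij_betw (sym_diff G) {A. A \<subseteq> T \<and> card A \<le> r} (ball G)"
    proof (rule bij_betw_byWitness[where f' = "sym_diff G"])
      have inv: "sym_diff G (sym_diff G A) = A" for A by auto
      then show "\<forall>A\<in>{A. A \<subseteq> T \<and> card A \<le> r}. sym_diff G (sym_diff G A) = A"
        "\<forall>A\<in>ball G. sym_diff G (sym_diff G A) = A" by blast+
      show "sym_diff G ` {A. A \<subseteq> T \<and> card A \<le> r} \<subseteq> ball G"
        unfolding ball_def using G inv by auto
      show "sym_diff G ` ball G \<subseteq> {A. A \<subseteq> T \<and> card A \<le> r}"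
        unfolding ball_def using G by auto
    qed
    then have "card (ball G) = card {A. A \<subseteq> T \<and> card A \<le> r}" by (simp add: bij_betw_same_card)
    then show "card (ball G) = (\<Sum>i\<le>r. 5 * d choose i)" using card_subsets_le[OF T(1)] T(2) by simp
  qed
  finally have A: "2 ^ (5 * d) \<le> card (tr ` H) * (\<Sum>i\<le>r. 5 * d choose i)"
    using T by (simp add: card_Pow)
  have "card (tr ` H) \<le> card {A. A \<subseteq> T \<and> (\<forall>B\<subseteq>A. \<exists>G\<in>tr ` H. G \<inter> A = B)}"
    by (rule card_le_card_shattered[OF T(1) fin(2)])
  also have "\<dots> \<le> card {A. A \<subseteq> T \<and> card A \<le> d}"
  proof (rule card_mono)
    show "{A. A \<subseteq> T \<and> (\<forall>B\<subseteq>A. \<exists>G\<in>tr ` H. G \<inter> A = B)} \<subseteq> {A. A \<subseteq> T \<and> card A \<le> d}"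
    proof clarify
      fix A assume A: "A \<subseteq> T" and B: "\<forall>B\<subseteq>A. \<exists>G\<in>tr ` H. G \<inter> A = B"
      have "\<exists>f\<in>H. \<forall>x\<in>A. f x = l x" for l
      proof -
        obtain h where h: "h \<in> H" "tr h \<inter> A = {x \<in> A. l x}"
          using B[rule_format, of "{x \<in> A. l x}"] by auto
        then have "\<forall>x\<in>A. h x = l x" using A by (fastforce simp: tr_def set_eq_iff)
        then show ?thesis using h(1) by blast
      qed
      then have "shatters H A" using A T by (auto simp: shatters_def intro: finite_subset)
      then show "card A \<le> d" by (rule sh[OF A])
    qed
  qed (use T in auto)
  also have "\<dots> = (\<Sum>i\<le>d. 5 * d choose i)" using card_subsets_le[OF T(1)] T(2) by simp
  finally have "2 ^ (5 * d) \<le> (\<Sum>i\<le>d. 5 * d choose i) * (\<Sum>i\<le>r. 5 * d choose i)"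
    using A by (meson le_trans mult_le_mono1)
  then have "real (2 ^ (5 * d)) \<le> real ((\<Sum>i\<le>d. 5 * d choose i) * (\<Sum>i\<le>r. 5 * d choose i))"
    by (rule of_nat_mono)
  then have main: "32 ^ d \<le> real (\<Sum>i\<le>d. 5 * d choose i) * real (\<Sum>i\<le>r. 5 * d choose i)"
    by (simp add: power_mult)
  have "real (\<Sum>i\<le>d. 5 * d choose i) \<le> (1 + 1 / 4) ^ (5 * d) * 4 ^ d"
    using sum_binomial_le[of "1 / 4" "5 * d" d] by (simp add: field_simps power_divide)
  moreover have "real (\<Sum>i\<le>r. 5 * d choose i) \<le> (1 + 1 / 10) ^ (5 * d) * (126 / 100) ^ d"
  proof -
    have "real (\<Sum>i\<le>r. 5 * d choose i) \<le> (1 + 1 / 10) ^ (5 * d) * 10 ^ r"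
      using sum_binomial_le[of "1 / 10" "5 * d" r] by (simp add: field_simps power_divide)
    \<comment> \<open>\<open>126 / 100\<close> is slightly above the tenth root of 10, and
      \<open>10 * r <= d\<close>.\<close>
    also have "10 ^ r \<le> (((126 / 100) ^ 10) ^ r :: real)"
      by (rule power_mono) (simp_all add: power_divide)
    also have "\<dots> \<le> (126 / 100) ^ d"
      unfolding power_mult[symmetric] by (rule power_increasing) (auto simp: r_def)
    finally show ?thesis by simp
  qed
  ultimately have "32 ^ d \<le> ((1 + 1 / 4) ^ (5 * d) * 4 ^ d) * ((1 + 1 / 10) ^ (5 * d) * (126 / 100) ^ d :: real)"
    by (intro order_trans[OF main] mult_mono) (auto intro!: sum_nonneg)
  also have "\<dots> = ((1 + 1 / 4) ^ 5 * 4 * ((1 + 1 / 10) ^ 5 * (126 / 100))) ^ d"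
    by (simp only: power_mult power_mult_distrib)
  \<comment> \<open>The base is about 24.8, below \<open>2^5 = 32\<close>. This comparison is what
    five points per unit of VC dimension provide.\<close>
  also have "\<dots> \<le> (25::real) ^ d" by (rule power_mono) (simp_all add: field_simps)
  finally have "(32::real) ^ d \<le> 25 ^ d" .
  moreover have "(25::real) ^ d < 32 ^ d" using d by (intro power_strict_mono) auto
  ultimately show False by simp
qed

section \<open>Elementary properties of shattering, \<open>VC\<close> and \<open>LVC\<close>\<close>

lemma shatters_subset:
  assumes "shatters H B" "A \<subseteq> B"
  shows "shatters H A"
  unfolding shatters_def
proof (intro conjI allI)
  show "finite A" using assms by (auto simp: shatters_def intro: finite_subset)
  fix l :: "'a \<Rightarrow> bool"
  obtain f where "f \<in> H" "\<forall>x\<in>B. f x = l x" using assms(1) by (auto simp: shatters_def)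
  then show "\<exists>f\<in>H. \<forall>x\<in>A. f x = l x" using assms(2) by (intro bexI[of _ f]) auto
qed

lemma VC_ge: "A \<subseteq> S \<Longrightarrow> shatters H A \<Longrightarrow> enat (card A) \<le> VC S H"
  unfolding VC_def by (intro Sup_upper) (auto simp: shatters_def)

lemma Sup_enat_attained:
  fixes K :: "enat set"
  assumes "Sup K = enat d" "d > 0"
  shows "enat d \<in> K"
proof (cases "K = {}")
  case True
  then show ?thesis using assms by (simp add: bot_enat_def zero_enat_def)
next
  case False
  then have "Sup K = (if finite K then Max K else \<infinity>)" by (simp add: Sup_enat_def)
  then show ?thesis using assms(1) Max_in[of K] False by (simp split: if_splits)
qed

lemma VC_attained:
  assumes "VC S H = enat d" "d > 0"
  obtains A where "A \<subseteq> S" "finite A" "card A = d" "shatters H A"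
  using Sup_enat_attained[OF assms[unfolded VC_def]] that by auto

lemma LVC_attained:
  assumes "LVC S H = enat k" "k > 0"
  shows "finite S \<longrightarrow> k \<le> card S" "\<And>T. T \<subseteq> S \<Longrightarrow> finite T \<Longrightarrow> card T = k \<Longrightarrow> shatters H T"
  using Sup_enat_attained[OF assms[unfolded LVC_def]] by auto

lemma ex_superset_card:
  assumes "finite A" "A \<subseteq> S" "card A \<le> k" "finite S \<longrightarrow> k \<le> card S"
  obtains B where "A \<subseteq> B" "B \<subseteq> S" "finite B" "card B = k"
proof (cases "finite S")
  case True
  then show ?thesis using exists_subset_between[of A k S] assms that finite_subset by metis
next
  case False
  then have "infinite (S - A)" using assms by simp
  then obtain C where "C \<subseteq> S - A" "finite C" "card C = k - card A"
    using infinite_arbitrarily_large by metis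
  moreover from this have "card (A \<union> C) = k"
    using assms by (subst card_Un_disjoint) auto
  ultimately show ?thesis using assms by (intro that[of "A \<union> C"]) auto
qed

lemma LVC_le_VC: "LVC S H \<le> VC S H"
  unfolding LVC_def
proof (intro Sup_least, clarify)
  fix k assume k: "finite S \<longrightarrow> k \<le> card S" "\<forall>T\<subseteq>S. finite T \<and> card T = k \<longrightarrow> shatters H T"
  obtain B where "B \<subseteq> S" "finite B" "card B = k"
    using ex_superset_card[of "{}" S k] k(1) by auto
  then show "enat k \<le> VC S H" using VC_ge[of B S H] k(2) by auto
qed

subsection \<open>Poissonized testers\<close>

text \<open>Markov's inequality for independent weights. It is applied with an indicator, to count
  nonzero weights on the near side, and with the identity, to bound the total weight on the far
  side.\<close>

lemma Pi_pmf_sum_markov: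
  fixes \<phi> :: "'b \<Rightarrow> real" and P :: "'b pmf"
  assumes T: "finite T" and P: "finite (set_pmf P)" and c: "c > 0"
    and \<phi>: "\<And>y. y \<in> set_pmf P \<Longrightarrow> \<phi> y \<ge> 0"
  shows "measure_pmf.prob (Pi_pmf T d (\<lambda>_. P)) {w. (\<Sum>x\<in>T. \<phi> (w x)) \<ge> c}
    \<le> real (card T) * measure_pmf.expectation P \<phi> / c"
proof -
  let ?Q = "Pi_pmf T d (\<lambda>_. P)"
  have supp: "w x \<in> set_pmf P" if "w \<in> set_pmf ?Q" "x \<in> T" for w x
    using that by (auto simp: set_Pi_pmf[OF T] PiE_dflt_def)
  have "finite (set_pmf ?Q)" by (auto simp: set_Pi_pmf[OF T] intro!: finite_PiE_dflt T P)
  then have int: "integrable (measure_pmf ?Q) f" for f :: "_ \<Rightarrow> real" by (rule integrable_measure_pmf_finite)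
  have "measure_pmf.prob ?Q {w. (\<Sum>x\<in>T. \<phi> (w x)) \<ge> c}
      = measure_pmf.expectation ?Q (indicator {w. (\<Sum>x\<in>T. \<phi> (w x)) \<ge> c})" by simp
  also have "\<dots> \<le> measure_pmf.expectation ?Q (\<lambda>w. (\<Sum>x\<in>T. \<phi> (w x)) / c)"
  proof (intro integral_mono_AE int)
    show "AE w in ?Q. indicat_real {w. (\<Sum>x\<in>T. \<phi> (w x)) \<ge> c} w \<le> (\<Sum>x\<in>T. \<phi> (w x)) / c"
      using c supp \<phi> by (auto simp: AE_measure_pmf_iff indicator_def intro!: divide_nonneg_pos sum_nonneg)
  qed
  also have "\<dots> = (\<Sum>x\<in>T. measure_pmf.expectation ?Q (\<lambda>w. \<phi> (w x))) / c"
    by (simp add: Bochner_Integration.integral_sum int)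
  also have "\<dots> = (\<Sum>x\<in>T. measure_pmf.expectation P \<phi>) / c"
  proof -
    have "measure_pmf.expectation ?Q (\<lambda>w. \<phi> (w x)) = measure_pmf.expectation P \<phi>" if "x \<in> T" for x
    proof -
      have "measure_pmf.expectation ?Q (\<lambda>w. \<phi> (w x)) = measure_pmf.expectation (map_pmf (\<lambda>w. w x) ?Q) \<phi>"
        by simp
      then show ?thesis using that by (simp only: Pi_pmf_component[OF T] if_True)
    qed
    then show ?thesis by simp
  qed
  finally show ?thesis by simp
qed

text \<open>For \<open>i < m\<close> one has \<open>y^i <= 2^m * (y / 2)^i\<close>, and the
  remaining sum is part of the series of \<open>exp (y / 2)\<close>. The crude factor
  \<open>2^m\<close> is harmless because the means to which this is applied are at least
  \<open>8 * m\<close>.\<close>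

lemma pois_lower_tail:
  assumes y: "y \<ge> 0"
  shows "measure_pmf.prob (pois y) {..<m} \<le> 2 ^ m * exp (- (y / 2))"
proof -
  have "measure_pmf.prob (pois y) {..<m} = (\<Sum>i<m. y ^ i / fact i * exp (- y))"
    using y by (simp add: measure_measure_pmf_finite pmf_pois)
  also have "\<dots> \<le> (\<Sum>i<m. 2 ^ m * exp (- y) * ((y / 2) ^ i / fact i))"
  proof (rule sum_mono)
    fix i assume "i \<in> {..<m}"
    then have "(2::real) ^ i \<le> 2 ^ m" by (intro power_increasing) auto
    then have "2 ^ i * ((y / 2) ^ i / fact i * exp (- y)) \<le> 2 ^ m * ((y / 2) ^ i / fact i * exp (- y))"
      using y by (intro mult_right_mono) auto
    then show "y ^ i / fact i * exp (- y) \<le> 2 ^ m * exp (- y) * ((y / 2) ^ i / fact i)"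
      by (simp add: power_divide field_simps)
  qed
  also have "\<dots> = 2 ^ m * exp (- y) * (\<Sum>i<m. (y / 2) ^ i / fact i)"
    by (simp add: sum_distrib_left)
  also have "(\<Sum>i<m. (y / 2) ^ i / fact i) \<le> exp (y / 2)"
  proof -
    have s: "(\<lambda>i. (y / 2) ^ i / fact i) sums exp (y / 2)"
      using exp_converges[of "y / 2"] by (simp add: field_simps)
    show ?thesis
      unfolding sums_unique[OF s] by (intro sum_le_suminf sums_summable[OF s]) (use y in auto)
  qed
  also have "2 ^ m * exp (- y) * exp (y / 2) = 2 ^ m * exp (- (y / 2))"
    by (simp flip: exp_add)
  finally show ?thesis by simp
qed

lemma map_take_replicate_pmf:
  assumes "m \<le> n"
  shows "map_pmf (take m) (replicate_pmf n p) = replicate_pmf m p"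
  using assms
proof (induction n arbitrary: m)
  case (Suc n)
  show ?case
  proof (cases m)
    case 0
    have "take 0 = (\<lambda>_ :: 'a list. [])" by (simp add: fun_eq_iff)
    then show ?thesis using 0 by simp
  next
    case (Suc m')
    then have IH: "map_pmf (take m') (replicate_pmf n p) = replicate_pmf m' p"
      using Suc.IH Suc.prems by simp
    have "map_pmf (take (Suc m')) (replicate_pmf (Suc n) p)
      = bind_pmf p (\<lambda>x. bind_pmf (map_pmf (take m') (replicate_pmf n p)) (\<lambda>ys. return_pmf (x # ys)))"
      by (simp add: map_bind_pmf bind_map_pmf)
    then show ?thesis unfolding IH using Suc by simp
  qed
qed simp

lemma replicate_map_pmf: "replicate_pmf n (map_pmf f p) = map_pmf (map f) (replicate_pmf n p)"
  by (induction n) (simp_all add: map_bind_pmf bind_map_pmf)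

lemma run_tester_cong:
  assumes "\<And>x. x \<in> set_pmf D \<Longrightarrow> f x = g x"
  shows "run_tester A m D f = run_tester A m D g"
proof -
  have "map_pmf (\<lambda>x. (x, f x)) D = map_pmf (\<lambda>x. (x, g x)) D"
    by (rule map_pmf_cong) (auto simp: assms)
  then show ?thesis by (simp add: run_tester_def)
qed

text \<open>
  Accepting short samples costs nothing on instances of the class, so only the far instances need a
  lower tail bound for the sample size.
\<close>

definition poissonized_run ::
  "(('a \<times> bool) list \<Rightarrow> bool pmf) \<Rightarrow> nat \<Rightarrow> ('a \<Rightarrow> bool) \<Rightarrow> 'a list \<Rightarrow> bool pmf" where
  "poissonized_run A m f xs =
     (if length xs < m then return_pmf True else A (map (\<lambda>x. (x, f x)) (take m xs)))"

lemma pmf_poissonized_run: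
  "pmf (bind_pmf (bind_pmf Q (\<lambda>n. replicate_pmf n D)) (poissonized_run A m f)) True
   = measure_pmf.expectation Q (\<lambda>n. if n < m then 1 else pmf (run_tester A m D f) True)"
proof -
  have "bind_pmf (replicate_pmf n D) (poissonized_run A m f)
      = (if n < m then return_pmf True else run_tester A m D f)" for n
  proof -
    have "bind_pmf (replicate_pmf n D) (poissonized_run A m f)
        = bind_pmf (replicate_pmf n D)
            (\<lambda>xs. if n < m then return_pmf True else A (map (\<lambda>x. (x, f x)) (take m xs)))"
      by (rule bind_pmf_cong) (auto simp: poissonized_run_def set_replicate_pmf)
    also have "\<dots> = (if n < m then return_pmf True
        else bind_pmf (map_pmf (take m) (replicate_pmf n D)) (\<lambda>xs. A (map (\<lambda>x. (x, f x)) xs)))"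
      by (auto simp: bind_map_pmf)
    finally show ?thesis
      by (simp add: map_take_replicate_pmf run_tester_def replicate_map_pmf bind_map_pmf)
  qed
  then have eq: "pmf (bind_pmf (replicate_pmf n D) (poissonized_run A m f)) True
      = (if n < m then 1 else pmf (run_tester A m D f) True)" for n
    by simp
  show ?thesis unfolding bind_assoc_pmf pmf_bind[of Q] eq ..
qed

lemma poissonized_run_bounds:
  fixes D :: "'a pmf" and f :: "'a \<Rightarrow> bool" and A :: "('a \<times> bool) list \<Rightarrow> bool pmf" and m :: nat
  assumes y: "y \<ge> 0"
  defines "a \<equiv> pmf (bind_pmf (bind_pmf (pois y) (\<lambda>n. replicate_pmf n D)) (poissonized_run A m f)) True"
  shows "pmf (run_tester A m D f) True \<le> a"
    "a \<le> pmf (run_tester A m D f) True + 2 ^ m * exp (- (y / 2))"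
proof -
  define p where "p = pmf (run_tester A m D f) True"
  have p: "0 \<le> p" "p \<le> 1" by (simp_all add: p_def pmf_le_1)
  have a: "a = measure_pmf.expectation (pois y) (\<lambda>n. if n < m then 1 else p)"
    unfolding a_def p_def by (rule pmf_poissonized_run)
  have int: "integrable (pois y) (\<lambda>n. if n < m then 1 else p)"
    by (rule integrable_pmf_bounded[where c = 1]) (use p in auto)
  have "measure_pmf.expectation (pois y) (\<lambda>_. p) \<le> a"
    unfolding a by (intro integral_mono int) (use p in auto)
  then show "pmf (run_tester A m D f) True \<le> a" by (simp add: p_def)
  have int': "integrable (pois y) (indicat_real {..<m})"
    by (rule integrable_pmf_bounded[where c = 1]) (auto simp: indicator_def)
  have "a \<le> measure_pmf.expectation (pois y) (\<lambda>n. p + indicator {..<m} n)"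
    unfolding a by (intro integral_mono int Bochner_Integration.integrable_add int')
      (use p in \<open>auto simp: indicator_def\<close>)
  also have "\<dots> = p + measure_pmf.prob (pois y) {..<m}"
    by (subst Bochner_Integration.integral_add) (use int' in auto)
  also have "\<dots> \<le> p + 2 ^ m * exp (- (y / 2))"
    using pois_lower_tail[OF y, of m] by simp
  finally show "a \<le> pmf (run_tester A m D f) True + 2 ^ m * exp (- (y / 2))" by (simp add: p_def)
qed

lemma pmf_bind_le:
  assumes "\<And>w. w \<in> set_pmf Q \<Longrightarrow> w \<notin> B \<Longrightarrow> pmf (K w) True \<le> c"
    and c: "0 \<le> c"
  shows "pmf (bind_pmf Q K) True \<le> c + measure_pmf.prob Q B"
proof -
  have int: "integrable Q (indicat_real B)"
    by (rule integrable_pmf_bounded[where c = 1]) (auto simp: indicator_def)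
  have "pmf (bind_pmf Q K) True \<le> measure_pmf.expectation Q (\<lambda>w. c + indicator B w)"
    unfolding pmf_bind
  proof (intro integral_mono_AE)
    show "AE w in Q. pmf (K w) True \<le> c + indicator B w"
      using assms by (auto simp: AE_measure_pmf_iff indicator_def pmf_le_1 add_increasing)
  qed (use int in auto)
  also have "\<dots> = c + measure_pmf.prob Q B"
    by (subst Bochner_Integration.integral_add) (use int in auto)
  finally show ?thesis .
qed

lemma pmf_bind_ge:
  assumes "\<And>w. w \<in> set_pmf Q \<Longrightarrow> w \<notin> B \<Longrightarrow> pmf (K w) True \<ge> c"
    and c: "c \<le> 1"
  shows "pmf (bind_pmf Q K) True \<ge> c - measure_pmf.prob Q B"
proof -
  have int: "integrable Q (indicat_real B)"
    by (rule integrable_pmf_bounded[where c = 1]) (auto simp: indicator_def)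
  have "c - measure_pmf.prob Q B = measure_pmf.expectation Q (\<lambda>w. c - indicator B w)"
    by (subst Bochner_Integration.integral_diff) (use int in auto)
  also have "\<dots> \<le> pmf (bind_pmf Q K) True"
    unfolding pmf_bind
  proof (intro integral_mono_AE)
    show "AE w in Q. c - indicator B w \<le> pmf (K w) True"
      using assms pmf_nonneg by (auto simp: AE_measure_pmf_iff indicator_def intro: order_trans[OF _ pmf_nonneg])
  qed (use int in auto)
  finally show ?thesis .
qed

subsection \<open>The lower bound\<close>

text \<open>Le Cam's two-point method with two random weight vectors and a single labelling
  \<open>l\<close>. On the near side \<open>l\<close> agrees on the support with a member of the
  class; on the far side it differs from each member in more than \<open>d / 10\<close> points, each
  of mass at least \<open>1 / (500 * d)\<close>, which explains the bound 1/5000 on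
  \<open>\<epsilon>\<close>. Acceptance has probability at least \<open>2/3 - 1/50\<close> on one
  side and at most \<open>1/3 + 1/7 + 1/50\<close> on the other, but these two probabilities differ
  by at most 1/100.\<close>

lemma no_tester_below:
  fixes X S :: "'a set" and d k m :: nat
  assumes S: "S \<subseteq> X" and H: "H \<subseteq> X \<rightarrow>\<^sub>E UNIV"
    and VC: "VC S H = enat d" and LVC: "LVC S H = enat k" and card_S: "finite S \<longrightarrow> 5 * d < card S"
    and kd: "k \<le> d" and d: "d \<ge> 1000"
    and m: "real m \<le> real k / (10 ^ 6 * ln (real d))" and k: "2 \<le> real k / (10 ^ 6 * ln (real d))"
    and eps: "\<epsilon> \<le> 1 / 5000" and A: "is_tester X H \<epsilon> m A"
  shows False
proof -
  define b where "b = real k / (10 ^ 6 * ln (real d))"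
  have lnd: "ln (real d) \<ge> 1"
  proof -
    have "exp 1 \<le> real d" using exp_le d by linarith
    then show ?thesis using d by (simp add: ln_ge_iff)
  qed
  have k0: "k > 0" using k lnd by (cases k) auto
  obtain T where T: "T \<subseteq> S" "finite T" "card T = 5 * d"
    by (rule ex_superset_card[of "{}" S "5 * d"]) (use card_S in auto)
  have sh_le: "card B \<le> d" if "B \<subseteq> T" "shatters H B" for B
    using VC_ge[of B S H] that T VC by auto
  obtain l where l: "\<And>h. h \<in> H \<Longrightarrow> d < 10 * card {x \<in> T. h x \<noteq> l x}"
    using ex_far_labelling[of T d H] T(2,3) d sh_le by auto
  have ag: "\<exists>h\<in>H. \<forall>x\<in>B. h x = l x" if B: "B \<subseteq> T" "card B \<le> k" for B
  proof -
    have B': "finite B" "B \<subseteq> S" using B T finite_subset by auto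
    obtain B' where "B \<subseteq> B'" "B' \<subseteq> S" "finite B'" "card B' = k"
      by (rule ex_superset_card[OF B' B(2) LVC_attained(1)[OF LVC k0]])
    then have "shatters H B" using LVC_attained(2)[OF LVC k0, of B'] shatters_subset[of H B' B] by simp
    then show ?thesis by (simp add: shatters_def)
  qed
  have HX: "f \<in> X \<rightarrow>\<^sub>E UNIV" if "f \<in> H" for f using H that by auto
  have Hne: "H \<noteq> {}" using ag[of "{}"] by auto
  \<comment> \<open>Each of the \<open>5 * d\<close> coordinates may then contribute an error of
    \<open>2 * exp (- D)\<close>, at most \<open>2 / (1000 * d)\<close>, for a total of
    1/100.\<close>
  define D where "D = nat \<lceil>ln (1000 * real d)\<rceil>"
  have ln1000: "0 < ln (1000 * real d)" using d by (intro ln_gt_zero) simp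
  have D: "ln (1000 * real d) \<le> real D" unfolding D_def by linarith
  have D1: "D \<ge> 1" using D ln1000 by linarith
  have "real D \<le> ln (1000 * real d) + 1" unfolding D_def using ln1000 by linarith
  also have "ln (1000 * real d) \<le> ln (real d * real d)" using d by (intro ln_mono) auto
  also have "\<dots> = 2 * ln (real d)" using d by (simp add: ln_mult)
  finally have D3: "real D \<le> 3 * ln (real d)" using lnd by simp
  \<comment> \<open>A weight from \<open>U\<close> is nonzero with probability at most
    \<open>2 / s\<close>, so the expected number of nonzero weights among the \<open>5 * d\<close>
    points is at most \<open>k / 50\<close>.\<close>
  define s where "s = 500 * real d / real k"
  have s: "s \<ge> 500" using kd k0 by (simp add: s_def field_simps)
  then have s2: "s \<ge> 2" by simp
  obtain U U' :: "real pmf" where finU: "finite (set_pmf U)"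
    and rU: "set_pmf U \<subseteq> insert 0 {s..s * (1 + 4 * real D ^ 2)}"
    and finU': "finite (set_pmf U')"
    and rU': "set_pmf U' \<subseteq> {1..s * (1 + 4 * real D ^ 2)}"
    and mom: "\<And>r. r \<le> Suc D \<Longrightarrow>
       measure_pmf.expectation U (\<lambda>x. x ^ r) = measure_pmf.expectation U' (\<lambda>x. x ^ r)"
    and U0: "measure_pmf.prob U {0<..} \<le> 2 / s"
    and EU': "measure_pmf.expectation U' (\<lambda>x. x) \<le> 2"
    by (rule moment_matching_pmfs[OF D1 s2]) (rule that; blast)
  note fin = finU finU'
  \<comment> \<open>The least total weight on the far side, \<open>5 * d\<close>, then has Poisson
    mean \<open>8 * b\<close>. The largest rate of a single point is of order
    \<open>D^2 / ln d\<close> times a small constant; the factor \<open>10^6\<close> in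
    \<open>b\<close> brings it below \<open>D / 18\<close>.\<close>
  define lam where "lam = 8 * b / (5 * real d)"
  have b2: "b \<ge> 2" using k by (simp add: b_def)
  have lam0: "lam \<ge> 0" using b2 d by (simp add: lam_def)
  have lamU: "lam * (s * (1 + 4 * real D ^ 2)) \<le> real D / 18"
  proof -
    have "1 + 4 * real D ^ 2 \<le> 5 * real D ^ 2" using D1 by simp
    then have "lam * (s * (1 + 4 * real D ^ 2)) \<le> lam * (s * (5 * real D ^ 2))"
      using lam0 s by (intro mult_left_mono) auto
    also have "\<dots> = 4000 * real D / (10 ^ 6 * ln (real d)) * real D"
      using k0 d by (simp add: lam_def s_def b_def field_simps power2_eq_square)
    also have "\<dots> \<le> 4000 * (3 * ln (real d)) / (10 ^ 6 * ln (real d)) * real D"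
      using D3 lnd by (intro mult_right_mono divide_right_mono) auto
    also have "\<dots> = 12 / 1000 * real D" using lnd by simp
    also have "\<dots> \<le> real D / 18" by simp
    finally show ?thesis .
  qed
  have range: "0 \<le> x \<and> lam * x \<le> real D / 18" if "x \<in> set_pmf U \<union> set_pmf U'" for x
  proof -
    have "0 \<le> s * (1 + 4 * real D ^ 2)" using s by (intro mult_nonneg_nonneg) auto
    then have x: "0 \<le> x" "x \<le> s * (1 + 4 * real D ^ 2)" using that rU rU' s by fastforce+
    then have "lam * x \<le> lam * (s * (1 + 4 * real D ^ 2))" using lam0 by (intro mult_left_mono)
    then show ?thesis using lamU x(1) by linarith
  qed
  define mix where "mix P = bind_pmf P (\<lambda>x. pois (lam * x))" for P
  define perm where "perm N = pmf_of_set (permutations_of_multiset (\<Sum>x\<in>T. replicate_mset (N x) x))" for N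
  define g where "g = poissonized_run A m l"
  define K where "K w = bind_pmf (bind_pmf (Pi_pmf T 0 (\<lambda>x. pois (lam * w x))) perm) g" for w
  define Q where "Q P = Pi_pmf T 0 (\<lambda>_. P)" for P :: "real pmf"
  \<comment> \<open>Random weights followed by Poisson counts form independent mixtures, the shape
    in which \<open>Pi_pmf_closeness\<close> applies.\<close>
  have QK: "bind_pmf (Q P) K = bind_pmf (Pi_pmf T 0 (\<lambda>_. mix P)) (\<lambda>N. bind_pmf (perm N) g)" for P
    unfolding mix_def Q_def K_def[abs_def] by (subst Pi_pmf_bind[OF T(2), where d' = 0]) (simp add: bind_assoc_pmf)
  have "\<bar>pmf (bind_pmf (Q U) K) True - pmf (bind_pmf (Q U') K) True\<bar> \<le> real (card T) * (2 * exp (- real D))"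
    unfolding QK
    by (rule Pi_pmf_closeness[OF _ T(2)])
      (unfold mix_def, rule poisson_mixture_closeness[OF fin range mom lam0])
  also have "\<dots> \<le> 1 / 100"
  proof -
    have "exp (- real D) \<le> exp (- ln (1000 * real d))" using D by simp
    also have "\<dots> = 1 / (1000 * real d)" using d by (simp add: exp_minus field_simps)
    finally have "10 * real d * exp (- real D) \<le> 10 * real d * (1 / (1000 * real d))"
      by (intro mult_left_mono) auto
    then show ?thesis using d T(3) by simp
  qed
  finally have close: "\<bar>pmf (bind_pmf (Q U) K) True - pmf (bind_pmf (Q U') K) True\<bar> \<le> 1 / 100" .

  have supp: "w x \<in> set_pmf P" if "w \<in> set_pmf (Q P)" "x \<in> T" for w x P
    using that by (auto simp: Q_def set_Pi_pmf[OF T(2)] PiE_dflt_def)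
  \<comment> \<open>Normalization is stated as a product in order to include total weight 0, where a
    point mass serves; its single support point is the reason for \<open>max 1\<close>.\<close>
  have norm: "\<exists>p. set_pmf p \<subseteq> T \<and> (\<forall>x\<in>T. pmf p x * (\<Sum>x\<in>T. w x) = w x) \<and>
      card (set_pmf p) \<le> max 1 (card {x \<in> T. w x > 0})"
    if w: "\<And>x. x \<in> T \<Longrightarrow> w x \<ge> 0" for w
  proof (cases "(\<Sum>x\<in>T. w x) = 0")
    case True
    have "T \<noteq> {}" using T(3) d by auto
    then obtain t where "t \<in> T" by auto
    moreover have "w x = 0" if "x \<in> T" for x using True w T(2) that by (simp add: sum_nonneg_eq_0_iff)
    ultimately show ?thesis using True by (intro exI[of _ "return_pmf t"]) auto
  next
    case False
    have nn: "w x / (\<Sum>x\<in>T. w x) \<ge> 0" if "x \<in> T" for x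
      using w that by (intro divide_nonneg_nonneg sum_nonneg) auto
    have "(\<Sum>x\<in>T. w x / (\<Sum>x\<in>T. w x)) = 1" using False by (simp flip: sum_divide_distrib)
    then obtain p where p: "set_pmf p \<subseteq> T" "\<And>x. x \<in> T \<Longrightarrow> pmf p x = w x / (\<Sum>x\<in>T. w x)"
      using ex_pmf_of_weights[of T "\<lambda>x. w x / (\<Sum>x\<in>T. w x)"] T(2) nn by blast
    have "set_pmf p \<subseteq> {x \<in> T. w x > 0}"
    proof
      fix x assume x: "x \<in> set_pmf p"
      then have "w x \<noteq> 0" using p by (auto simp: set_pmf_iff)
      then show "x \<in> {x \<in> T. w x > 0}" using x p(1) w[of x] by auto
    qed
    then have "card (set_pmf p) \<le> card {x \<in> T. w x > 0}" using T(2) by (intro card_mono) auto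
    then show ?thesis using p False by (intro exI[of _ p]) simp
  qed
  have KD: "K w = bind_pmf (bind_pmf (pois (lam * (\<Sum>x\<in>T. w x))) (\<lambda>n. replicate_pmf n p)) g"
    if "\<And>x. x \<in> T \<Longrightarrow> w x \<ge> 0" "set_pmf p \<subseteq> T" "\<forall>x\<in>T. pmf p x * (\<Sum>x\<in>T. w x) = w x" for w p
    unfolding K_def perm_def[abs_def]
    by (subst poissonization[where p = p and W = "\<Sum>x\<in>T. w x"]) (use T(2) lam0 that in auto)

  have near: "2 / 3 - measure_pmf.prob (Q U) {w. (\<Sum>x\<in>T. indicator {0<..} (w x)) \<ge> real k}
      \<le> pmf (bind_pmf (Q U) K) True"
  proof (rule pmf_bind_ge)
    fix w assume wQ: "w \<in> set_pmf (Q U)"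
      and good: "w \<notin> {w. (\<Sum>x\<in>T. indicator {0<..} (w x)) \<ge> real k}"
    have w0: "w x \<ge> 0" if "x \<in> T" for x using supp[OF wQ that] range by auto
    obtain p where p: "set_pmf p \<subseteq> T" "\<forall>x\<in>T. pmf p x * (\<Sum>x\<in>T. w x) = w x"
        "card (set_pmf p) \<le> max 1 (card {x \<in> T. w x > 0})"
      using norm[of w] w0 by blast
    have Kw: "K w = bind_pmf (bind_pmf (pois (lam * (\<Sum>x\<in>T. w x))) (\<lambda>n. replicate_pmf n p)) g"
      by (rule KD) (use w0 p in auto)
    have "(\<Sum>x\<in>T. indicator {0<..} (w x)) = (\<Sum>x\<in>{x \<in> T. w x > 0}. 1::real)"
      using T(2) by (intro sum.mono_neutral_cong_right) (auto simp: indicator_def)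
    then have card_k: "card {x \<in> T. w x > 0} \<le> k" using good by simp
    have "\<exists>f\<in>H. \<forall>x\<in>set_pmf p. f x = l x"
      using ag[of "set_pmf p"] p card_k k0 by simp
    then obtain f where f: "f \<in> H" "\<And>x. x \<in> set_pmf p \<Longrightarrow> f x = l x" by blast
    have "2 / 3 \<le> pmf (run_tester A m p f) True"
      using A f(1) p(1) T(1) S HX[OF f(1)] unfolding is_tester_def by blast
    also have "run_tester A m p f = run_tester A m p l" by (rule run_tester_cong) (rule f(2))
    also have "pmf (run_tester A m p l) True \<le> pmf (K w) True"
      unfolding Kw g_def using lam0 w0 by (intro poissonized_run_bounds mult_nonneg_nonneg sum_nonneg)
    finally show "2 / 3 \<le> pmf (K w) True" .
  qed simp
  have "measure_pmf.prob (Q U) {w. (\<Sum>x\<in>T. indicator {0<..} (w x)) \<ge> real k}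
      \<le> real (card T) * measure_pmf.expectation U (indicator {0<..}) / real k"
    unfolding Q_def by (rule Pi_pmf_sum_markov) (use T fin k0 in auto)
  also have "\<dots> \<le> real (5 * d) * (2 / s) / real k"
    using U0 T by (intro divide_right_mono mult_mono) auto
  also have "\<dots> = 1 / 50" using k0 d by (simp add: s_def)
  finally have near': "pmf (bind_pmf (Q U) K) True \<ge> 2 / 3 - 1 / 50" using near by linarith

  have far: "pmf (bind_pmf (Q U') K) True
      \<le> 1 / 3 + 1 / 7 + measure_pmf.prob (Q U') {w. (\<Sum>x\<in>T. w x) \<ge> 500 * real d}"
  proof (rule pmf_bind_le)
    fix w assume wQ: "w \<in> set_pmf (Q U')" and good: "w \<notin> {w. (\<Sum>x\<in>T. w x) \<ge> 500 * real d}"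
    define W where "W = (\<Sum>x\<in>T. w x)"
    have w1: "w x \<ge> 1" if "x \<in> T" for x using supp[OF wQ that] rU' by auto
    then have w0: "w x \<ge> 0" if "x \<in> T" for x using that by force
    obtain p where p: "set_pmf p \<subseteq> T" "\<forall>x\<in>T. pmf p x * (\<Sum>x\<in>T. w x) = w x"
        "card (set_pmf p) \<le> max 1 (card {x \<in> T. w x > 0})"
      using norm[of w] w0 by blast
    have Kw: "K w = bind_pmf (bind_pmf (pois (lam * (\<Sum>x\<in>T. w x))) (\<lambda>n. replicate_pmf n p)) g"
      by (rule KD) (use w0 p in auto)
    have "W \<ge> (\<Sum>x\<in>T. 1)" unfolding W_def by (intro sum_mono w1)
    then have W: "W \<ge> 5 * real d" "W < 500 * real d" using T good by (auto simp: W_def)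
    have W0: "W > 0" using W(1) d by linarith
    \<comment> \<open>A tester promises something only for extensional functions; this restriction
      has the labels of \<open>l\<close> on the support.\<close>
    define f where "f = (\<lambda>x\<in>X. l x)"
    have "dist_fun p f h \<ge> 1 / 5000" if h: "h \<in> H" for h
    proof -
      let ?B = "{x \<in> T. h x \<noteq> l x}"
      have "real (card ?B) * (1 / (500 * real d)) = (\<Sum>x\<in>?B. 1 / (500 * real d))" by simp
      also have "\<dots> \<le> (\<Sum>x\<in>?B. pmf p x)"
      proof (rule sum_mono)
        fix x assume x: "x \<in> ?B"
        then have "pmf p x * W = w x" using p(2) by (auto simp: W_def)
        then have "pmf p x = w x / W" using W0 by (simp add: field_simps)
        moreover have "1 / (500 * real d) \<le> w x / W" using w1[of x] x W W0 by (intro frac_le) auto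
        ultimately show "1 / (500 * real d) \<le> pmf p x" by simp
      qed
      also have "\<dots> = measure_pmf.prob p ?B" using T(2) by (simp add: measure_measure_pmf_finite)
      also have "\<dots> \<le> dist_fun p f h"
        unfolding dist_fun_def f_def using T(1) S by (intro measure_pmf.finite_measure_mono) auto
      finally have "real (card ?B) * (1 / (500 * real d)) \<le> dist_fun p f h" .
      moreover have "real d < real (10 * card ?B)" using l[OF h] by (simp only: of_nat_less_iff)
      then have "1 / 5000 \<le> real (card ?B) * (1 / (500 * real d))" using d by (simp add: field_simps)
      ultimately show ?thesis by simp
    qed
    then have "\<epsilon> \<le> dist_fun p f h" if "h \<in> H" for h
      using eps that by (meson order_trans)
    then have "dist_class p f H \<ge> \<epsilon>"
      unfolding dist_class_def by (intro cINF_greatest Hne)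
    moreover have "set_pmf p \<subseteq> X" "f \<in> X \<rightarrow>\<^sub>E UNIV" using p(1) T(1) S by (auto simp: f_def)
    ultimately have "2 / 3 \<le> pmf (run_tester A m p f) False"
      using A unfolding is_tester_def by blast
    moreover have "run_tester A m p f = run_tester A m p l"
      by (rule run_tester_cong) (use p(1) T(1) S in \<open>auto simp: f_def\<close>)
    ultimately have a: "pmf (run_tester A m p l) True \<le> 1 / 3"
      by (simp add: pmf_False_conv_True)
    have "pmf (K w) True \<le> pmf (run_tester A m p l) True + 2 ^ m * exp (- (lam * W / 2))"
      unfolding Kw g_def W_def using lam0 w0 by (intro poissonized_run_bounds mult_nonneg_nonneg sum_nonneg)
    \<comment> \<open>The mean \<open>lam * W\<close> is at least \<open>8 * b\<close>, and
      \<open>2^m <= exp b\<close>, so the exponent is at most \<open>b - 4 * b\<close>, which is at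
      most -6 because \<open>b >= 2\<close>.\<close>
    also have "2 ^ m * exp (- (lam * W / 2)) \<le> 1 / 7"
    proof -
      have "(2::real) ^ m \<le> exp 1 ^ m"
        using exp_ge_add_one_self[of "1::real"] by (intro power_mono) auto
      also have "\<dots> = exp (real m)" by (simp flip: exp_of_nat_mult)
      also have "\<dots> \<le> exp b" using m by (simp add: b_def)
      finally have "2 ^ m * exp (- (lam * W / 2)) \<le> exp b * exp (- (lam * W / 2))"
        by (intro mult_right_mono) auto
      also have "lam * (5 * real d) \<le> lam * W" by (intro mult_left_mono W lam0)
      then have "8 * b \<le> lam * W" using d by (simp add: lam_def)
      then have "exp b * exp (- (lam * W / 2)) \<le> exp (- 6)"
        using b2 by (simp flip: exp_add)
      also have "exp (- 6) \<le> 1 / (7::real)"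
        using exp_ge_add_one_self[of "6::real"] by (simp add: exp_minus field_simps)
      finally show ?thesis .
    qed
    finally show "pmf (K w) True \<le> 1 / 3 + 1 / 7" using a by linarith
  qed simp
  have "measure_pmf.prob (Q U') {w. (\<Sum>x\<in>T. w x) \<ge> 500 * real d}
      \<le> real (card T) * measure_pmf.expectation U' (\<lambda>x. x) / (500 * real d)"
    unfolding Q_def by (rule Pi_pmf_sum_markov) (use T fin d rU' in auto)
  also have "\<dots> \<le> real (5 * d) * 2 / (500 * real d)"
    unfolding T(3) by (intro divide_right_mono mult_left_mono EU') auto
  also have "\<dots> = 1 / 50" using d by simp
  finally have "pmf (bind_pmf (Q U') K) True \<le> 1 / 3 + 1 / 7 + 1 / 50" using far by linarith
  with near' close show False by linarith
qed

section \<open>From testers to sample complexity\<close>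

lemma m_test_cases:
  "m_test X H \<epsilon> = \<infinity> \<or> (\<exists>m A. m_test X H \<epsilon> = enat m \<and> is_tester X H \<epsilon> m A)"
proof (cases "{enat m |m. \<exists>A. is_tester X H \<epsilon> m A} = {}")
  case True
  then show ?thesis unfolding m_test_def by (simp only: Inf_enat_def if_True) simp
next
  case False
  then obtain y where "y \<in> {enat m |m. \<exists>A. is_tester X H \<epsilon> m A}" by blast
  then have "(LEAST x. x \<in> {enat m |m. \<exists>A. is_tester X H \<epsilon> m A}) \<in> {enat m |m. \<exists>A. is_tester X H \<epsilon> m A}"
    by (rule LeastI)
  then have "m_test X H \<epsilon> \<in> {enat m |m. \<exists>A. is_tester X H \<epsilon> m A}"
    unfolding m_test_def Inf_enat_def using False by (simp only: if_False)
  then show ?thesis by auto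
qed

lemma m_test_le: "is_tester X H \<epsilon> m A \<Longrightarrow> m_test X H \<epsilon> \<le> enat m"
  unfolding m_test_def by (rule Inf_lower) auto

lemma admissibleE:
  assumes adm: "admissible C X H S" and C: "C > 0"
  obtains d k where "VC S H = enat d" "LVC S H = enat k" "2 \<le> d" "0 < k" "k \<le> d"
    "finite S \<longrightarrow> 5 * d < card S" "C * real d powr (3 / 4) * sqrt (ln (real d)) \<le> real k"
    "H \<subseteq> X \<rightarrow>\<^sub>E UNIV" "S \<subseteq> X" "rate H S = (real k)\<^sup>2 / (real d * ln (real d))"
proof -
  obtain d where d: "VC S H = enat d" using adm by (auto simp: admissible_def)
  have d2: "2 \<le> d" using adm d by (simp add: admissible_def numeral_eq_enat)
  have "LVC S H \<le> enat d" using LVC_le_VC[of S H] d d2 by (simp add: zero_enat_def)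
  then obtain k where k: "LVC S H = enat k" "k \<le> d" by (cases "LVC S H") auto
  have kge: "C * real d powr (3 / 4) * sqrt (ln (real d)) \<le> real k"
    using adm d k by (simp add: admissible_def)
  moreover have "C * real d powr (3 / 4) * sqrt (ln (real d)) > 0" using C d2 by simp
  ultimately have "0 < k" by (cases k) auto
  then show ?thesis
    using that[OF d k(1) d2 _ k(2) _ kge] adm d k by (simp add: admissible_def rate_def)
qed

text \<open>As \<open>sqrt (ln d) <= d powr (3/4)\<close>, the hypothesis on \<open>k\<close>
  implies \<open>k >= 2 * 10^6 * ln d\<close>. This yields both side conditions of
  \<open>no_tester_below\<close>: the excluded sample sizes reach up to at least 2, and
  \<open>k <= d\<close> forces \<open>d >= 1000\<close>.\<close>

lemma lower_bound_constants: "lower_bound TYPE('a) (2 * 10 ^ 6) (1 / 10 ^ 6) (1 / 5000)"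
  unfolding lower_bound_def
proof (intro allI impI)
  fix X :: "'a set" and H S and \<epsilon> :: real
  assume adm: "admissible (2 * 10 ^ 6) X H S" and eps: "0 < \<epsilon> \<and> \<epsilon> < 1 / 5000"
  obtain d k where dk: "VC S H = enat d" "LVC S H = enat k" "2 \<le> d" "0 < k" "k \<le> d"
    "finite S \<longrightarrow> 5 * d < card S" "2 * 10 ^ 6 * real d powr (3 / 4) * sqrt (ln (real d)) \<le> real k"
    "H \<subseteq> X \<rightarrow>\<^sub>E UNIV" "S \<subseteq> X" and rate: "rate H S = (real k)\<^sup>2 / (real d * ln (real d))"
    by (rule admissibleE[OF adm]) auto
  have lnd: "ln (real d) > 0" using dk by simp
  have "ln (real d) = sqrt (ln (real d)) * sqrt (ln (real d))" using lnd by simp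
  also have "\<dots> \<le> real d powr (3 / 4) * sqrt (ln (real d))"
  proof (rule mult_right_mono)
    have "sqrt (ln (real d)) \<le> sqrt (real d)" using ln_bound[of "real d"] dk by simp
    also have "\<dots> = real d powr (1 / 2)" by (simp add: powr_half_sqrt)
    also have "\<dots> \<le> real d powr (3 / 4)" using dk by (intro powr_mono) auto
    finally show "sqrt (ln (real d)) \<le> real d powr (3 / 4)" .
  qed (use lnd in simp)
  finally have kln: "2 * 10 ^ 6 * ln (real d) \<le> real k" using dk(7) by simp
  have "ln 2 \<le> ln (real d)" using dk by (intro ln_mono) auto
  then have "1 / 2 \<le> ln (real d)" using ln2_ge_two_thirds by linarith
  then have "2 * 10 ^ 6 * (1 / 2) \<le> 2 * 10 ^ 6 * ln (real d)" by (intro mult_left_mono) auto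
  also have "\<dots> \<le> real d" using kln dk(5) by simp
  finally have d1000: "1000 \<le> d" by simp
  have "1 / 10 ^ 6 * rate H S = real k / (10 ^ 6 * ln (real d)) * (real k / real d)"
    unfolding rate by (simp add: power2_eq_square)
  also have "\<dots> \<le> real k / (10 ^ 6 * ln (real d)) * 1"
    using dk lnd by (intro mult_left_mono) auto
  finally have rate_le: "1 / 10 ^ 6 * rate H S \<le> real k / (10 ^ 6 * ln (real d))" by simp
  show "ereal (1 / 10 ^ 6 * rate H S) \<le> ereal_of_enat (m_test X H \<epsilon>)"
  proof (cases "m_test X H \<epsilon> = \<infinity>")
    case False
    then obtain m A where m: "m_test X H \<epsilon> = enat m" "is_tester X H \<epsilon> m A"
      using m_test_cases[of X H \<epsilon>] by auto
    have "real k / (10 ^ 6 * ln (real d)) < real m"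
    proof (rule ccontr)
      assume "\<not> real k / (10 ^ 6 * ln (real d)) < real m"
      then have mk: "real m \<le> real k / (10 ^ 6 * ln (real d))" by simp
      have k2: "2 \<le> real k / (10 ^ 6 * ln (real d))" using kln lnd by (simp add: field_simps)
      show False
        by (rule no_tester_below[OF dk(9,8,1,2,6,5) d1000 mk k2 _ m(2)]) (use eps in simp)
    qed
    then show ?thesis using rate_le m(1) by simp
  qed simp
qed

subsection \<open>Transfer between domain types\<close>

lemma LVC_ge:
  assumes "finite S \<longrightarrow> k \<le> card S" "\<And>T. T \<subseteq> S \<Longrightarrow> finite T \<Longrightarrow> card T = k \<Longrightarrow> shatters H T"
  shows "enat k \<le> LVC S H"
  unfolding LVC_def using assms by (intro Sup_upper) auto

text \<open>Finitely many sets certify both values: a shattered set of size \<open>d\<close>, an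
  unshattered set of each size in \<open>{k<..d}\<close>, and \<open>5 * d + 1\<close> points for
  the size condition. Sizes above \<open>d\<close> are ruled out by \<open>VC\<close>
  itself.\<close>

lemma ex_finite_witness:
  assumes VC: "VC S H = enat d" and LVC: "LVC S H = enat k" and d: "0 < d" and k: "0 < k"
    and S: "finite S \<longrightarrow> 5 * d < card S"
  obtains S0 where "S0 \<subseteq> S" "finite S0" "5 * d < card S0" "VC S0 H = enat d" "LVC S0 H = enat k"
proof -
  obtain T where T: "T \<subseteq> S" "finite T" "card T = d" "shatters H T" using VC_attained[OF VC d] .
  have "\<exists>B\<subseteq>S. finite B \<and> card B = j \<and> \<not> shatters H B" if j: "j \<in> {k<..d}" for j
  proof (rule ccontr)
    assume "\<not> ?thesis"
    then have "enat j \<le> LVC S H" using S j by (intro LVC_ge) auto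
    then show False using LVC j by simp
  qed
  then obtain B where B: "\<And>j. j \<in> {k<..d} \<Longrightarrow> B j \<subseteq> S \<and> finite (B j) \<and> card (B j) = j \<and> \<not> shatters H (B j)"
    by metis
  obtain E where E: "{} \<subseteq> E" "E \<subseteq> S" "finite E" "card E = 5 * d + 1"
    by (rule ex_superset_card[of "{}" S "5 * d + 1"]) (use S in auto)
  define S0 where "S0 = T \<union> (\<Union>j\<in>{k<..d}. B j) \<union> E"
  have "(\<Union>j\<in>{k<..d}. B j) \<subseteq> S" "finite (\<Union>j\<in>{k<..d}. B j)" using B by blast+
  then have S0: "S0 \<subseteq> S" "finite S0" using T E by (simp_all add: S0_def)
  have card: "5 * d < card S0"
    using card_mono[OF S0(2), of E] E by (auto simp: S0_def)
  have VC0: "VC S0 H = enat d"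
  proof (rule antisym)
    show "VC S0 H \<le> enat d"
      unfolding VC_def
    proof (intro Sup_least, clarify)
      fix T' assume "T' \<subseteq> S0" "finite T'" "shatters H T'"
      then show "enat (card T') \<le> enat d" using VC_ge[of T' S H] S0(1) VC by simp
    qed
    show "enat d \<le> VC S0 H" using VC_ge[of T S0 H] T by (auto simp: S0_def)
  qed
  have "LVC S0 H = enat k"
  proof (rule antisym)
    show "LVC S0 H \<le> enat k"
      unfolding LVC_def
    proof (intro Sup_least, clarify)
      fix j assume j: "finite S0 \<longrightarrow> j \<le> card S0" "\<forall>T\<subseteq>S0. finite T \<and> card T = j \<longrightarrow> shatters H T"
      obtain E' where E': "{} \<subseteq> E'" "E' \<subseteq> S0" "finite E'" "card E' = j"
        by (rule ex_superset_card[of "{}" S0 j]) (use j in auto)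
      then have "j \<le> d" using VC_ge[of E' S0 H] j VC0 by auto
      moreover have False if "k < j" "j \<le> d"
      proof -
        have "B j \<subseteq> S0" using that by (auto simp: S0_def)
        then show False using j B[of j] that by auto
      qed
      ultimately show "enat j \<le> enat k" by (meson enat_ord_simps(1) not_le)
    qed
    have "k \<le> d"
      using LVC_le_VC[of S H] VC LVC d by (simp add: zero_enat_def)
    then show "enat k \<le> LVC S0 H"
      using LVC_attained(2)[OF LVC k] S0 card by (intro LVC_ge) auto
  qed
  then show ?thesis using that[OF S0 card VC0] by blast
qed

lemma VC_LVC_transport:
  assumes bij: "bij_betw \<psi> S' S" and sh: "\<And>A. A \<subseteq> S' \<Longrightarrow> shatters H' A \<longleftrightarrow> shatters H (\<psi> ` A)"
  shows "VC S' H' = VC S H" "LVC S' H' = LVC S H"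
proof -
  have inj: "inj_on \<psi> S'" and im: "\<psi> ` S' = S" using bij by (auto simp: bij_betw_def)
  have pull: "\<exists>A\<subseteq>S'. \<psi> ` A = T \<and> (finite A \<longleftrightarrow> finite T) \<and> card A = card T" if "T \<subseteq> S" for T
  proof -
    obtain A where A: "A \<subseteq> S'" "\<psi> ` A = T" using \<open>T \<subseteq> S\<close> im by (metis subset_imageE)
    have "inj_on \<psi> A" using inj A(1) by (rule inj_on_subset)
    then show ?thesis using A by (intro exI[of _ A]) (auto simp: card_image finite_image_iff)
  qed
  have push: "\<psi> ` A \<subseteq> S" "finite (\<psi> ` A) \<longleftrightarrow> finite A" "card (\<psi> ` A) = card A" if "A \<subseteq> S'" for A
    using that inj im by (auto simp: card_image finite_image_iff inj_on_subset)
  have "(\<exists>T\<subseteq>S'. finite T \<and> card T = k \<and> shatters H' T) \<longleftrightarrow> (\<exists>T\<subseteq>S. finite T \<and> card T = k \<and> shatters H T)" for k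
  proof
    assume "\<exists>T\<subseteq>S'. finite T \<and> card T = k \<and> shatters H' T"
    then obtain T where T: "T \<subseteq> S'" "finite T" "card T = k" "shatters H' T" by auto
    then show "\<exists>T\<subseteq>S. finite T \<and> card T = k \<and> shatters H T"
      using push[OF T(1)] sh[OF T(1)] by (intro exI[of _ "\<psi> ` T"]) simp
  next
    assume "\<exists>T\<subseteq>S. finite T \<and> card T = k \<and> shatters H T"
    then obtain T where T: "T \<subseteq> S" "finite T" "card T = k" "shatters H T" by auto
    obtain A where "A \<subseteq> S'" "\<psi> ` A = T" "finite A \<longleftrightarrow> finite T" "card A = card T" using pull[OF T(1)] by auto
    then show "\<exists>T\<subseteq>S'. finite T \<and> card T = k \<and> shatters H' T"
      using T sh[of A] by (intro exI[of _ A]) simp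
  qed
  then show "VC S' H' = VC S H" unfolding VC_def by simp
  have fin: "finite S' \<longleftrightarrow> finite S" "card S' = card S" using bij by (auto simp: bij_betw_finite bij_betw_same_card)
  have "(\<forall>T\<subseteq>S'. finite T \<and> card T = k \<longrightarrow> shatters H' T) \<longleftrightarrow> (\<forall>T\<subseteq>S. finite T \<and> card T = k \<longrightarrow> shatters H T)" for k
  proof (intro iffI allI impI)
    fix T assume *: "\<forall>T\<subseteq>S'. finite T \<and> card T = k \<longrightarrow> shatters H' T" and T: "T \<subseteq> S" "finite T \<and> card T = k"
    obtain A where "A \<subseteq> S'" "\<psi> ` A = T" "finite A \<longleftrightarrow> finite T" "card A = card T" using pull[OF T(1)] by auto
    then show "shatters H T" using * T sh[of A] by simp
  next
    fix T assume *: "\<forall>T\<subseteq>S. finite T \<and> card T = k \<longrightarrow> shatters H T" and T: "T \<subseteq> S'" "finite T \<and> card T = k"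
    then show "shatters H' T" using push[OF T(1)] sh[OF T(1)] by simp
  qed
  then show "LVC S' H' = LVC S H" unfolding LVC_def fin by simp
qed

text \<open>Distributions on the image of \<open>X'\<close> are among those on \<open>X\<close>, so
  a tester for \<open>X\<close> can be run on the translated sample. The values of the extended
  function off the image are arbitrary; neither the run nor the distance sees them.\<close>

lemma m_test_transport:
  fixes \<psi> :: "'b \<Rightarrow> 'a"
  assumes inj: "inj_on \<psi> X'" and im: "\<psi> ` X' \<subseteq> X" and H: "H \<subseteq> X \<rightarrow>\<^sub>E UNIV"
  shows "m_test X' ((\<lambda>h. \<lambda>i\<in>X'. h (\<psi> i)) ` H) \<epsilon> \<le> m_test X H \<epsilon>"
proof (cases "m_test X H \<epsilon> = \<infinity>")
  case False
  define H' where "H' = (\<lambda>h. \<lambda>i\<in>X'. h (\<psi> i)) ` H"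
  obtain m A where m: "m_test X H \<epsilon> = enat m" and A: "is_tester X H \<epsilon> m A"
    using m_test_cases[of X H \<epsilon>] False by auto
  define A' where "A' xs = A (map (\<lambda>(i, b). (\<psi> i, b)) xs)" for xs
  have "is_tester X' H' \<epsilon> m A'"
    unfolding is_tester_def
  proof (intro allI impI)
    fix D' :: "'b pmf" and f' :: "'b \<Rightarrow> bool" assume D': "set_pmf D' \<subseteq> X'" and f': "f' \<in> X' \<rightarrow>\<^sub>E UNIV"
    define D where "D = map_pmf \<psi> D'"
    define f where "f = (\<lambda>x\<in>X. f' (the_inv_into X' \<psi> x))"
    have D: "set_pmf D \<subseteq> X" using D' im by (auto simp: D_def)
    have f: "f \<in> X \<rightarrow>\<^sub>E UNIV" by (simp add: f_def)
    have ff: "f (\<psi> i) = f' i" if "i \<in> X'" for i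
      using that im inj by (auto simp: f_def the_inv_into_f_f)
    have run: "run_tester A' m D' f' = run_tester A m D f"
    proof -
      have "map_pmf (\<lambda>x. (x, f x)) D = map_pmf (\<lambda>(i, b). (\<psi> i, b)) (map_pmf (\<lambda>x. (x, f' x)) D')"
        unfolding D_def by (simp add: pmf.map_comp o_def) (rule map_pmf_cong, use D' ff in auto)
      then show ?thesis
        unfolding run_tester_def A'_def[abs_def] by (simp only: replicate_map_pmf bind_map_pmf)
    qed
    have "pmf (run_tester A m D f) True \<ge> 2 / 3" if "f' \<in> H'"
    proof -
      obtain h where h: "h \<in> H" "f' = (\<lambda>i\<in>X'. h (\<psi> i))" using \<open>f' \<in> H'\<close> by (auto simp: H'_def)
      have "run_tester A m D f = run_tester A m D h"
        by (rule run_tester_cong) (use D' ff h in \<open>auto simp: D_def\<close>)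
      then show ?thesis using A D h(1) H unfolding is_tester_def by (metis subsetD)
    qed
    moreover have "dist_class D f H = dist_class D' f' H'"
    proof -
      have "dist_fun D f h = dist_fun D' f' (\<lambda>i\<in>X'. h (\<psi> i))" for h
      proof -
        have "dist_fun D f h = measure_pmf.prob D' {i. f (\<psi> i) \<noteq> h (\<psi> i)}"
          by (simp add: dist_fun_def D_def vimage_def)
        also have "\<dots> = dist_fun D' f' (\<lambda>i\<in>X'. h (\<psi> i))"
          unfolding dist_fun_def by (rule measure_pmf.finite_measure_eq_AE)
            (use D' ff in \<open>auto simp: AE_measure_pmf_iff\<close>)
        finally show ?thesis .
      qed
      then show ?thesis by (simp add: dist_class_def H'_def image_image)
    qed
    ultimately show "(f' \<in> H' \<longrightarrow> 2 / 3 \<le> pmf (run_tester A' m D' f') True) \<and>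
        (\<epsilon> \<le> dist_class D' f' H' \<longrightarrow> 2 / 3 \<le> pmf (run_tester A' m D' f') False)"
      using A D f unfolding run is_tester_def by auto
  qed
  then show ?thesis unfolding m H'_def by (rule m_test_le)
qed simp

text \<open>The hypotheses and the rate involve the class only through its dimensions on
  \<open>S\<close>, and \<open>m_test\<close> does not grow when the class is restricted to a
  smaller domain. Hence \<open>S\<close> may be replaced by a finite witness set, whose points are
  then numbered.\<close>

lemma lower_bound_transfer:
  assumes lb: "lower_bound TYPE(nat) C c \<epsilon>\<^sub>0" and C: "C > 0"
  shows "lower_bound TYPE('x) C c \<epsilon>\<^sub>0"
  unfolding lower_bound_def
proof (intro allI impI)
  fix X :: "'x set" and H S and \<epsilon> :: real
  assume adm: "admissible C X H S" and eps: "0 < \<epsilon> \<and> \<epsilon> < \<epsilon>\<^sub>0"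
  obtain d k where dk: "VC S H = enat d" "LVC S H = enat k" "2 \<le> d" "0 < k" "k \<le> d"
    "finite S \<longrightarrow> 5 * d < card S" "C * real d powr (3 / 4) * sqrt (ln (real d)) \<le> real k"
    "H \<subseteq> X \<rightarrow>\<^sub>E UNIV" "S \<subseteq> X" and rate: "rate H S = (real k)\<^sup>2 / (real d * ln (real d))"
    by (rule admissibleE[OF adm C])
  have d0: "0 < d" using dk by simp
  obtain S0 where S0: "S0 \<subseteq> S" "finite S0" "5 * d < card S0" "VC S0 H = enat d" "LVC S0 H = enat k"
    by (rule ex_finite_witness[OF dk(1,2) d0 dk(4,6)])
  obtain \<psi> where \<psi>: "bij_betw \<psi> {..<card S0} S0"
    using ex_bij_betw_nat_finite[OF S0(2)] by (auto simp: atLeast0LessThan)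
  define X' where "X' = {..<card S0}"
  define H' where "H' = (\<lambda>h. \<lambda>i\<in>X'. h (\<psi> i)) ` H"
  have inj: "inj_on \<psi> X'" and im: "\<psi> ` X' = S0" using \<psi> by (auto simp: bij_betw_def X'_def)
  have sh: "shatters H' A \<longleftrightarrow> shatters H (\<psi> ` A)" if A: "A \<subseteq> X'" for A
  proof
    assume *: "shatters H' A"
    show "shatters H (\<psi> ` A)"
      unfolding shatters_def
    proof (intro conjI allI)
      show "finite (\<psi> ` A)" using * by (simp add: shatters_def)
      fix l :: "'x \<Rightarrow> bool"
      obtain f where f: "f \<in> H'" "\<forall>x\<in>A. f x = l (\<psi> x)"
        using *[unfolded shatters_def, THEN conjunct2, rule_format, of "l \<circ> \<psi>"] by auto
      obtain h where h: "h \<in> H" "f = (\<lambda>i\<in>X'. h (\<psi> i))" using f(1) by (auto simp: H'_def)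
      have "h (\<psi> x) = l (\<psi> x)" if "x \<in> A" for x using f(2) h(2) A that by force
      then show "\<exists>f\<in>H. \<forall>x\<in>\<psi> ` A. f x = l x" using h(1) by (intro bexI[of _ h]) auto
    qed
  next
    have injA: "inj_on \<psi> A" using inj A by (rule inj_on_subset)
    assume *: "shatters H (\<psi> ` A)"
    show "shatters H' A"
      unfolding shatters_def
    proof (intro conjI allI)
      show "finite A" using * injA by (simp add: shatters_def finite_image_iff)
      fix l :: "nat \<Rightarrow> bool"
      obtain f where f: "f \<in> H" "\<forall>x\<in>\<psi> ` A. f x = l (the_inv_into A \<psi> x)"
        using *[unfolded shatters_def, THEN conjunct2, rule_format, of "l \<circ> the_inv_into A \<psi>"] by auto
      have "f (\<psi> i) = l i" if "i \<in> A" for i using f(2) that injA by (auto simp: the_inv_into_f_f)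
      then show "\<exists>f\<in>H'. \<forall>x\<in>A. f x = l x"
        using f(1) A by (intro bexI[of _ "\<lambda>i\<in>X'. f (\<psi> i)"]) (auto simp: H'_def)
    qed
  qed
  have V: "VC X' H' = enat d" "LVC X' H' = enat k"
    using VC_LVC_transport[of \<psi> X' S0 H' H] \<psi> sh S0 by (simp_all add: X'_def)
  have adm': "admissible C X' H' X'"
    unfolding admissible_def V using dk S0(3) by (auto simp: H'_def X'_def numeral_eq_enat)
  have rate': "rate H' X' = rate H S" unfolding rate by (simp add: rate_def V)
  have "ereal (c * rate H S) \<le> ereal_of_enat (m_test X' H' \<epsilon>)"
    using lb[unfolded lower_bound_def, rule_format, OF adm' eps] rate' by simp
  also have "m_test X' H' \<epsilon> \<le> m_test X H \<epsilon>"
    unfolding H'_def using im S0(1) dk(9) by (intro m_test_transport inj dk(8)) auto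
  then have "ereal_of_enat (m_test X' H' \<epsilon>) \<le> ereal_of_enat (m_test X H \<epsilon>)" by simp
  finally show "ereal (c * rate H S) \<le> ereal_of_enat (m_test X H \<epsilon>)" .
qed

subsection \<open>Threshold polynomials\<close>

text \<open>By the recursion, consecutive differences grow by \<open>2 * (x - 1) * u\<close>, hence
  by at least \<open>2 * (x - 1)\<close> once \<open>u >= 1\<close>. Both claims are carried
  together; adding up the differences gives the quadratic bound that follows.\<close>

lemma poly_cheb_ge_1:
  assumes "x \<ge> 1"
  shows "poly (cheb n) x \<ge> 1 \<and> poly (cheb (Suc n)) x - poly (cheb n) x \<ge> (2 * real n + 1) * (x - 1)"
proof (induction n)
  case (Suc n)
  define u where "u = poly (cheb (Suc n)) x"
  have "0 \<le> (2 * real n + 1) * (x - 1)" using assms by simp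
  then have u: "u \<ge> 1" using Suc unfolding u_def by linarith
  have "2 * (x - 1) * 1 \<le> 2 * (x - 1) * u" using assms u by (intro mult_left_mono) auto
  moreover have "poly (cheb (Suc (Suc n))) x - u = u - poly (cheb n) x + 2 * (x - 1) * u"
    by (simp add: u_def algebra_simps)
  ultimately show ?case using Suc u unfolding u_def by (simp add: algebra_simps)
qed (use assms in simp)

lemma poly_cheb_ge_quadratic:
  assumes "x \<ge> 1"
  shows "poly (cheb n) x \<ge> 1 + real n ^ 2 * (x - 1)"
proof (induction n)
  case (Suc n)
  then show ?case using poly_cheb_ge_1[OF assms, of n] by (simp add: power2_eq_square algebra_simps)
qed simp

lemma poly_cheb_mono:
  assumes "1 \<le> y" "y \<le> x"
  shows "poly (cheb n) y \<le> poly (cheb n) x"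
proof -
  define \<delta> where "\<delta> n = poly (cheb n) x - poly (cheb n) y" for n
  have "0 \<le> \<delta> n \<and> \<delta> n \<le> \<delta> (Suc n)"
  proof (induction n)
    case (Suc n)
    have "poly (cheb (Suc n)) y \<ge> 1" using poly_cheb_ge_1[OF assms(1)] by blast
    then have "(y - 1) * poly (cheb (Suc n)) y \<le> (x - 1) * poly (cheb (Suc n)) x"
      using assms Suc by (intro mult_mono) (auto simp: \<delta>_def)
    moreover have "\<delta> (Suc (Suc n)) - \<delta> (Suc n) = \<delta> (Suc n) - \<delta> n
        + 2 * ((x - 1) * poly (cheb (Suc n)) x - (y - 1) * poly (cheb (Suc n)) y)"
      by (simp add: \<delta>_def algebra_simps)
    ultimately show ?case using Suc by (smt (verit))
  qed (use assms in \<open>simp add: \<delta>_def\<close>)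
  then show ?thesis by (simp add: \<delta>_def)
qed

lemma abs_poly_cheb_le_1:
  assumes "\<bar>x\<bar> \<le> 1"
  shows "\<bar>poly (cheb n) x\<bar> \<le> 1"
  using poly_cheb_cos[of n "arccos x"] assms by (simp add: cos_arccos abs_le_iff)

text \<open>The l1 norm of the coefficients after the argument is scaled by \<open>z\<close>. For
  \<open>z = L / m\<close> it controls the increments of \<open>binom_estimator\<close>.\<close>

definition poly_norm :: "real \<Rightarrow> real poly \<Rightarrow> real" where
  "poly_norm z p = (\<Sum>j\<le>degree p. \<bar>coeff p j\<bar> * z ^ j)"

lemma poly_norm_eq:
  assumes "degree p \<le> n"
  shows "poly_norm z p = (\<Sum>j\<le>n. \<bar>coeff p j\<bar> * z ^ j)"
  unfolding poly_norm_def using assms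
  by (intro sum.mono_neutral_left) (auto simp: coeff_eq_0)

lemma poly_norm_diff_le:
  assumes "z \<ge> 0"
  shows "poly_norm z (p - q) \<le> poly_norm z p + poly_norm z q"
proof -
  define n where "n = max (degree p) (degree q)"
  have "degree (p - q) \<le> n" unfolding n_def by (rule degree_diff_le_max)
  then have "poly_norm z (p - q) = (\<Sum>j\<le>n. \<bar>coeff p j - coeff q j\<bar> * z ^ j)"
    by (simp add: poly_norm_eq)
  also have "\<dots> \<le> (\<Sum>j\<le>n. (\<bar>coeff p j\<bar> + \<bar>coeff q j\<bar>) * z ^ j)"
    using assms by (intro sum_mono mult_right_mono abs_triangle_ineq4) auto
  also have "\<dots> = poly_norm z p + poly_norm z q"
    by (simp add: poly_norm_eq[of p n] poly_norm_eq[of q n] n_def distrib_right sum.distrib)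
  finally show ?thesis .
qed

lemma poly_norm_smult: "poly_norm z (smult c p) = \<bar>c\<bar> * poly_norm z p"
  by (simp add: poly_norm_eq[OF degree_smult_le] poly_norm_def[of z p] abs_mult sum_distrib_left mult_ac)

lemma poly_norm_pCons_0: "poly_norm z (pCons 0 p) = z * poly_norm z p"
proof -
  have "poly_norm z (pCons 0 p) = (\<Sum>j\<le>Suc (degree p). \<bar>coeff (pCons 0 p) j\<bar> * z ^ j)"
    by (rule poly_norm_eq) (rule degree_pCons_le)
  also have "\<dots> = z * poly_norm z p"
    unfolding sum.atMost_Suc_shift poly_norm_def by (simp add: sum_distrib_left mult_ac)
  finally show ?thesis .
qed

lemma poly_norm_linear_mult_le:
  assumes "z \<ge> 0"
  shows "poly_norm z ([:b, c:] * p) \<le> (\<bar>b\<bar> + \<bar>c\<bar> * z) * poly_norm z p"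
proof -
  have "[:b, c:] * p = smult b p - smult (- c) (pCons 0 p)" by (simp add: mult_pCons_left)
  then show ?thesis
    using poly_norm_diff_le[OF assms, of "smult b p" "smult (- c) (pCons 0 p)"]
    by (simp only: poly_norm_smult poly_norm_pCons_0) (simp add: algebra_simps)
qed

text \<open>One step of the recursion multiplies the norm by at most \<open>2 * 4\<close> and adds
  the norm two indices back, whence base 9.\<close>

lemma poly_norm_pcompose_cheb:
  assumes z: "z \<ge> 0" and uv: "\<bar>u\<bar> + \<bar>v\<bar> * z \<le> 4"
  shows "poly_norm z (pcompose (cheb n) [:u, v:]) \<le> 9 ^ n"
proof -
  have "poly_norm z (pcompose (cheb n) [:u, v:]) \<le> 9 ^ n
      \<and> poly_norm z (pcompose (cheb (Suc n)) [:u, v:]) \<le> 9 ^ Suc n"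
  proof (induction n)
    case 0
    have "poly_norm z [:u, v:] \<le> \<bar>u\<bar> + \<bar>v\<bar> * z"
      by (subst poly_norm_eq[of _ 1]) auto
    then show ?case using uv by (simp add: pcompose_pCons pcompose_1 poly_norm_def[of z 1])
  next
    case (Suc n)
    let ?p = "\<lambda>n. pcompose (cheb n) [:u, v:]"
    have nonneg: "poly_norm z p \<ge> 0" for p unfolding poly_norm_def using z by (auto intro!: sum_nonneg)
    have "?p (Suc (Suc n)) = [:2 * u, 2 * v:] * ?p (Suc n) - ?p n"
      by (simp add: pcompose_diff pcompose_mult pcompose_pCons pcompose_smult smult_add_right)
    then have "poly_norm z (?p (Suc (Suc n))) \<le> poly_norm z ([:2 * u, 2 * v:] * ?p (Suc n)) + poly_norm z (?p n)"
      using poly_norm_diff_le[OF z] by metis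
    also have "\<dots> \<le> (\<bar>2 * u\<bar> + \<bar>2 * v\<bar> * z) * poly_norm z (?p (Suc n)) + poly_norm z (?p n)"
      using poly_norm_linear_mult_le[OF z] by (intro add_mono) auto
    also have "\<dots> \<le> 8 * 9 ^ Suc n + 9 ^ n"
      using Suc uv nonneg by (intro add_mono mult_mono) (auto simp: abs_mult)
    also have "\<dots> \<le> 9 ^ Suc (Suc n)" by simp
    finally show ?case using Suc by simp
  qed
  then show ?thesis by simp
qed

text \<open>
  Since Chebyshev polynomials of degree \<open>L\<close> grow like \<open>1 + L\<^sup>2 \<eta>\<close> at \<open>1 + \<eta>\<close>, a degree of order
  \<open>\<surd>(B / a)\<close> suffices.
\<close>

lemma ex_threshold_poly:
  fixes a B z \<tau> :: real and L :: nat
  assumes a: "0 < a" "2 * a \<le> B" and z: "0 \<le> z" "4 * z \<le> B" and \<tau>: "\<tau> > 0"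
    and L: "1 \<le> \<tau> * (real L ^ 2 * (2 * a / B))"
  obtains q where "degree q \<le> L" "poly q 0 = 0" "poly_norm z q \<le> 1 + 9 ^ L"
    "\<And>x. 0 \<le> x \<Longrightarrow> x \<le> B \<Longrightarrow> 0 \<le> poly q x \<and> poly q x \<le> 1 + \<tau>"
    "\<And>x. a \<le> x \<Longrightarrow> x \<le> B \<Longrightarrow> 1 - \<tau> \<le> poly q x"
proof -
  \<comment> \<open>The map \<open>u - v * x\<close> takes \<open>[a, B]\<close> onto
    \<open>[-1, 1]\<close> and 0 to \<open>u > 1\<close>. Dividing by the large value
    \<open>t\<close> at \<open>u\<close> makes \<open>q\<close> vanish at 0 and stay within
    \<open>1 / t\<close> of 1 on \<open>[a, B]\<close>.\<close>
  define u where "u = (B + a) / (B - a)"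
  define v where "v = 2 / (B - a)"
  have Ba: "B - a > 0" "B > 0" using a by auto
  have u1: "u = 1 + 2 * a / (B - a)" using Ba by (simp add: u_def field_simps)
  have "2 * a / B \<le> 2 * a / (B - a)" using a Ba by (intro frac_le) auto
  then have u: "u \<ge> 1 + 2 * a / B" by (simp add: u1)
  then have u_ge: "u \<ge> 1" using a Ba by (smt (verit) divide_nonneg_pos)
  define t where "t = poly (cheb L) u"
  have t1: "t \<ge> 1" unfolding t_def using poly_cheb_ge_1[OF u_ge] by blast
  have "real L ^ 2 * (2 * a / B) \<le> real L ^ 2 * (u - 1)" using u by (intro mult_left_mono) auto
  also have "\<dots> \<le> t" unfolding t_def using poly_cheb_ge_quadratic[OF u_ge, of L] by simp
  finally have "1 \<le> \<tau> * t" using L \<tau> by (smt (verit) mult_left_mono)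
  then have t\<tau>: "1 / t \<le> \<tau>" using t1 by (simp add: field_simps)
  define r where "r = pcompose (cheb L) [:u, - v:]"
  define q where "q = 1 - smult (1 / t) r"
  have poly_q: "poly q x = 1 - poly (cheb L) (u - v * x) / t" for x
    by (simp add: q_def r_def poly_pcompose mult_ac)
  have "degree r \<le> L"
    unfolding r_def using degree_pcompose_le[of "cheb L" "[:u, - v:]"] degree_cheb[of L]
    by (auto split: if_splits)
  then have "degree q \<le> L"
    unfolding q_def by (intro degree_diff_le) (auto intro: order_trans[OF degree_smult_le])
  moreover have "poly q 0 = 0" unfolding poly_q using t1 by (simp add: t_def)
  moreover have "poly_norm z q \<le> 1 + 9 ^ L"
  proof -
    have v0: "v \<ge> 0" using Ba by (simp add: v_def)
    have "u \<le> 3" using a Ba by (simp add: u_def field_simps)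
    moreover have "v * z \<le> 1" using z a Ba by (simp add: v_def field_simps)
    ultimately have "poly_norm z r \<le> 9 ^ L"
      unfolding r_def using u_ge v0 by (intro poly_norm_pcompose_cheb z) auto
    moreover have "0 \<le> poly_norm z r" unfolding poly_norm_def using z by (auto intro!: sum_nonneg)
    ultimately have "1 / t * poly_norm z r \<le> 1 * 9 ^ L" using t1 by (intro mult_mono) auto
    then show ?thesis
      unfolding q_def using poly_norm_diff_le[OF z(1), of 1 "smult (1 / t) r"] t1
      by (simp add: poly_norm_smult poly_norm_def[of z 1])
  qed
  moreover have near: "\<bar>poly q x - 1\<bar> \<le> 1 / t" if "a \<le> x" "x \<le> B" for x
  proof -
    have eq: "u - v * x = (B + a - 2 * x) / (B - a)" by (simp add: u_def v_def diff_divide_distrib)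
    have "\<bar>u - v * x\<bar> \<le> 1" unfolding eq using that Ba by (auto simp: abs_le_iff field_simps)
    then have "\<bar>poly (cheb L) (u - v * x)\<bar> \<le> 1" by (rule abs_poly_cheb_le_1)
    then show ?thesis unfolding poly_q using t1 by (simp add: divide_right_mono)
  qed
  moreover have "0 \<le> poly q x \<and> poly q x \<le> 1 + \<tau>" if x: "0 \<le> x" "x \<le> B" for x
  proof (cases "a \<le> x")
    case True
    have "1 / t \<le> 1" using t1 by simp
    then show ?thesis using near[OF True x(2)] t\<tau> by linarith
  next
    case False
    have "v * x \<le> v * a" using False Ba by (intro mult_left_mono) (auto simp: v_def)
    also have "v * a = u - 1" using Ba by (simp add: u1 v_def)
    finally have "1 \<le> u - v * x" by simp
    moreover have "u - v * x \<le> u" using x Ba by (simp add: v_def)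
    ultimately have "1 \<le> poly (cheb L) (u - v * x)" "poly (cheb L) (u - v * x) \<le> t"
      unfolding t_def using poly_cheb_ge_1[of "u - v * x" L] poly_cheb_mono by auto
    then show ?thesis unfolding poly_q using t1 \<tau> by (simp add: field_simps)
  qed
  moreover have "1 - \<tau> \<le> poly q x" if "a \<le> x" "x \<le> B" for x
    using near[OF that] t\<tau> by linarith
  ultimately show ?thesis using that by blast
qed

subsection \<open>Letter counts of independent samples\<close>

lemma finite_set_replicate_pmf: "finite (set_pmf p) \<Longrightarrow> finite (set_pmf (replicate_pmf n p))"
  by (induction n) auto

lemma expectation_bind_finite:
  fixes h :: "'b \<Rightarrow> real"
  assumes "finite (set_pmf p)" "\<And>x. x \<in> set_pmf p \<Longrightarrow> finite (set_pmf (q x))"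
  shows "measure_pmf.expectation (bind_pmf p q) h
    = measure_pmf.expectation p (\<lambda>x. measure_pmf.expectation (q x) h)"
  using assms
  by (subst pmf_expectation_bind[of "set_pmf p"]) (auto simp: integral_measure_pmf[of "set_pmf p"])

lemma expectation_replicate_Suc:
  fixes h :: "'a list \<Rightarrow> real"
  assumes "finite (set_pmf p)"
  shows "measure_pmf.expectation (replicate_pmf (Suc n) p) h
    = measure_pmf.expectation p (\<lambda>x. measure_pmf.expectation (replicate_pmf n p) (\<lambda>xs. h (x # xs)))"
  using assms finite_set_replicate_pmf[OF assms, of n]
  by (simp add: expectation_bind_finite)

lemma expectation_indicator_eq:
  "measure_pmf.expectation p (\<lambda>x. if x = y then c else (0::real)) = c * pmf p y"
  by (subst integral_measure_pmf_real[of "{y}"]) (auto split: if_splits)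

text \<open>Revealing the first letter is Pascal's rule. Binomials of a count, unlike its powers,
  have a pure monomial in the probability as mean; the estimator below is built from them for this
  reason.\<close>

lemma expectation_replicate_choose:
  fixes p :: "'a pmf"
  assumes fin: "finite (set_pmf p)"
  shows "measure_pmf.expectation (replicate_pmf n p) (\<lambda>xs. real (count_list xs y choose j))
    = real (n choose j) * pmf p y ^ j"
proof (induction n arbitrary: j)
  case 0
  then show ?case by (cases j) auto
next
  case (Suc n)
  have int: "integrable (replicate_pmf n p) f" "integrable p g" for f g :: "_ \<Rightarrow> real"
    using fin finite_set_replicate_pmf by (auto intro: integrable_measure_pmf_finite)
  show ?case
  proof (cases j)
    case (Suc j')
    have "measure_pmf.expectation (replicate_pmf (Suc n) p) (\<lambda>xs. real (count_list xs y choose j))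
      = measure_pmf.expectation p (\<lambda>x. measure_pmf.expectation (replicate_pmf n p)
          (\<lambda>xs. real (count_list xs y choose j) + (if x = y then real (count_list xs y choose j') else 0)))"
      unfolding expectation_replicate_Suc[OF fin] by (intro Bochner_Integration.integral_cong) (auto simp: Suc)
    also have "\<dots> = measure_pmf.expectation p (\<lambda>x. real (n choose j) * pmf p y ^ j
        + (if x = y then real (n choose j') * pmf p y ^ j' else 0))"
      by (intro Bochner_Integration.integral_cong) (auto simp: Suc.IH int)
    also have "\<dots> = real (n choose j) * pmf p y ^ j + real (n choose j') * pmf p y ^ j' * pmf p y"
      by (simp add: int expectation_indicator_eq)
    finally show ?thesis using Suc by (simp add: algebra_simps)
  qed simp
qed

lemma expectation_replicate_power:
  fixes p :: "'a pmf"
  assumes fin: "finite (set_pmf p)"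
  shows "measure_pmf.expectation (replicate_pmf n p) (\<lambda>xs. z ^ count_list xs y)
    = (1 + (z - 1) * pmf p y) ^ n"
proof (induction n)
  case (Suc n)
  have int: "integrable p g" for g :: "_ \<Rightarrow> real"
    using fin by (auto intro: integrable_measure_pmf_finite)
  have "measure_pmf.expectation (replicate_pmf (Suc n) p) (\<lambda>xs. z ^ count_list xs y)
    = measure_pmf.expectation p (\<lambda>x. measure_pmf.expectation (replicate_pmf n p)
          (\<lambda>xs. (1 + (if x = y then z - 1 else 0)) * z ^ count_list xs y))"
    unfolding expectation_replicate_Suc[OF fin] by (intro Bochner_Integration.integral_cong) auto
  also have "\<dots> = measure_pmf.expectation p (\<lambda>x. (1 + (if x = y then z - 1 else 0))) * (1 + (z - 1) * pmf p y) ^ n"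
    by (simp add: Suc)
  also have "measure_pmf.expectation p (\<lambda>x. (1 + (if x = y then z - 1 else 0))) = 1 + (z - 1) * pmf p y"
    by (simp add: int expectation_indicator_eq)
  finally show ?case by simp
qed simp

lemma expectation_square_le:
  fixes f :: "'a \<Rightarrow> real"
  assumes "finite (set_pmf p)"
  shows "(measure_pmf.expectation p f)\<^sup>2 \<le> measure_pmf.expectation p (\<lambda>x. (f x)\<^sup>2)"
proof -
  have int: "integrable p g" for g :: "_ \<Rightarrow> real" using assms by (rule integrable_measure_pmf_finite)
  have "0 \<le> measure_pmf.variance p f" by (rule measure_pmf.variance_positive)
  then show ?thesis by (simp add: measure_pmf.variance_eq int)
qed

text \<open>
  An Efron--Stein type bound. The growth condition is kept in the form \<open>A y * 2 ^ n\<close>, because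
  revealing one letter only shifts its count, that is, doubles its \<open>A y\<close>.
\<close>

lemma variance_count_statistic_le:
  fixes p :: "'a pmf" and G :: "'a \<Rightarrow> nat \<Rightarrow> real" and A :: "'a \<Rightarrow> real"
  assumes fin: "finite (set_pmf p)" and Y: "finite Y"
    and G: "\<And>y k. y \<in> Y \<Longrightarrow> \<bar>G y (Suc k) - G y k\<bar> \<le> A y * 2 ^ k"
  defines "\<phi> \<equiv> \<lambda>G xs. \<Sum>y\<in>Y. G y (count_list xs y)"
  shows "measure_pmf.expectation (replicate_pmf n p) (\<lambda>xs. (\<phi> G xs)\<^sup>2)
      - (measure_pmf.expectation (replicate_pmf n p) (\<phi> G))\<^sup>2
    \<le> real n * (\<Sum>y\<in>Y. pmf p y * (A y)\<^sup>2 * (1 + 3 * pmf p y) ^ n)"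
  using G
proof (induction n arbitrary: G A)
  case (Suc n)
  let ?E = "measure_pmf.expectation p"
  let ?En = "measure_pmf.expectation (replicate_pmf n p)"
  define H where "H x = (\<lambda>y k. G y (if y = x then Suc k else k))" for x
  have int: "integrable (replicate_pmf n p) f" "integrable p g" for f g :: "_ \<Rightarrow> real"
    using fin finite_set_replicate_pmf by (auto intro: integrable_measure_pmf_finite)
  have \<phi>_Cons: "\<phi> G (x # xs) = \<phi> (H x) xs" for x xs
    unfolding \<phi>_def H_def by (intro sum.cong) auto
  define \<mu> where "\<mu> x = ?En (\<phi> (H x))" for x
  \<comment> \<open>The variance of \<open>\<mu>\<close> is at most its second moment about any
    constant. With this constant, \<open>\<mu> x - c\<close> is the effect of one additional letter
    \<open>x\<close>, so it involves a single increment of \<open>G x\<close>.\<close>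
  define c where "c = ?En (\<phi> G)"
  define q where "q y = 1 + 3 * pmf p y" for y
  have q1: "q y \<ge> 1" for y by (simp add: q_def)
  define t where "t y = pmf p y * (A y)\<^sup>2 * q y ^ n" for y
  have t0: "t y \<ge> 0" for y using q1[of y] by (simp add: t_def)
  have IH: "?En (\<lambda>xs. (\<phi> (H x) xs)\<^sup>2) - (\<mu> x)\<^sup>2 \<le> real n * (\<Sum>y\<in>Y. t y * (if y = x then 4 else 1))" for x
  proof -
    have "?En (\<lambda>xs. (\<phi> (H x) xs)\<^sup>2) - (\<mu> x)\<^sup>2
        \<le> real n * (\<Sum>y\<in>Y. pmf p y * (if y = x then 2 * A y else A y)\<^sup>2 * (1 + 3 * pmf p y) ^ n)"
      unfolding \<mu>_def
    proof (rule Suc.IH)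
      fix y k assume "y \<in> Y"
      then show "\<bar>H x y (Suc k) - H x y k\<bar> \<le> (if y = x then 2 * A y else A y) * 2 ^ k"
        using Suc.prems[of y k] Suc.prems[of y "Suc k"] by (auto simp: H_def)
    qed
    also have "\<dots> = real n * (\<Sum>y\<in>Y. t y * (if y = x then 4 else 1))"
      by (intro arg_cong[where f = "\<lambda>u. real n * u"] sum.cong)
        (auto simp: t_def q_def power_mult_distrib)
    finally show ?thesis .
  qed
  have step: "(\<mu> x - c)\<^sup>2 \<le> (if x \<in> Y then (A x)\<^sup>2 * q x ^ n else 0)" for x
  proof -
    have "\<mu> x - c = ?En (\<lambda>xs. \<phi> (H x) xs - \<phi> G xs)" by (simp add: \<mu>_def c_def int)
    then have "(\<mu> x - c)\<^sup>2 \<le> ?En (\<lambda>xs. (\<phi> (H x) xs - \<phi> G xs)\<^sup>2)"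
      using expectation_square_le[OF finite_set_replicate_pmf[OF fin, of n]] by simp
    also have "\<dots> \<le> (if x \<in> Y then (A x)\<^sup>2 * q x ^ n else 0)"
    proof (cases "x \<in> Y")
      case True
      have diff: "\<phi> (H x) xs - \<phi> G xs = G x (Suc (count_list xs x)) - G x (count_list xs x)" for xs
      proof -
        have "\<phi> (H x) xs - \<phi> G xs = (\<Sum>y\<in>Y. if y = x then G y (Suc (count_list xs y)) - G y (count_list xs y) else 0)"
          unfolding \<phi>_def H_def sum_subtractf[symmetric] by (intro sum.cong) auto
        then show ?thesis using True Y by simp
      qed
      have "?En (\<lambda>xs. (\<phi> (H x) xs - \<phi> G xs)\<^sup>2) \<le> ?En (\<lambda>xs. (A x)\<^sup>2 * 4 ^ count_list xs x)"
      proof (intro integral_mono int)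
        fix xs
        have "(\<phi> (H x) xs - \<phi> G xs)\<^sup>2 \<le> (A x * 2 ^ count_list xs x)\<^sup>2"
          unfolding diff using Suc.prems[OF True, of "count_list xs x"] by (rule abs_le_square_iff[THEN iffD1, OF order_trans]) simp
        also have "\<dots> = (A x)\<^sup>2 * (2 ^ 2) ^ count_list xs x"
          by (simp only: power_mult_distrib power_mult[symmetric] mult.commute)
        finally show "(\<phi> (H x) xs - \<phi> G xs)\<^sup>2 \<le> (A x)\<^sup>2 * 4 ^ count_list xs x" by simp
      qed
      also have "\<dots> = (A x)\<^sup>2 * q x ^ n"
        using expectation_replicate_power[OF fin, of n 4 x] by (simp add: q_def)
      finally show ?thesis using True by simp
    next
      case False
      then have "\<phi> (H x) xs = \<phi> G xs" for xs unfolding \<phi>_def H_def by (intro sum.cong) auto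
      then show ?thesis using False by simp
    qed
    finally show ?thesis .
  qed
  have "measure_pmf.expectation (replicate_pmf (Suc n) p) (\<lambda>xs. (\<phi> G xs)\<^sup>2)
      - (measure_pmf.expectation (replicate_pmf (Suc n) p) (\<phi> G))\<^sup>2
    = ?E (\<lambda>x. ?En (\<lambda>xs. (\<phi> (H x) xs)\<^sup>2)) - (?E \<mu>)\<^sup>2"
    unfolding expectation_replicate_Suc[OF fin] \<phi>_Cons \<mu>_def[abs_def] ..
  also have "\<dots> = ?E (\<lambda>x. ?En (\<lambda>xs. (\<phi> (H x) xs)\<^sup>2) - (\<mu> x)\<^sup>2) + (?E (\<lambda>x. (\<mu> x)\<^sup>2) - (?E \<mu>)\<^sup>2)"
    by (simp add: int)
  also have "?E (\<lambda>x. (\<mu> x)\<^sup>2) - (?E \<mu>)\<^sup>2 \<le> ?E (\<lambda>x. (\<mu> x - c)\<^sup>2)"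
  proof -
    have "?E (\<lambda>x. (\<mu> x - c)\<^sup>2) = ?E (\<lambda>x. (\<mu> x)\<^sup>2) - 2 * c * ?E \<mu> + c\<^sup>2"
      by (simp add: power2_diff int algebra_simps)
    moreover have "0 \<le> (?E \<mu> - c)\<^sup>2" by simp
    ultimately show ?thesis by (simp add: power2_diff algebra_simps)
  qed
  also have "?E (\<lambda>x. ?En (\<lambda>xs. (\<phi> (H x) xs)\<^sup>2) - (\<mu> x)\<^sup>2) + ?E (\<lambda>x. (\<mu> x - c)\<^sup>2)
    \<le> ?E (\<lambda>x. real n * (\<Sum>y\<in>Y. t y * (if y = x then 4 else 1)))
      + ?E (\<lambda>x. \<Sum>y\<in>Y. if x = y then (A y)\<^sup>2 * q y ^ n else 0)"
    using step Y by (intro add_mono integral_mono int IH) (auto simp: sum.delta')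
  also have "\<dots> = real n * (\<Sum>y\<in>Y. t y * q y) + (\<Sum>y\<in>Y. t y)"
  proof -
    have "?E (\<lambda>x. if y = x then 4 else (1::real)) = q y" for y
    proof -
      have "?E (\<lambda>x. if y = x then 4 else (1::real)) = ?E (\<lambda>x. 1 + (if x = y then 3 else 0))"
        by (intro Bochner_Integration.integral_cong) auto
      then show ?thesis by (simp add: int expectation_indicator_eq q_def)
    qed
    then show ?thesis
      by (simp add: Bochner_Integration.integral_sum int expectation_indicator_eq t_def mult_ac)
  qed
  also have "\<dots> \<le> real n * (\<Sum>y\<in>Y. t y * q y) + (\<Sum>y\<in>Y. t y * q y)"
  proof -
    have "t y * 1 \<le> t y * q y" for y using t0 q1 by (intro mult_left_mono) auto
    then show ?thesis by (auto intro!: sum_mono)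
  qed
  also have "\<dots> = real (Suc n) * (\<Sum>y\<in>Y. pmf p y * (A y)\<^sup>2 * (1 + 3 * pmf p y) ^ Suc n)"
    by (simp add: t_def q_def algebra_simps)
  finally show ?case by simp
qed simp

subsection \<open>A tester for sparse functions\<close>

definition binom_estimator :: "nat \<Rightarrow> real poly \<Rightarrow> nat \<Rightarrow> real" where
  "binom_estimator m q k = (\<Sum>j\<le>degree q. coeff q j * (real (k choose j) / real (m choose j)))"

lemma binom_estimator_unbiased:
  assumes fin: "finite (set_pmf p)" and deg: "degree q \<le> m"
  shows "measure_pmf.expectation (replicate_pmf m p) (\<lambda>xs. binom_estimator m q (count_list xs y)) = poly q (pmf p y)"
proof -
  have int: "integrable (replicate_pmf m p) f" for f :: "_ \<Rightarrow> real"
    using finite_set_replicate_pmf[OF fin] by (rule integrable_measure_pmf_finite)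
  have each: "measure_pmf.expectation (replicate_pmf m p)
      (\<lambda>xs. coeff q j * (real (count_list xs y choose j) / real (m choose j))) = coeff q j * pmf p y ^ j"
    if "j \<le> degree q" for j
  proof -
    have "real (m choose j) \<noteq> 0" using that deg by simp
    then show ?thesis using expectation_replicate_choose[OF fin, of m y j] by simp
  qed
  have "measure_pmf.expectation (replicate_pmf m p) (\<lambda>xs. binom_estimator m q (count_list xs y))
      = (\<Sum>j\<le>degree q. measure_pmf.expectation (replicate_pmf m p)
          (\<lambda>xs. coeff q j * (real (count_list xs y choose j) / real (m choose j))))"
    unfolding binom_estimator_def by (rule Bochner_Integration.integral_sum) (rule int)
  also have "\<dots> = (\<Sum>j\<le>degree q. coeff q j * pmf p y ^ j)"
    by (intro sum.cong refl each) simp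
  finally show ?thesis by (simp add: poly_altdef)
qed

lemma binomial_le_two_power: "real (n choose k) \<le> 2 ^ n"
  using of_nat_mono[OF binomial_le_pow2[of n k], where 'a = real] by simp

text \<open>Pascal's rule turns the increment of the term of order \<open>j\<close> into
  \<open>k choose (j - 1)\<close> over \<open>m choose j\<close>. Bounding the numerator by
  \<open>2^k\<close> and the denominator from below by \<open>(m / j)^j\<close> gives the growth
  shape required by \<open>variance_count_statistic_le\<close>.\<close>

lemma binom_estimator_growth:
  assumes deg: "degree q \<le> L" "L \<le> m" and m: "m > 0"
  shows "\<bar>binom_estimator m q (Suc k) - binom_estimator m q k\<bar> \<le> poly_norm (real L / real m) q * 2 ^ k"
proof -
  have summand: "\<bar>coeff q j * (real (Suc k choose j) / real (m choose j)) - coeff q j * (real (k choose j) / real (m choose j))\<bar>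
      \<le> \<bar>coeff q j\<bar> * (real L / real m) ^ j * 2 ^ k" if j: "j \<le> degree q" for j
  proof (cases j)
    case (Suc i)
    have jm: "j \<le> m" "j \<le> L" using j deg by auto
    have "(real m / real j) ^ j \<le> real (m choose j)"
      using jm(1) by (rule binomial_ge_n_over_k_pow_k)
    moreover have "(real m / real j) ^ j > 0" using m Suc by simp
    ultimately have "1 / real (m choose j) \<le> 1 / (real m / real j) ^ j"
      using jm by (intro divide_left_mono mult_pos_pos) auto
    also have "\<dots> = (real j / real m) ^ j" by (simp add: power_divide)
    also have "\<dots> \<le> (real L / real m) ^ j" using jm by (intro power_mono divide_right_mono) auto
    finally have inv: "1 / real (m choose j) \<le> (real L / real m) ^ j" .
    have "coeff q j * (real (Suc k choose j) / real (m choose j)) - coeff q j * (real (k choose j) / real (m choose j))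
        = coeff q j * (real (k choose i) * (1 / real (m choose j)))"
      unfolding Suc by (simp add: add_divide_distrib algebra_simps)
    also have "\<bar>\<dots>\<bar> = \<bar>coeff q j\<bar> * (real (k choose i) * (1 / real (m choose j)))"
      by (simp add: abs_mult)
    also have "\<dots> \<le> \<bar>coeff q j\<bar> * (2 ^ k * (real L / real m) ^ j)"
      using inv binomial_le_two_power by (intro mult_left_mono mult_mono) auto
    finally show ?thesis by (simp add: mult_ac)
  qed simp
  have "\<bar>binom_estimator m q (Suc k) - binom_estimator m q k\<bar>
      \<le> (\<Sum>j\<le>degree q. \<bar>coeff q j * (real (Suc k choose j) / real (m choose j)) - coeff q j * (real (k choose j) / real (m choose j))\<bar>)"
    unfolding binom_estimator_def sum_subtractf[symmetric] by (rule sum_abs)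
  also have "\<dots> \<le> (\<Sum>j\<le>degree q. \<bar>coeff q j\<bar> * (real L / real m) ^ j * 2 ^ k)"
    by (intro sum_mono summand) auto
  finally show ?thesis by (simp add: poly_norm_def sum_distrib_right)
qed

text \<open>\<open>F\<close> stands for the letters seen in an independent earlier sample. Their
  terms are constant and add no variance; the others have probability at most \<open>B\<close>, so
  \<open>(1 + 3 * pmf p y)^m\<close> is at most \<open>exp (3 * B * m)\<close>. The probabilities
  add up to at most 1, which keeps \<open>card Y\<close> out of the bound. Chebyshev's inequality
  finishes.\<close>

lemma support_statistic_concentration:
  fixes p :: "'a pmf"
  assumes fin: "finite (set_pmf p)" and Y: "finite Y"
    and deg: "degree q \<le> L" "L \<le> m" and m: "m > 0" and t: "t > 0"
    and small: "\<And>y. y \<in> Y \<Longrightarrow> y \<notin> F \<Longrightarrow> pmf p y \<le> B" and B: "B \<ge> 0"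
  defines "\<phi> \<equiv> \<lambda>ys. \<Sum>y\<in>Y. if y \<in> F then 1 else binom_estimator m q (count_list ys y)"
  shows "measure_pmf.prob (replicate_pmf m p)
      {ys. t \<le> \<bar>\<phi> ys - (\<Sum>y\<in>Y. if y \<in> F then 1 else poly q (pmf p y))\<bar>}
    \<le> real m * (poly_norm (real L / real m) q)\<^sup>2 * exp (3 * B * real m) / t\<^sup>2"
proof -
  let ?R = "replicate_pmf m p"
  let ?A = "poly_norm (real L / real m) q"
  have int: "integrable ?R f" for f :: "_ \<Rightarrow> real"
    using finite_set_replicate_pmf[OF fin] by (rule integrable_measure_pmf_finite)
  have "measure_pmf.expectation ?R (\<lambda>ys. if y \<in> F then 1 else binom_estimator m q (count_list ys y))
      = (if y \<in> F then 1 else poly q (pmf p y))" for y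
    using binom_estimator_unbiased[OF fin, of q m y] deg by auto
  then have mean: "measure_pmf.expectation ?R \<phi> = (\<Sum>y\<in>Y. if y \<in> F then 1 else poly q (pmf p y))"
    unfolding \<phi>_def by (subst Bochner_Integration.integral_sum) (auto intro: int)
  define G where "G y k = (if y \<in> F then 1 else binom_estimator m q k)" for y k
  have \<phi>: "\<phi> = (\<lambda>ys. \<Sum>y\<in>Y. G y (count_list ys y))" by (simp add: \<phi>_def G_def)
  have "measure_pmf.variance ?R \<phi> = measure_pmf.expectation ?R (\<lambda>xs. (\<phi> xs)\<^sup>2) - (measure_pmf.expectation ?R \<phi>)\<^sup>2"
    by (rule measure_pmf.variance_eq) (rule int)+
  also have "\<dots> \<le> real m * (\<Sum>y\<in>Y. pmf p y * (if y \<in> F then 0 else ?A)\<^sup>2 * (1 + 3 * pmf p y) ^ m)"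
    unfolding \<phi> by (rule variance_count_statistic_le[OF fin Y])
      (use binom_estimator_growth[OF deg m] in \<open>auto simp: G_def\<close>)
  also have "\<dots> \<le> real m * (\<Sum>y\<in>Y. pmf p y * (?A\<^sup>2 * exp (3 * B * real m)))"
  proof (intro mult_left_mono sum_mono)
    fix y assume y: "y \<in> Y"
    show "pmf p y * (if y \<in> F then 0 else ?A)\<^sup>2 * (1 + 3 * pmf p y) ^ m \<le> pmf p y * (?A\<^sup>2 * exp (3 * B * real m))"
    proof (cases "y \<in> F")
      case False
      have "1 + 3 * pmf p y \<le> exp (3 * pmf p y)" by (rule exp_ge_add_one_self)
      also have "\<dots> \<le> exp (3 * B)" using small[OF y False] by simp
      finally have "(1 + 3 * pmf p y) ^ m \<le> exp (3 * B) ^ m" by (intro power_mono) auto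
      also have "\<dots> = exp (3 * B * real m)" by (simp add: mult.commute flip: exp_of_nat_mult)
      finally show ?thesis using False by (simp add: mult_left_mono mult.assoc)
    qed simp
  qed simp
  also have "\<dots> = real m * (?A\<^sup>2 * exp (3 * B * real m)) * measure_pmf.prob p Y"
    using Y by (simp add: measure_measure_pmf_finite sum_distrib_right mult_ac)
  also have "\<dots> \<le> real m * (?A\<^sup>2 * exp (3 * B * real m)) * 1"
    by (intro mult_left_mono) auto
  finally have var: "measure_pmf.variance ?R \<phi> \<le> real m * ?A\<^sup>2 * exp (3 * B * real m)" by (simp add: mult.assoc)
  have "measure_pmf.prob ?R {ys \<in> space ?R. t \<le> \<bar>\<phi> ys - measure_pmf.expectation ?R \<phi>\<bar>}
      \<le> measure_pmf.variance ?R \<phi> / t\<^sup>2"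
    by (rule measure_pmf.Chebyshev_inequality) (auto intro: int t)
  also have "\<dots> \<le> real m * ?A\<^sup>2 * exp (3 * B * real m) / t\<^sup>2"
    using var by (intro divide_right_mono) auto
  finally show ?thesis by (simp add: mean)
qed

lemma prob_unseen:
  assumes fin: "finite (set_pmf p)" and Y: "finite Y" and B: "0 \<le> B"
  shows "measure_pmf.prob (replicate_pmf n p) {xs. \<exists>y\<in>Y. B \<le> pmf p y \<and> y \<notin> set xs}
    \<le> real (card Y) * exp (- (B * real n))"
proof -
  have one: "measure_pmf.prob (replicate_pmf n p) {xs. y \<notin> set xs} = (1 - pmf p y) ^ n" for y
  proof -
    have "measure_pmf.prob (replicate_pmf n p) {xs. y \<notin> set xs}
        = measure_pmf.expectation (replicate_pmf n p) (indicator {xs. y \<notin> set xs})" by simp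
    \<comment> \<open>With \<open>0^0 = 1\<close>, absence of a letter is the case
      \<open>z = 0\<close> of \<open>expectation_replicate_power\<close>.\<close>
    also have "\<dots> = measure_pmf.expectation (replicate_pmf n p) (\<lambda>xs. 0 ^ count_list xs y)"
      by (intro Bochner_Integration.integral_cong) (auto simp: indicator_def power_0_left count_list_0_iff)
    finally show ?thesis by (simp add: expectation_replicate_power[OF fin])
  qed
  let ?Y = "{y \<in> Y. B \<le> pmf p y}"
  have "measure_pmf.prob (replicate_pmf n p) {xs. \<exists>y\<in>Y. B \<le> pmf p y \<and> y \<notin> set xs}
      = measure_pmf.prob (replicate_pmf n p) (\<Union>y\<in>?Y. {xs. y \<notin> set xs})"
    by (intro arg_cong[where f = "measure_pmf.prob _"]) auto
  also have "\<dots> \<le> (\<Sum>y\<in>?Y. measure_pmf.prob (replicate_pmf n p) {xs. y \<notin> set xs})"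
    by (rule measure_pmf.finite_measure_subadditive_finite) (use Y in auto)
  also have "\<dots> \<le> (\<Sum>y\<in>?Y. exp (- (B * real n)))"
  proof (rule sum_mono)
    fix y assume y: "y \<in> ?Y"
    have "1 - pmf p y \<le> exp (- pmf p y)" using exp_ge_add_one_self[of "- pmf p y"] by simp
    also have "\<dots> \<le> exp (- B)" using y by simp
    finally have "(1 - pmf p y) ^ n \<le> exp (- B) ^ n" by (intro power_mono) (auto simp: pmf_le_1)
    then show "measure_pmf.prob (replicate_pmf n p) {xs. y \<notin> set xs} \<le> exp (- (B * real n))"
      unfolding one by (simp add: mult.commute flip: exp_of_nat_mult)
  qed
  also have "\<dots> \<le> real (card Y) * exp (- (B * real n))"
    using card_mono[OF Y, of ?Y] by (simp add: mult_right_mono)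
  finally show ?thesis .
qed

section \<open>Functions with at most \<open>d\<close> ones\<close>

definition sparse_class :: "nat \<Rightarrow> (nat \<Rightarrow> bool) set" where
  "sparse_class d = {f \<in> {..<6 * d} \<rightarrow>\<^sub>E UNIV. card {x \<in> {..<6 * d}. f x} \<le> d}"

lemma shatters_sparse_class:
  assumes "A \<subseteq> {..<6 * d}"
  shows "shatters (sparse_class d) A \<longleftrightarrow> card A \<le> d"
proof
  assume *: "shatters (sparse_class d) A"
  obtain f where f: "f \<in> sparse_class d" "\<forall>x\<in>A. f x"
    using *[unfolded shatters_def, THEN conjunct2, rule_format, of "\<lambda>_. True"] by auto
  have "card A \<le> card {x \<in> {..<6 * d}. f x}" using assms f(2) by (intro card_mono) auto
  then show "card A \<le> d" using f(1) by (simp add: sparse_class_def)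
next
  assume le: "card A \<le> d"
  have fin: "finite A" using assms finite_subset by auto
  show "shatters (sparse_class d) A"
    unfolding shatters_def
  proof (intro conjI allI fin)
    fix l :: "nat \<Rightarrow> bool"
    define f where "f = (\<lambda>x\<in>{..<6 * d}. x \<in> A \<and> l x)"
    have "card {x \<in> {..<6 * d}. f x} \<le> card A" using fin by (intro card_mono) (auto simp: f_def)
    then have "f \<in> sparse_class d" using le by (auto simp: sparse_class_def f_def)
    moreover have "\<forall>x\<in>A. f x = l x" using assms by (auto simp: f_def)
    ultimately show "\<exists>f\<in>sparse_class d. \<forall>x\<in>A. f x = l x" by blast
  qed
qed

text \<open>Shattering depends on cardinality alone here, so both dimensions equal \<open>d\<close>
  and the rate becomes \<open>d / ln d\<close>. The domain size \<open>6 * d\<close> meets the size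
  condition in \<open>admissible\<close>.\<close>

lemma VC_LVC_sparse_class:
  assumes "d > 0"
  shows "VC {..<6 * d} (sparse_class d) = enat d" "LVC {..<6 * d} (sparse_class d) = enat d"
proof -
  let ?X = "{..<6 * d}"
  show V: "VC ?X (sparse_class d) = enat d"
  proof (rule antisym)
    show "VC ?X (sparse_class d) \<le> enat d"
      unfolding VC_def by (intro Sup_least) (auto simp: shatters_sparse_class)
    show "enat d \<le> VC ?X (sparse_class d)"
      using VC_ge[of "{..<d}" ?X "sparse_class d"] shatters_sparse_class[of "{..<d}" d] assms by auto
  qed
  show "LVC ?X (sparse_class d) = enat d"
  proof (rule antisym)
    show "LVC ?X (sparse_class d) \<le> enat d"
      using LVC_le_VC[of ?X "sparse_class d"] V assms by (simp add: zero_enat_def)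
    show "enat d \<le> LVC ?X (sparse_class d)"
      by (rule LVC_ge) (auto simp: shatters_sparse_class)
  qed
qed

text \<open>Otherwise some sparse function is too near: it keeps all ones of mass above
  \<open>1 / d\<close>, of which there are at most \<open>d\<close>, and fills up with others. Fewer
  than \<open>\<epsilon> * d / 2\<close> relevant ones are dropped, each of mass at most
  \<open>1 / d\<close>, and the points of mass below \<open>\<epsilon> / (12 * d)\<close> weigh at
  most \<open>\<epsilon> / 2\<close> in total.\<close>

lemma far_from_sparse:
  assumes D: "set_pmf D \<subseteq> {..<6 * d}" and d: "d > 0" and eps: "0 < \<epsilon>"
    and far: "\<epsilon> \<le> dist_class D f (sparse_class d)"
  shows "(1 + \<epsilon> / 2) * real d \<le> real (card {i \<in> {..<6 * d}. f i \<and> \<epsilon> / (12 * real d) \<le> pmf D i})"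
proof (rule ccontr)
  define a where "a = \<epsilon> / (12 * real d)"
  define I where "I = {i \<in> {..<6 * d}. f i \<and> a \<le> pmf D i}"
  assume "\<not> ?thesis"
  then have cI: "real (card I) < (1 + \<epsilon> / 2) * real d" by (simp add: I_def a_def)
  have finI: "finite I" by (simp add: I_def)
  have a0: "a > 0" using eps d by (simp add: a_def)
  obtain I' where I': "I' \<subseteq> I" "card I' \<le> d" and rest: "(\<Sum>i\<in>I - I'. pmf D i) < \<epsilon> / 2"
  proof (cases "card I \<le> d")
    case True
    then show ?thesis using that[of I] eps by simp
  next
    case False
    define J where "J = {i \<in> I. 1 / real d < pmf D i}"
    have JI: "J \<subseteq> I" and finJ: "finite J" using finI by (auto simp: J_def)
    have "real (card J) * (1 / real d) = (\<Sum>i\<in>J. 1 / real d)" by simp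
    also have "\<dots> \<le> (\<Sum>i\<in>J. pmf D i)" by (intro sum_mono) (auto simp: J_def)
    also have "\<dots> \<le> 1" using finJ measure_pmf.prob_le_1[of D J] by (simp add: measure_measure_pmf_finite)
    finally have "card J \<le> d" using d by (simp add: field_simps)
    then obtain I' where I': "J \<subseteq> I'" "I' \<subseteq> I" "card I' = d"
      using exists_subset_between[of J d I] False JI finI by auto
    have finI': "finite I'" using I' finI finite_subset by auto
    have "(\<Sum>i\<in>I - I'. pmf D i) \<le> (\<Sum>i\<in>I - I'. 1 / real d)"
      using I'(1) by (intro sum_mono) (fastforce simp: J_def)
    also have "\<dots> = (real (card I) - real d) / real d"
      using I' finI' False by (simp add: card_Diff_subset of_nat_diff)
    also have "\<dots> < \<epsilon> / 2" using cI d by (simp add: field_simps)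
    finally show ?thesis using that[of I'] I' by simp
  qed
  define h where "h = (\<lambda>x\<in>{..<6 * d}. x \<in> I')"
  have "{x \<in> {..<6 * d}. h x} = I'" using I'(1) by (auto simp: h_def I_def)
  then have "h \<in> sparse_class d" using I'(2) by (simp add: sparse_class_def) (simp add: h_def)
  then have "dist_class D f (sparse_class d) \<le> dist_fun D f h"
    unfolding dist_class_def by (intro cINF_lower bdd_belowI[of _ 0]) (auto simp: dist_fun_def)
  also have "\<dots> \<le> measure_pmf.prob D ((I - I') \<union> {i \<in> {..<6 * d}. pmf D i < a})"
    unfolding dist_fun_def
  proof (rule measure_pmf.finite_measure_mono_AE)
    show "AE x in D. x \<in> {x. f x \<noteq> h x} \<longrightarrow> x \<in> (I - I') \<union> {i \<in> {..<6 * d}. pmf D i < a}"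
      using D I'(1) by (auto simp: AE_measure_pmf_iff h_def I_def subset_iff)
  qed simp
  also have "\<dots> \<le> (\<Sum>i\<in>I - I'. pmf D i) + (\<Sum>i\<in>{i \<in> {..<6 * d}. pmf D i < a}. pmf D i)"
    using finI by (intro order_trans[OF measure_Un_le]) (auto simp: measure_measure_pmf_finite)
  also have "(\<Sum>i\<in>{i \<in> {..<6 * d}. pmf D i < a}. pmf D i) \<le> (\<Sum>i\<in>{i \<in> {..<6 * d}. pmf D i < a}. a)"
    by (intro sum_mono) auto
  also have "\<dots> \<le> real (6 * d) * a"
  proof -
    have "card {i \<in> {..<6 * d}. pmf D i < a} \<le> card {..<6 * d}" by (intro card_mono) auto
    then have "real (card {i \<in> {..<6 * d}. pmf D i < a}) \<le> real (6 * d)" by simp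
    then show ?thesis using a0 by simp
  qed
  also have "\<dots> = \<epsilon> / 2" using d by (simp add: a_def)
  finally show False using rest far by simp
qed

text \<open>Each numerical hypothesis feeds one step: \<open>deg\<close> makes the threshold
  polynomial accurate to \<open>\<epsilon> / 16\<close>, \<open>var\<close> bounds the failure
  probability in Chebyshev's inequality by 1/6, and \<open>unseen\<close> bounds by 1/6 the
  probability that the first sample misses a heavy letter. The first sample is the longer one
  because missing any of \<open>6 * d\<close> letters must be unlikely.\<close>

lemma ex_sparse_tester:
  fixes d L m :: nat
  assumes d: "d > 0" and eps: "0 < \<epsilon>" "\<epsilon> \<le> 1" and L: "1 \<le> L" "L \<le> m" and m: "m \<le> d"
    and deg: "384 * real d \<le> \<epsilon>\<^sup>2 * real L * real m"
    and var: "384 * real m * 100 ^ L * exp (12 * real L) \<le> \<epsilon>\<^sup>2 * (real d)\<^sup>2"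
    and unseen: "36 * real d * exp (- (144 * real L)) \<le> 1"
  shows "\<exists>A. is_tester {..<6 * d} (sparse_class d) \<epsilon> (36 * m + m) A"
proof -
  define a where "a = \<epsilon> / (12 * real d)"
  \<comment> \<open>The least value for which \<open>z = L / m\<close> meets the requirement
    \<open>4 * z <= B\<close> of \<open>ex_threshold_poly\<close>.\<close>
  define B where "B = 4 * real L / real m"
  define \<tau> where "\<tau> = \<epsilon> / 16"
  have m0: "m > 0" using L by simp
  have a0: "a > 0" using eps d by (simp add: a_def)
  have B0: "B > 0" using L m0 by (simp add: B_def)
  have aB: "2 * a \<le> B"
  proof -
    have "2 * a = (\<epsilon> / 6) / real d" by (simp add: a_def)
    also have "\<dots> \<le> (4 * real L) / real m" using eps L m m0 by (intro frac_le) auto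
    finally show ?thesis by (simp add: B_def)
  qed
  have LB: "1 \<le> \<tau> * (real L ^ 2 * (2 * a / B))"
  proof -
    have "\<tau> * (real L ^ 2 * (2 * a / B)) = \<epsilon>\<^sup>2 * real L * real m / (384 * real d)"
      using L m0 d by (simp add: \<tau>_def a_def B_def field_simps power2_eq_square)
    also have "\<dots> \<ge> 1" using deg d by simp
    finally show ?thesis .
  qed
  obtain q where q: "degree q \<le> L" "poly q 0 = 0" "poly_norm (real L / real m) q \<le> 1 + 9 ^ L"
    "\<And>x. 0 \<le> x \<Longrightarrow> x \<le> B \<Longrightarrow> 0 \<le> poly q x \<and> poly q x \<le> 1 + \<tau>"
    "\<And>x. a \<le> x \<Longrightarrow> x \<le> B \<Longrightarrow> 1 - \<tau> \<le> poly q x"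
    by (rule ex_threshold_poly[OF a0 aB, of "real L / real m" \<tau> L])
      (use LB eps in \<open>auto simp: B_def \<tau>_def\<close>)
  \<comment> \<open>Only positively labelled examples are counted: the letter
    \<open>(i, True)\<close> has mass \<open>pmf D i\<close> if \<open>f i\<close> holds and 0
    otherwise.\<close>
  define Y :: "(nat \<times> bool) set" where "Y = (\<lambda>i. (i, True)) ` {..<6 * d}"
  have Y: "finite Y" "card Y = 6 * d" by (auto simp: Y_def card_image inj_on_def)
  define Z where "Z xs ys = (\<Sum>y\<in>Y. if y \<in> set xs then 1 else binom_estimator m q (count_list ys y))"
    for xs ys :: "(nat \<times> bool) list"
  \<comment> \<open>The mean of \<open>Z\<close> is at most \<open>(1 + \<epsilon>/16) * d\<close>
    for members and at least \<open>(1 - \<epsilon>/16) * (1 + \<epsilon>/2) * d\<close> for far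
    functions; \<open>thr\<close> has distance at least \<open>t = \<epsilon> * d / 8\<close> from
    both.\<close>
  define thr where "thr = (1 + \<epsilon> / 4) * real d"
  define A where "A zs = return_pmf (Z (take (36 * m) zs) (drop (36 * m) zs) \<le> thr)" for zs
  define t where "t = \<epsilon> * real d / 8"
  have t0: "t > 0" using eps d by (simp add: t_def)
  have "is_tester {..<6 * d} (sparse_class d) \<epsilon> (36 * m + m) A"
    unfolding is_tester_def
  proof (intro allI impI)
    fix D :: "nat pmf" and f :: "nat \<Rightarrow> bool"
    assume D: "set_pmf D \<subseteq> {..<6 * d}"
    define E where "E = map_pmf (\<lambda>x. (x, f x)) D"
    have finE: "finite (set_pmf E)" using D finite_subset by (auto simp: E_def)
    have \<pi>: "pmf E (i, True) = (if f i then pmf D i else 0)" for i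
    proof -
      have "(\<lambda>x. (x, f x)) -` {(i, True)} = (if f i then {i} else {})" by auto
      then show ?thesis by (simp add: E_def pmf_map measure_pmf_single)
    qed
    define K where "K xs = map_pmf (\<lambda>ys. Z xs ys \<le> thr) (replicate_pmf m E)" for xs
    have run: "run_tester A (36 * m + m) D f = bind_pmf (replicate_pmf (36 * m) E) K"
      unfolding run_tester_def E_def[symmetric] replicate_pmf_distrib bind_assoc_pmf
    proof (rule bind_pmf_cong[OF refl])
      fix xs assume "xs \<in> set_pmf (replicate_pmf (36 * m) E)"
      then have "length xs = 36 * m" by (simp add: set_replicate_pmf)
      then show "bind_pmf (replicate_pmf m E) (\<lambda>ys. bind_pmf (return_pmf (xs @ ys)) A) = K xs"
        by (simp add: K_def map_pmf_def bind_return_pmf A_def)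
    qed
    have K_True: "pmf (K xs) True = measure_pmf.prob (replicate_pmf m E) {ys. Z xs ys \<le> thr}" for xs
      by (simp add: K_def pmf_map vimage_def)
    define bad where "bad = {xs. \<exists>y\<in>Y. B \<le> pmf E y \<and> y \<notin> set xs}"
    have bad: "measure_pmf.prob (replicate_pmf (36 * m) E) bad \<le> 1 / 6"
    proof -
      have "measure_pmf.prob (replicate_pmf (36 * m) E) bad \<le> real (card Y) * exp (- (B * real (36 * m)))"
        unfolding bad_def using B0 by (intro prob_unseen finE Y) auto
      also have "B * real (36 * m) = 144 * real L" using m0 by (simp add: B_def)
      finally show ?thesis using unseen Y by simp
    qed
    define \<mu> where "\<mu> xs = (\<Sum>y\<in>Y. if y \<in> set xs then 1 else poly q (pmf E y))" for xs
    have \<mu>: "\<mu> xs = (\<Sum>i<6 * d. if (i, True) \<in> set xs then 1 else poly q (pmf E (i, True)))" for xs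
      unfolding \<mu>_def Y_def by (subst sum.reindex) (auto simp: inj_on_def)
    have conc: "measure_pmf.prob (replicate_pmf m E) {ys. t \<le> \<bar>Z xs ys - \<mu> xs\<bar>} \<le> 1 / 6"
      if xs: "xs \<notin> bad" for xs
    proof -
      have "measure_pmf.prob (replicate_pmf m E) {ys. t \<le> \<bar>Z xs ys - \<mu> xs\<bar>}
          \<le> real m * (poly_norm (real L / real m) q)\<^sup>2 * exp (3 * B * real m) / t\<^sup>2"
        unfolding Z_def \<mu>_def using xs B0
        by (intro support_statistic_concentration[where F = "set xs"] finE Y q(1) L m0 t0)
          (auto simp: bad_def)
      also have "3 * B * real m = 12 * real L" using m0 by (simp add: B_def)
      also have "real m * (poly_norm (real L / real m) q)\<^sup>2 * exp (12 * real L) / t\<^sup>2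
          \<le> real m * 100 ^ L * exp (12 * real L) / t\<^sup>2"
      proof -
        have "(1::real) + 9 ^ L \<le> 10 ^ L"
        proof -
          obtain L' where L': "L = Suc L'" using L by (cases L) auto
          have "(1::real) \<le> 9 ^ L'" "(9::real) ^ L' \<le> 10 ^ L'" by (auto intro: power_mono)
          then show ?thesis unfolding L' power_Suc by linarith
        qed
        moreover have "0 \<le> poly_norm (real L / real m) q" unfolding poly_norm_def by (auto intro!: sum_nonneg)
        ultimately have "(poly_norm (real L / real m) q)\<^sup>2 \<le> (10 ^ L)\<^sup>2"
          using q(3) by (intro power_mono) auto
        also have "((10::real) ^ L)\<^sup>2 = (10\<^sup>2) ^ L" by (simp only: power_mult[symmetric] mult.commute)
        finally have "(poly_norm (real L / real m) q)\<^sup>2 \<le> 100 ^ L" by simp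
        then show ?thesis by (intro divide_right_mono mult_right_mono mult_left_mono) auto
      qed
      also have "\<dots> \<le> 1 / 6"
        using var eps d by (simp add: t_def power_divide power_mult_distrib field_simps)
      finally show ?thesis .
    qed
    have accept: "2 / 3 \<le> pmf (run_tester A (36 * m + m) D f) True" if fH: "f \<in> sparse_class d"
    proof -
      have "5 / 6 \<le> pmf (K xs) True" if xs: "xs \<in> set_pmf (replicate_pmf (36 * m) E)" "xs \<notin> bad" for xs
      proof -
        \<comment> \<open>Points labelled 0 drop out, as their letter is never seen and
          \<open>q\<close> vanishes at 0. An unseen letter of a good sample has mass below
          \<open>B\<close>, the range in which \<open>q\<close> is controlled.\<close>
        have "\<mu> xs \<le> (\<Sum>i<6 * d. if f i then 1 + \<tau> else 0)"
          unfolding \<mu>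
        proof (rule sum_mono)
          fix i assume i: "i \<in> {..<6 * d}"
          have "(i, True) \<notin> set xs" if "\<not> f i"
            using xs(1) that by (auto simp: set_replicate_pmf E_def)
          moreover have "pmf E (i, True) \<le> B" if "(i, True) \<notin> set xs"
          proof -
            have "\<not> B \<le> pmf E (i, True)" using xs(2) i that by (auto simp: bad_def Y_def)
            then show ?thesis by simp
          qed
          ultimately show "(if (i, True) \<in> set xs then 1 else poly q (pmf E (i, True))) \<le> (if f i then 1 + \<tau> else 0)"
            using q(2) q(4)[of "pmf E (i, True)"] \<pi>[of i] eps by (auto simp: \<tau>_def)
        qed
        also have "\<dots> = real (card {i \<in> {..<6 * d}. f i}) * (1 + \<tau>)"
          by (simp add: sum.If_cases Int_def)
        also have "\<dots> \<le> real d * (1 + \<tau>)"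
          using fH eps by (intro mult_right_mono) (auto simp: sparse_class_def \<tau>_def)
        finally have \<mu>le: "\<mu> xs \<le> real d * (1 + \<tau>)" .
        have gap: "t \<le> thr - real d * (1 + \<tau>)"
          using eps d by (simp add: t_def thr_def \<tau>_def algebra_simps)
        have "1 - pmf (K xs) True = measure_pmf.prob (replicate_pmf m E) (- {ys. Z xs ys \<le> thr})"
          unfolding K_True using measure_pmf.prob_compl[of "{ys. Z xs ys \<le> thr}" "replicate_pmf m E"] by (simp add: Compl_eq_Diff_UNIV)
        also have "\<dots> \<le> measure_pmf.prob (replicate_pmf m E) {ys. t \<le> \<bar>Z xs ys - \<mu> xs\<bar>}"
          using \<mu>le gap by (intro measure_pmf.finite_measure_mono) auto
        also have "\<dots> \<le> 1 / 6" by (rule conc[OF xs(2)])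
        finally show ?thesis by simp
      qed
      then have "5 / 6 - measure_pmf.prob (replicate_pmf (36 * m) E) bad \<le> pmf (run_tester A (36 * m + m) D f) True"
        unfolding run by (rule pmf_bind_ge) auto
      then show ?thesis using bad by simp
    qed
    have reject: "2 / 3 \<le> pmf (run_tester A (36 * m + m) D f) False" if far: "\<epsilon> \<le> dist_class D f (sparse_class d)"
    proof -
      define I where "I = {i \<in> {..<6 * d}. f i \<and> a \<le> pmf D i}"
      have I: "(1 + \<epsilon> / 2) * real d \<le> real (card I)"
        unfolding I_def a_def by (rule far_from_sparse[OF D d eps(1) far])
      have "pmf (K xs) True \<le> 1 / 6" if xs: "xs \<in> set_pmf (replicate_pmf (36 * m) E)" "xs \<notin> bad" for xs
      proof -
        have "(1 - \<tau>) * ((1 + \<epsilon> / 2) * real d) \<le> (1 - \<tau>) * real (card I)"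
          using I eps by (intro mult_left_mono) (auto simp: \<tau>_def)
        also have "\<dots> = (\<Sum>i\<in>I. 1 - \<tau>)" by simp
        also have "\<dots> = (\<Sum>i<6 * d. if i \<in> I then 1 - \<tau> else 0)"
          by (intro sum.mono_neutral_cong_left) (auto simp: I_def)
        also have "\<dots> \<le> \<mu> xs"
          unfolding \<mu>
        proof (rule sum_mono)
          fix i assume i: "i \<in> {..<6 * d}"
          have "pmf E (i, True) \<le> B" if "(i, True) \<notin> set xs"
          proof -
            have "\<not> B \<le> pmf E (i, True)" using xs(2) i that by (auto simp: bad_def Y_def)
            then show ?thesis by simp
          qed
          then show "(if i \<in> I then 1 - \<tau> else 0) \<le> (if (i, True) \<in> set xs then 1 else poly q (pmf E (i, True)))"
            using q(4)[of "pmf E (i, True)"] q(5)[of "pmf E (i, True)"] \<pi>[of i] eps by (auto simp: \<tau>_def I_def)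
        qed
        finally have \<mu>ge: "(1 - \<tau>) * ((1 + \<epsilon> / 2) * real d) \<le> \<mu> xs" .
        have gap: "t \<le> (1 - \<tau>) * ((1 + \<epsilon> / 2) * real d) - thr"
        proof -
          have "\<epsilon> * \<epsilon> \<le> \<epsilon> * 1" using eps by (intro mult_left_mono) auto
          moreover have "(1 - \<tau>) * (1 + \<epsilon> / 2) - (1 + \<epsilon> / 4) = 3 / 16 * \<epsilon> - 1 / 32 * (\<epsilon> * \<epsilon>)"
            by (simp add: \<tau>_def field_simps)
          ultimately have "\<epsilon> / 8 \<le> (1 - \<tau>) * (1 + \<epsilon> / 2) - (1 + \<epsilon> / 4)" using eps by linarith
          then have "\<epsilon> / 8 * real d \<le> ((1 - \<tau>) * (1 + \<epsilon> / 2) - (1 + \<epsilon> / 4)) * real d"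
            by (intro mult_right_mono) auto
          also have "\<dots> = (1 - \<tau>) * ((1 + \<epsilon> / 2) * real d) - thr"
            unfolding thr_def by algebra
          finally show ?thesis by (simp add: t_def)
        qed
        have "pmf (K xs) True \<le> measure_pmf.prob (replicate_pmf m E) {ys. t \<le> \<bar>Z xs ys - \<mu> xs\<bar>}"
          unfolding K_True using \<mu>ge gap by (intro measure_pmf.finite_measure_mono) auto
        also have "\<dots> \<le> 1 / 6" by (rule conc[OF xs(2)])
        finally show ?thesis .
      qed
      then have "pmf (run_tester A (36 * m + m) D f) True \<le> 1 / 6 + measure_pmf.prob (replicate_pmf (36 * m) E) bad"
        unfolding run by (rule pmf_bind_le) auto
      then show ?thesis using bad by (simp add: pmf_False_conv_True)
    qed
    show "(f \<in> sparse_class d \<longrightarrow> 2 / 3 \<le> pmf (run_tester A (36 * m + m) D f) True) \<and>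
        (\<epsilon> \<le> dist_class D f (sparse_class d) \<longrightarrow> 2 / 3 \<le> pmf (run_tester A (36 * m + m) D f) False)"
      using accept reject by blast
  qed
  then show ?thesis by blast
qed

section \<open>Choice of parameters and assembly of the theorem\<close>

lemma m_test_sparse_class_le:
  assumes eps: "0 < \<epsilon>" "\<epsilon> \<le> 1"
  shows "\<exists>b>0. eventually (\<lambda>d. ereal_of_enat (m_test {..<6 * d} (sparse_class d) \<epsilon>)
    \<le> ereal (b * (real d / ln (real d)))) sequentially"
proof -
  define c where "c = 384 / \<epsilon>\<^sup>2"
  have c: "c \<ge> 384" using eps by (simp add: c_def field_simps power_le_one)
  define b where "b = 37 * (72 * c + 1)"
  have "eventually (\<lambda>d. real d \<ge> 72 * c * real d / ln (real d) + 1) sequentially"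
    using c by real_asymp
  moreover have "eventually (\<lambda>d. (ln (real d))\<^sup>2 \<le> real d) sequentially" by real_asymp
  moreover have "eventually (\<lambda>d. ln (real d) \<ge> 72) sequentially" by real_asymp
  moreover have "eventually (\<lambda>d. c * sqrt (real d) \<le> real d) sequentially"
    using c by real_asymp
  moreover have "eventually (\<lambda>d. d \<ge> (36 :: nat)) sequentially" by (rule eventually_ge_at_top)
  ultimately have "eventually (\<lambda>d. ereal_of_enat (m_test {..<6 * d} (sparse_class d) \<epsilon>)
    \<le> ereal (b * (real d / ln (real d)))) sequentially"
  proof eventually_elim
    case (elim d)
    define x where "x = ln (real d)"
    have x: "x \<ge> 72" "x\<^sup>2 \<le> real d" "72 * c * real d / x + 1 \<le> real d"
      using elim by (auto simp: x_def)
    have d0: "d > 0" using elim by simp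
    have dx: "real d = exp x" using d0 by (simp add: x_def)
    \<comment> \<open>As \<open>100 <= exp 6\<close>, the variance factor is at most
      \<open>exp (18 * L)\<close>, which \<open>L <= x / 36\<close> keeps below
      \<open>sqrt d\<close>. Rounding down loses at most a factor 2, hence the 72. The value of
      \<open>m\<close> below is then the least that \<open>deg\<close> permits.\<close>
    define L where "L = nat \<lfloor>x / 36\<rfloor>"
    have L: "x / 72 \<le> real L" "real L \<le> x / 36" "1 \<le> real L"
      using x(1) unfolding L_def by linarith+
    define m where "m = nat \<lceil>c * real d / real L\<rceil>"
    have cd: "c * real d / real L > 0" using c d0 L by (intro divide_pos_pos mult_pos_pos) auto
    have m: "c * real d / real L \<le> real m" "real m \<le> c * real d / real L + 1"
      using cd unfolding m_def by linarith+
    have "c * real d / real L \<le> c * real d / (x / 72)"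
      using c d0 L x by (intro divide_left_mono mult_pos_pos) auto
    then have m_le: "real m \<le> 72 * c * real d / x + 1" using m by (simp add: mult_ac)
    then have md: "m \<le> d" using x(3) by linarith
    have "real L \<le> real m"
    proof -
      have "real L * real L \<le> x * x" using L x by (intro mult_mono) auto
      also have "\<dots> \<le> real d" using x by (simp add: power2_eq_square)
      also have "\<dots> \<le> c * real d" using mult_right_mono[of 1 c "real d"] c by simp
      finally have "real L \<le> c * real d / real L" using L by (simp add: field_simps)
      then show ?thesis using m by linarith
    qed
    then have Lm: "L \<le> m" by simp
    have deg: "384 * real d \<le> \<epsilon>\<^sup>2 * real L * real m"
    proof -
      have "384 * real d = \<epsilon>\<^sup>2 * real L * (c * real d / real L)"
        using eps L by (simp add: c_def)
      also have "\<dots> \<le> \<epsilon>\<^sup>2 * real L * real m" using m by (intro mult_left_mono) auto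
      finally show ?thesis .
    qed
    have var: "384 * real m * 100 ^ L * exp (12 * real L) \<le> \<epsilon>\<^sup>2 * (real d)\<^sup>2"
    proof -
      have "(100::real) \<le> (5 / 2) ^ 6" by (simp add: power_divide)
      also have "\<dots> \<le> exp 1 ^ 6"
        using exp_lower_Taylor_quadratic[of "1::real"] by (intro power_mono) auto
      also have "\<dots> = exp 6" by (simp flip: exp_of_nat_mult)
      finally have "(100::real) ^ L \<le> exp 6 ^ L" by (intro power_mono) auto
      also have "\<dots> = exp (6 * real L)" by (simp add: mult.commute flip: exp_of_nat_mult)
      finally have "100 ^ L * exp (12 * real L) \<le> exp (6 * real L) * exp (12 * real L)"
        by (intro mult_right_mono) auto
      also have "\<dots> = exp (18 * real L)" by (simp flip: exp_add)
      also have "\<dots> \<le> exp (x / 2)" using L by simp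
      also have "\<dots> = sqrt (real d)"
        unfolding dx by (rule real_sqrt_unique[symmetric]) (simp_all add: power2_eq_square flip: exp_add)
      finally have "384 * real m * (100 ^ L * exp (12 * real L)) \<le> 384 * real d * sqrt (real d)"
        using md by (intro mult_mono) auto
      also have "\<dots> = \<epsilon>\<^sup>2 * real d * (c * sqrt (real d))"
        using eps by (simp add: c_def)
      also have "\<dots> \<le> \<epsilon>\<^sup>2 * real d * real d" using elim by (intro mult_left_mono) auto
      finally show ?thesis by (simp add: power2_eq_square mult_ac)
    qed
    have unseen: "36 * real d * exp (- (144 * real L)) \<le> 1"
    proof -
      have "exp (- (144 * real L)) \<le> exp (- (2 * x))" using L by simp
      then have "36 * real d * exp (- (144 * real L)) \<le> 36 * real d * exp (- (2 * x))"
        by (intro mult_left_mono) auto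
      also have "\<dots> = 36 * exp (- x)" unfolding dx by (simp flip: exp_add)
      also have "\<dots> = 36 / real d" unfolding dx by (simp add: exp_minus field_simps)
      also have "\<dots> \<le> 1" using elim d0 by simp
      finally show ?thesis .
    qed
    obtain A where "is_tester {..<6 * d} (sparse_class d) \<epsilon> (36 * m + m) A"
      using ex_sparse_tester[OF d0 eps _ Lm md deg var unseen] L by auto
    then have "m_test {..<6 * d} (sparse_class d) \<epsilon> \<le> enat (36 * m + m)" by (rule m_test_le)
    then have "ereal_of_enat (m_test {..<6 * d} (sparse_class d) \<epsilon>) \<le> ereal_of_enat (enat (36 * m + m))"
      by (simp only: ereal_of_enat_le_iff)
    also have "\<dots> = ereal (37 * real m)" by simp
    also have "37 * real m \<le> b * (real d / x)"
    proof -
      have "x \<le> real d" using ln_bound[of "real d"] d0 by (simp add: x_def)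
      then have "1 \<le> real d / x" using x by simp
      then have "37 * real m \<le> 37 * (72 * c * (real d / x) + real d / x)" using m_le by simp
      also have "\<dots> = b * (real d / x)" by (simp add: b_def add_divide_distrib algebra_simps)
      finally show ?thesis .
    qed
    finally show ?case by (simp add: x_def)
  qed
  moreover have "b > 0" using c by (simp add: b_def)
  ultimately show ?thesis by blast
qed

lemma tightness:
  assumes lb: "lower_bound TYPE(nat) C c \<epsilon>\<^sub>0" and pos: "C > 0" "c > 0" "\<epsilon>\<^sub>0 > 0"
  shows "lower_bound_tight C"
  unfolding lower_bound_tight_def
\<comment> \<open>The lower half of the estimate needs
  \<open>\<epsilon> < \<epsilon>\<^sub>0\<close>, the tester \<open>\<epsilon> <= 1\<close>.\<close>
proof (rule exI[of _ "min \<epsilon>\<^sub>0 1"], intro conjI allI impI)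
  fix \<epsilon> :: real assume eps: "0 < \<epsilon> \<and> \<epsilon> < min \<epsilon>\<^sub>0 1"
  obtain b where b: "b > 0" "eventually (\<lambda>d. ereal_of_enat (m_test {..<6 * d} (sparse_class d) \<epsilon>)
    \<le> ereal (b * (real d / ln (real d)))) sequentially"
    using m_test_sparse_class_le[of \<epsilon>] eps by auto
  have ev: "eventually (\<lambda>d. C * real d powr (3 / 4) * sqrt (ln (real d)) \<le> real d) sequentially"
    using pos by real_asymp
  have "\<exists>(X :: nat set) H S. admissible C X H S \<and> enat N \<le> VC S H \<and>
           ereal (c * rate H S) \<le> ereal_of_enat (m_test X H \<epsilon>) \<and>
           ereal_of_enat (m_test X H \<epsilon>) \<le> ereal (b * rate H S)" for N
  proof -
    have "eventually (\<lambda>d. C * real d powr (3 / 4) * sqrt (ln (real d)) \<le> real d \<and>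
      ereal_of_enat (m_test {..<6 * d} (sparse_class d) \<epsilon>) \<le> ereal (b * (real d / ln (real d))) \<and>
      max N 2 \<le> d) sequentially"
      using ev b(2) eventually_ge_at_top[of "max N 2"] by eventually_elim simp
    then obtain d where d: "C * real d powr (3 / 4) * sqrt (ln (real d)) \<le> real d"
      "ereal_of_enat (m_test {..<6 * d} (sparse_class d) \<epsilon>) \<le> ereal (b * (real d / ln (real d)))"
      "max N 2 \<le> d"
      by (auto simp: eventually_sequentially)
    have d0: "d > 0" using d by simp
    note V = VC_LVC_sparse_class[OF d0]
    have rate: "rate (sparse_class d) {..<6 * d} = real d / ln (real d)"
      using d0 by (simp add: rate_def V power2_eq_square)
    have adm: "admissible C {..<6 * d} (sparse_class d) {..<6 * d}"
      unfolding admissible_def V using d d0 by (auto simp: sparse_class_def numeral_eq_enat)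
    then have "ereal (c * rate (sparse_class d) {..<6 * d}) \<le> ereal_of_enat (m_test {..<6 * d} (sparse_class d) \<epsilon>)"
      using lb[unfolded lower_bound_def, rule_format, OF adm, of \<epsilon>] eps by simp
    then show ?thesis
      using adm d V by (intro exI[of _ "{..<6 * d}"] exI[of _ "sparse_class d"]) (auto simp: rate)
  qed
  then show "\<exists>a>0. \<exists>b>0. \<forall>N :: nat. \<exists>(X :: nat set) H S.
           admissible C X H S \<and> enat N \<le> VC S H \<and>
           ereal (a * rate H S) \<le> ereal_of_enat (m_test X H \<epsilon>) \<and>
           ereal_of_enat (m_test X H \<epsilon>) \<le> ereal (b * rate H S)"
    using pos(2) b(1) by blast
qed (use pos in simp)

(* The constants are absolute, so they may not depend on the type of the domain elements, over
   which HOL cannot quantify inside the formula. Hence the constants are asserted to exist for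
   domains X :: nat set, and every such choice of constants is asserted to be valid for domains
   X :: 'x set over an arbitrary type 'x. *)
theorem theorem1p1:
  shows "(\<exists>C>0. \<exists>c>0. \<exists>\<epsilon>\<^sub>0>0. lower_bound TYPE(nat) C c \<epsilon>\<^sub>0 \<and> lower_bound_tight C) \<and>
    (\<forall>C>0. \<forall>c>0. \<forall>\<epsilon>\<^sub>0>0. lower_bound TYPE(nat) C c \<epsilon>\<^sub>0 \<longrightarrow> lower_bound TYPE('x) C c \<epsilon>\<^sub>0)"
proof (intro conjI allI impI)
  have "lower_bound_tight (2 * 10 ^ 6)"
    by (rule tightness[OF lower_bound_constants]) simp_all
  then show "\<exists>C>0. \<exists>c>0. \<exists>\<epsilon>\<^sub>0>0. lower_bound TYPE(nat) C c \<epsilon>\<^sub>0 \<and> lower_bound_tight C"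
    using lower_bound_constants
    by (intro exI[of _ "2 * 10 ^ 6"] exI[of _ "1 / 10 ^ 6"] exI[of _ "1 / 5000"] conjI) simp_all
  show "lower_bound TYPE('x) C c \<epsilon>\<^sub>0" if "C > 0" "lower_bound TYPE(nat) C c \<epsilon>\<^sub>0" for C c \<epsilon>\<^sub>0
    using lower_bound_transfer that by blast
qed

end
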